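(* Fix $k\ge1$. For $n\ge k$ let $\mathbf{S_{n,n}}=(S_{1,n},\dots,S_{n,n})^*$ be uniformly distributed on $\mathcal{M}_n(\mathbb{C})$ and $\mathbf{S_{k,n}}=(S_{1,n},\dots,S_{k,n})^*$ (a $kp\times p$ block column). Then $$\sqrt{8np}\,(A^{-1}\otimes I_p)(\mathbf{S_{k,n}}-\mathbf{S^0_k})\xrightarrow[n\to\infty]{\mathcal{D}}\mathbf{G}=(G_1,\dots,G_k)^*,$$ with $G_1,\dots,G_k$ i.i.d. GUE, $\mathbf{S^0_k}=(s^0_1I_p,\dots,s^0_kI_p)^*$, $s^0_j=2^{-2j}\binom{2j}{j}$, and $A$ the $k\times k$ lower triangular matrix with $a_{i,j}=2^{-2i+2}\binom{2i}{i-j}$ for $j\le i$, $a_{i,j}=0$ for $j>i$.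
   Context: $\mathcal{S}_p(\mathbb{C})$: complex hermitian $p\times p$ matrices with Lebesgue measure $dX=\prod_idx_{ii}\prod_{i<j}d\operatorname{Re}x_{ij}\,d\operatorname{Im}x_{ij}$. A complex matrix measure on $[0,1]$ is a $p\times p$ matrix of complex Borel measures with $\mu(B)$ hermitian nonnegative definite for every Borel $B$ and $\mu([0,1])=I_p$; $S_j=\int_0^1x^jd\mu$. $\mathcal{M}_n(\mathbb{C})\subset(\mathcal{S}_p(\mathbb{C}))^n$ is the set of moment vectors $(S_1,\dots,S_n)^*$, and the uniform distribution on it has density proportional to its indicator with respect to Lebesgue measure. $s^0_j=\int_0^1\frac{x^jdx}{\pi\sqrt{x(1-x)}}$ are the arcsine moments. $\otimes$ is the Kronecker product. GUE: density $(2\pi)^{-p/2}\pi^{-p(p-1)/2}e^{-\frac12\operatorname{tr}X^2}$ with respect to $dX$. *)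

theory Defs
  imports "HOL-Probability.Probability"
begin

text \<open>Hermitian p x p matrices are represented as functions nat => nat => complex
  whose entries vanish outside the index box {..<p} x {..<p}.\<close>

definition M01 :: "real measure" where
  "M01 = restrict_space borel {0..1}"

definition is_complex_measure :: "(real set \<Rightarrow> complex) \<Rightarrow> bool" where
  "is_complex_measure \<nu> \<longleftrightarrow> \<nu> {} = 0 \<and>
     (\<forall>A. range A \<subseteq> sets M01 \<longrightarrow> disjoint_family A \<longrightarrow>
          (\<lambda>n. \<nu> (A n)) sums \<nu> (\<Union>(range A)))"

text \<open>Integral of a (bounded measurable) real function against a complex measure,
  via a decomposition into finite positive measures (independent of the decomposition).\<close>
definition cm_integral :: "(real set \<Rightarrow> complex) \<Rightarrow> (real \<Rightarrow> real) \<Rightarrow> complex" where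
  "cm_integral \<nu> f = (THE z. \<exists>M1 M2 M3 M4 :: real measure.
      (\<forall>M\<in>{M1, M2, M3, M4}. sets M = sets M01 \<and> finite_measure M) \<and>
      (\<forall>B\<in>sets M01. \<nu> B = Complex (measure M1 B - measure M2 B) (measure M3 B - measure M4 B)) \<and>
      z = Complex ((\<integral>x. f x \<partial>M1) - (\<integral>x. f x \<partial>M2)) ((\<integral>x. f x \<partial>M3) - (\<integral>x. f x \<partial>M4)))"

definition hermitian_psd :: "nat \<Rightarrow> (nat \<Rightarrow> nat \<Rightarrow> complex) \<Rightarrow> bool" where
  "hermitian_psd p X \<longleftrightarrow> (\<forall>i<p. \<forall>j<p. X i j = cnj (X j i)) \<and>
     (\<forall>v :: nat \<Rightarrow> complex. 0 \<le> Re (\<Sum>i<p. \<Sum>j<p. cnj (v i) * X i j * v j))"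

definition matrix_measure :: "nat \<Rightarrow> (nat \<Rightarrow> nat \<Rightarrow> real set \<Rightarrow> complex) \<Rightarrow> bool" where
  "matrix_measure p \<mu> \<longleftrightarrow>
     (\<forall>i<p. \<forall>j<p. is_complex_measure (\<mu> i j)) \<and>
     (\<forall>B\<in>sets M01. hermitian_psd p (\<lambda>i j. \<mu> i j B)) \<and>
     (\<forall>i<p. \<forall>j<p. \<mu> i j {0..1} = (if i = j then 1 else 0))"

definition mat_moment :: "nat \<Rightarrow> (nat \<Rightarrow> nat \<Rightarrow> real set \<Rightarrow> complex) \<Rightarrow> nat \<Rightarrow> nat \<Rightarrow> nat \<Rightarrow> complex" where
  "mat_moment p \<mu> j = (\<lambda>i l. if i < p \<and> l < p then cm_integral (\<mu> i l) (\<lambda>x. x ^ j) else 0)"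

definition moment_space :: "nat \<Rightarrow> nat \<Rightarrow> (nat \<Rightarrow> nat \<Rightarrow> nat \<Rightarrow> complex) set" where
  "moment_space p n = {S. \<exists>\<mu>. matrix_measure p \<mu> \<and>
      (\<forall>j. S j = (if j \<in> {1..n} then mat_moment p \<mu> j else (\<lambda>_ _. 0)))}"

definition herm_of_coords :: "nat \<Rightarrow> (nat \<times> nat \<Rightarrow> real) \<Rightarrow> nat \<Rightarrow> nat \<Rightarrow> complex" where
  "herm_of_coords p c = (\<lambda>i j. if i < p \<and> j < p then
      (if i = j then complex_of_real (c (i, i))
       else if i < j then Complex (c (i, j)) (c (j, i))
       else Complex (c (j, i)) (- c (i, j)))
     else 0)"

definition leb_herm :: "nat \<Rightarrow> (nat \<Rightarrow> nat \<Rightarrow> complex) measure" where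
  "leb_herm p = distr (PiM ({..<p} \<times> {..<p}) (\<lambda>_. lborel)) borel (herm_of_coords p)"

definition leb_herm_tuple :: "nat \<Rightarrow> nat \<Rightarrow> (nat \<Rightarrow> nat \<Rightarrow> nat \<Rightarrow> complex) measure" where
  "leb_herm_tuple p n = distr (PiM ({1..n} \<times> ({..<p} \<times> {..<p})) (\<lambda>_. lborel)) borel
     (\<lambda>c j. if j \<in> {1..n} then herm_of_coords p (\<lambda>(i, l). c (j, i, l)) else (\<lambda>_ _. 0))"

definition unif_moment :: "nat \<Rightarrow> nat \<Rightarrow> (nat \<Rightarrow> nat \<Rightarrow> nat \<Rightarrow> complex) measure" where
  "unif_moment p n = uniform_measure (leb_herm_tuple p n) (moment_space p n)"

definition tr_sq :: "nat \<Rightarrow> (nat \<Rightarrow> nat \<Rightarrow> complex) \<Rightarrow> real" where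
  "tr_sq p X = Re (\<Sum>i<p. \<Sum>l<p. X i l * X l i)"

definition gue_const :: "nat \<Rightarrow> real" where
  "gue_const p = (2 * pi) powr (- real p / 2) * pi powr (- real p * (real p - 1) / 2)"

definition GUE :: "nat \<Rightarrow> (nat \<Rightarrow> nat \<Rightarrow> complex) measure" where
  "GUE p = distr (density (PiM ({..<p} \<times> {..<p}) (\<lambda>_. lborel))
       (\<lambda>c. ennreal (gue_const p * exp (- tr_sq p (herm_of_coords p c) / 2))))
     borel (herm_of_coords p)"

definition GUE_vec :: "nat \<Rightarrow> nat \<Rightarrow> (nat \<Rightarrow> nat \<Rightarrow> nat \<Rightarrow> complex) measure" where
  "GUE_vec p k = distr (PiM {1..k} (\<lambda>_. GUE p)) borel
     (\<lambda>G j. if j \<in> {1..k} then G j else (\<lambda>_ _. 0))"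

definition s0 :: "nat \<Rightarrow> real" where
  "s0 j = real ((2 * j) choose j) / 4 ^ j"

definition amat :: "nat \<Rightarrow> nat \<Rightarrow> real" where
  "amat i j = (if j \<le> i then (1 / 4) ^ (i - 1) * real ((2 * i) choose (i - j)) else 0)"

definition Ainv :: "nat \<Rightarrow> nat \<Rightarrow> nat \<Rightarrow> real" where
  "Ainv k = (THE B. (\<forall>i j. (i \<notin> {1..k} \<or> j \<notin> {1..k}) \<longrightarrow> B i j = 0) \<and>
      (\<forall>i\<in>{1..k}. \<forall>j\<in>{1..k}. (\<Sum>m=1..k. B i m * amat m j) = (if i = j then 1 else 0)))"

definition stat :: "nat \<Rightarrow> nat \<Rightarrow> nat \<Rightarrow> (nat \<Rightarrow> nat \<Rightarrow> nat \<Rightarrow> complex) \<Rightarrow> nat \<Rightarrow> nat \<Rightarrow> nat \<Rightarrow> complex" where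
  "stat p k n S = (\<lambda>j. if j \<in> {1..k} then
      (\<lambda>i l. if i < p \<and> l < p then
         complex_of_real (sqrt (8 * real n * real p)) *
         (\<Sum>m=1..k. complex_of_real (Ainv k j m) *
            (S m i l - (if i = l then complex_of_real (s0 m) else 0)))
       else 0)
    else (\<lambda>_ _. 0))"

definition conv_in_distr :: "(nat \<Rightarrow> 'a::topological_space measure) \<Rightarrow> 'a measure \<Rightarrow> bool" where
  "conv_in_distr Ms M \<longleftrightarrow>
     (\<forall>f :: 'a \<Rightarrow> real. continuous_on UNIV f \<and> bounded (range f) \<longrightarrow>
        (\<lambda>n. \<integral>x. f x \<partial>Ms n) \<longlonglongrightarrow> (\<integral>x. f x \<partial>M))"

end

theory Submission
  imports Defs "Jordan_Normal_Form.Determinant" "HOL-Library.Function_Algebras"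
begin

text \<open>With \<open>x = cos\<^sup>2 (\<theta> / 2)\<close>, the power moments are affine in the Chebyshev moments \<open>C\<^sub>i = \<integral> cos (i \<theta>) d\<mu>\<close>:
  \<open>S\<^sub>j = s\<^sup>0\<^sub>j + (a\<^sub>j\<^sub>1 C\<^sub>1 + \<dots> + a\<^sub>j\<^sub>j C\<^sub>j) / 2\<close>. Hence the statistic is simply \<open>(2 n p)\<^sup>1\<^sup>/\<^sup>2 (C\<^sub>1, \<dots>, C\<^sub>k)\<close>, and the
  moment space is, up to this triangular map with constant Jacobian, the set of hermitian tuples whose
  block Toeplitz matrix \<open>[C\<^bsub>|i-j|\<^esub>]\<close> is positive semidefinite (Riemann sums in one direction; Fejer
  kernel, Caratheodory's theorem and compactness in the other, which also shows that it is closed).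

  Given \<open>C\<^sub>1, \<dots>, C\<^sub>j\<close> with Schur complement \<open>P\<^sub>j = L L\<^sup>*\<close>, the Levinson recursion yields
  \<open>C\<^bsub>j+1\<^esub> = M + L V L\<^sup>*\<close> and \<open>P\<^bsub>j+1\<^esub> = L (1 - V\<^sup>2) L\<^sup>*\<close>, where \<open>M\<close> depends only on the earlier moments. The congruence
  by \<open>L\<close> has Jacobian \<open>(det P\<^sub>j)\<^sup>p\<close>, so integrating out the last moments one at a time gives \<open>(C\<^sub>1, \<dots>, C\<^sub>k)\<close> a
  density proportional to \<open>det (P\<^sub>k)\<^bsup>p (n - k)\<^esup>\<close>. At scale \<open>(2 n p)\<^sup>-\<^sup>1\<^sup>/\<^sup>2\<close> this tends to
  \<open>exp (- tr (X\<^sub>1\<^sup>2 + \<dots> + X\<^sub>k\<^sup>2) / 2)\<close>, and \<open>det P\<^sub>k \<le> exp (tr P\<^sub>k - p)\<close> together with the minimality of the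
  Schur complement provides a Gaussian majorant for dominated convergence.\<close>

section \<open>Matrix algebra and Cholesky factorisation\<close>

text \<open>Since the moments are hermitian, the block Toeplitz matrix is invariant under reversing
  the order of its blocks. One predictor column and its reversal therefore carry the whole
  recursion, and the innovation \<open>LE\<close> is hermitian, so that V ranges over hermitian
  matrices. The blocks do not commute, hence the new moment is normalised by a congruence. A
  Cholesky factor is taken instead of a square root because it makes the substitution triangular in
  real coordinates, so that every volume computation is an iterated affine substitution in one
  variable.

  The uniform law starts with exponent 0 at level n and each integration adds p. At scale (2 n
  p)^(-1/2) the exponent p (n - k) contributes p (n - k) / (2 n p), which tends to 1/2, the
  coefficient in the GUE density. The remaining factor 2 of sqrt (8 n p) cancels the 1/2 in front of
  the a_ji. Constants are only shown to be positive and finite, since they cancel in quotients of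
  integrals. The moment space is a semidefinite set while the recursion lives on the positive
  definite one; the gap is a null set.\<close>

lemma sum_fun_apply: "(\<Sum>i\<in>I. f i) x = (\<Sum>i\<in>I. f i x)"
  by (induct I rule: infinite_finite_induct) auto

text \<open>Induction by eliminating index 0: the Schur complement \<open>X'\<close> of the pivot is
  again positive definite, and its factor, shifted by one, fills the rest of
  \<open>L\<close>.\<close>

lemma cholesky_exists:
  fixes X :: "nat \<Rightarrow> nat \<Rightarrow> complex"
  assumes "\<And>i j. i < p \<Longrightarrow> j < p \<Longrightarrow> X i j = cnj (X j i)"
    and "\<And>v. \<exists>i<p. v i \<noteq> 0 \<Longrightarrow> 0 < Re (\<Sum>i<p. \<Sum>j<p. cnj (v i) * X i j * v j)"
  shows "\<exists>L d. (\<forall>i j. i < j \<longrightarrow> L i j = 0) \<and> (\<forall>i<p. 0 < d i \<and> L i i = complex_of_real (d i)) \<and>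
    (\<forall>i<p. \<forall>j<p. X i j = (\<Sum>l<p. L i l * cnj (L j l)))"
  using assms
proof (induction p arbitrary: X)
  case 0
  then show ?case by (intro exI[of _ "\<lambda>_ _. 0"]) auto
next
  case (Suc p)
  note herm = Suc.prems(1) and pos = Suc.prems(2)
  define x where "x = X 0 0"
  define a where "a = Re x"
  have "Im x = 0"
    using herm[of 0 0] by (simp add: complex_eq_iff x_def)
  then have xa: "x = complex_of_real a"
    by (simp add: complex_eq_iff a_def)
  have "0 < Re (\<Sum>i<Suc p. \<Sum>j<Suc p. cnj (if i = 0 then 1 else 0) * X i j * (if j = 0 then 1 else 0))"
    by (rule pos) (auto intro!: exI[of _ 0])
  also have "(\<Sum>i<Suc p. \<Sum>j<Suc p. cnj (if i = 0 then 1 else 0) * X i j * (if j = 0 then 1 else 0)) = x"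
    by (simp add: sum.lessThan_Suc_shift x_def del: sum.lessThan_Suc)
  finally have a0: "a > 0" by (simp add: a_def)
  then have x0: "x \<noteq> 0" by (simp add: xa)
  define X' where "X' i j = X (Suc i) (Suc j) - X (Suc i) 0 * X 0 (Suc j) / x" for i j
  have herm': "X' i j = cnj (X' j i)" if "i < p" "j < p" for i j
    using herm[of "Suc i" "Suc j"] herm[of "Suc i" 0] herm[of 0 "Suc j"] that
    by (simp add: X'_def xa)
  have pos': "0 < Re (\<Sum>i<p. \<Sum>j<p. cnj (w i) * X' i j * w j)" if w: "\<exists>i<p. w i \<noteq> 0" for w
  proof -
    define s where "s = (\<Sum>j<p. X 0 (Suc j) * w j)"
    have cs: "(\<Sum>i<p. cnj (w i) * X (Suc i) 0) = cnj s"
    proof -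
      have "cnj s = (\<Sum>j<p. cnj (X 0 (Suc j)) * cnj (w j))"
        by (simp add: s_def)
      also have "\<dots> = (\<Sum>i<p. cnj (w i) * X (Suc i) 0)"
        using herm[of _ 0] by (intro sum.cong) (auto simp: mult.commute)
      finally show ?thesis by simp
    qed
    \<comment> \<open>The entry \<open>- s / x\<close> minimises the form of \<open>X\<close> in
      coordinate 0 when the others are \<open>w\<close>; the minimum is the form of
      \<open>X'\<close> at \<open>w\<close>.\<close>
    define v where "v i = (case i of 0 \<Rightarrow> - s / x | Suc i \<Rightarrow> w i)" for i
    have v0: "v 0 = - s / x" and vS: "v (Suc i) = w i" for i
      by (simp_all add: v_def)
    have "0 < Re (\<Sum>i<Suc p. \<Sum>j<Suc p. cnj (v i) * X i j * v j)"
      using w by (intro pos) (force simp: v_def)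
    also have "(\<Sum>i<Suc p. \<Sum>j<Suc p. cnj (v i) * X i j * v j) =
       cnj (v 0) * x * v 0 + cnj (v 0) * s + cnj s * v 0 +
       (\<Sum>i<p. \<Sum>j<p. cnj (w i) * X (Suc i) (Suc j) * w j)"
    proof -
      have "cnj (v 0) * s = (\<Sum>j<p. cnj (v 0) * X 0 (Suc j) * w j)"
        "cnj s * v 0 = (\<Sum>i<p. cnj (w i) * X (Suc i) 0 * v 0)"
        unfolding cs[symmetric] by (simp_all add: s_def sum_distrib_left sum_distrib_right mult.assoc)
      then show ?thesis
        by (simp add: sum.lessThan_Suc_shift vS sum.distrib x_def del: sum.lessThan_Suc)
    qed
    also have "\<dots> = (\<Sum>i<p. \<Sum>j<p. cnj (w i) * X (Suc i) (Suc j) * w j) - cnj s * s / x"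
    proof -
      have "cnj x = x" by (simp add: xa)
      then show ?thesis using x0 by (simp add: v0 field_simps)
    qed
    also have "\<dots> = (\<Sum>i<p. \<Sum>j<p. cnj (w i) * X' i j * w j)"
    proof -
      have "(\<Sum>i<p. \<Sum>j<p. cnj (w i) * X' i j * w j) = (\<Sum>i<p. \<Sum>j<p. cnj (w i) * X (Suc i) (Suc j) * w j) -
          (\<Sum>i<p. \<Sum>j<p. (cnj (w i) * X (Suc i) 0) * (X 0 (Suc j) * w j) / x)"
        by (simp add: X'_def algebra_simps sum_subtractf)
      also have "(\<Sum>i<p. \<Sum>j<p. (cnj (w i) * X (Suc i) 0) * (X 0 (Suc j) * w j) / x) = cnj s * s / x"
        unfolding cs[symmetric] by (simp add: s_def sum_product sum_divide_distrib)
      finally show ?thesis by simp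
    qed
    finally show ?thesis .
  qed
  obtain L d where L: "\<And>i j. i < j \<Longrightarrow> L i j = 0" "\<And>i. i < p \<Longrightarrow> 0 < d i \<and> L i i = complex_of_real (d i)"
    "\<And>i j. i < p \<Longrightarrow> j < p \<Longrightarrow> X' i j = (\<Sum>l<p. L i l * cnj (L j l))"
    using Suc.IH[OF herm' pos'] by blast
  define L' where "L' i j = (if j = 0 then X i 0 / complex_of_real (sqrt a) else if i = 0 then 0 else L (i - 1) (j - 1))" for i j
  define d' where "d' i = (case i of 0 \<Rightarrow> sqrt a | Suc i \<Rightarrow> d i)" for i
  have sq: "complex_of_real (sqrt a) * complex_of_real (sqrt a) = x"
    using a0 by (simp add: xa of_real_mult[symmetric] del: of_real_mult)
  have 1: "\<forall>i j. i < j \<longrightarrow> L' i j = 0"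
    using L(1) by (auto simp: L'_def)
  have 2: "\<forall>i<Suc p. 0 < d' i \<and> L' i i = complex_of_real (d' i)"
  proof (intro allI impI)
    fix i assume "i < Suc p"
    then show "0 < d' i \<and> L' i i = complex_of_real (d' i)"
      using L(2) a0 sq by (cases i) (auto simp: d'_def L'_def x_def[symmetric] field_simps)
  qed
  have 3: "X i j = (\<Sum>l<Suc p. L' i l * cnj (L' j l))" if "i < Suc p" "j < Suc p" for i j
  proof -
    have "(\<Sum>l<Suc p. L' i l * cnj (L' j l)) = X i 0 * cnj (X j 0) / x + (\<Sum>l<p. L' i (Suc l) * cnj (L' j (Suc l)))"
      by (simp add: sum.lessThan_Suc_shift L'_def sq del: sum.lessThan_Suc)
    also have "cnj (X j 0) = X 0 j" using herm[of j 0] that by simp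
    also have "X i 0 * X 0 j / x + (\<Sum>l<p. L' i (Suc l) * cnj (L' j (Suc l))) = X i j"
    proof (cases i)
      case 0 then show ?thesis using x0 by (simp add: L'_def x_def[symmetric])
    next
      case (Suc i')
      show ?thesis
      proof (cases j)
        case 0 then show ?thesis using x0 by (simp add: L'_def x_def[symmetric])
      next
        case (Suc j')
        with \<open>i = Suc i'\<close> show ?thesis using that
          by (simp add: L'_def X'_def flip: L(3))
      qed
    qed
    finally show ?thesis by simp
  qed
  show ?case using 1 2 3 by blast
qed

text \<open>Matrices stay functions, as in the definitions behind the theorem, and \<open>p\<close>
  is fixed so that the product needs no size argument. \<open>supp\<close> confines the entries to
  the index box; determinants and adjugates are taken through \<open>jmat\<close>.\<close>

locale cmats = fixes p :: nat
begin

type_synonym cmx = "nat \<Rightarrow> nat \<Rightarrow> complex"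

definition mm :: "cmx \<Rightarrow> cmx \<Rightarrow> cmx" (infixl "\<diamondop>" 70) where
  "X \<diamondop> Y = (\<lambda>i j. \<Sum>l<p. X i l * Y l j)"

definition adj :: "cmx \<Rightarrow> cmx" where
  "adj X = (\<lambda>i j. cnj (X j i))"

definition one :: cmx where
  "one = (\<lambda>i j. if i = j \<and> i < p then 1 else 0)"

definition supp :: "cmx \<Rightarrow> bool" where
  "supp X \<longleftrightarrow> (\<forall>i j. X i j \<noteq> 0 \<longrightarrow> i < p \<and> j < p)"

definition herm :: "cmx \<Rightarrow> bool" where
  "herm X \<longleftrightarrow> supp X \<and> adj X = X"

definition qf :: "cmx \<Rightarrow> (nat \<Rightarrow> complex) \<Rightarrow> complex" where
  "qf X v = (\<Sum>i<p. \<Sum>j<p. cnj (v i) * X i j * v j)"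

definition posdef :: "cmx \<Rightarrow> bool" where
  "posdef X \<longleftrightarrow> herm X \<and> (\<forall>v. (\<exists>i<p. v i \<noteq> 0) \<longrightarrow> 0 < Re (qf X v))"

definition psd :: "cmx \<Rightarrow> bool" where
  "psd X \<longleftrightarrow> herm X \<and> (\<forall>v. 0 \<le> Re (qf X v))"

definition jmat :: "cmx \<Rightarrow> complex mat" where
  "jmat X = Matrix.mat p p (\<lambda>(i, j). X i j)"

definition fdet :: "cmx \<Rightarrow> complex" where
  "fdet X = Determinant.det (jmat X)"

text \<open>Cramer's rule makes each entry a quotient of polynomials in the entries of
  \<open>X\<close>; measurability and continuity of the inverse are read off from it.\<close>

definition finv :: "cmx \<Rightarrow> cmx" where
  "finv X = (\<lambda>i j. if i < p \<and> j < p then adj_mat (jmat X) $$ (i, j) / fdet X else 0)"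

definition ftr :: "cmx \<Rightarrow> complex" where
  "ftr X = (\<Sum>i<p. X i i)"

lemma mm_assoc: "X \<diamondop> Y \<diamondop> Z = X \<diamondop> (Y \<diamondop> Z)"
  by (intro ext) (simp add: mm_def sum_distrib_left sum_distrib_right mult.assoc, rule sum.swap)

lemma mm_add_left: "(X + Y) \<diamondop> Z = X \<diamondop> Z + Y \<diamondop> Z"
  by (intro ext) (simp add: mm_def algebra_simps sum.distrib)

lemma mm_add_right: "X \<diamondop> (Y + Z) = X \<diamondop> Y + X \<diamondop> Z"
  by (intro ext) (simp add: mm_def algebra_simps sum.distrib)

lemma mm_diff_left: "(X - Y) \<diamondop> Z = X \<diamondop> Z - Y \<diamondop> Z"
  by (intro ext) (simp add: mm_def algebra_simps sum_subtractf)

lemma mm_diff_right: "X \<diamondop> (Y - Z) = X \<diamondop> Y - X \<diamondop> Z"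
  by (intro ext) (simp add: mm_def algebra_simps sum_subtractf)

lemma mm_zero_left [simp]: "0 \<diamondop> X = 0"
  by (intro ext) (simp add: mm_def)

lemma mm_zero_right [simp]: "X \<diamondop> 0 = 0"
  by (intro ext) (simp add: mm_def)

lemma mm_minus_left: "(- X) \<diamondop> Y = - (X \<diamondop> Y)"
  using mm_diff_left[of 0 X Y] by simp

lemma mm_minus_right: "X \<diamondop> (- Y) = - (X \<diamondop> Y)"
  using mm_diff_right[of X 0 Y] by simp

lemma mm_sum_left: "(\<Sum>i\<in>I. f i) \<diamondop> X = (\<Sum>i\<in>I. f i \<diamondop> X)"
  by (intro ext) (simp add: mm_def sum_fun_apply sum_distrib_right, rule sum.swap)

lemma mm_sum_right: "X \<diamondop> (\<Sum>i\<in>I. f i) = (\<Sum>i\<in>I. X \<diamondop> f i)"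
  by (intro ext) (simp add: mm_def sum_fun_apply sum_distrib_left, rule sum.swap)

lemmas mm_distribs = mm_add_left mm_add_right mm_diff_left mm_diff_right mm_minus_left mm_minus_right

lemma adj_mm: "adj (X \<diamondop> Y) = adj Y \<diamondop> adj X"
  by (intro ext) (simp add: mm_def adj_def mult.commute)

lemma adj_adj [simp]: "adj (adj X) = X"
  by (simp add: adj_def)

lemma adj_add: "adj (X + Y) = adj X + adj Y"
  by (intro ext) (simp add: adj_def)

lemma adj_diff: "adj (X - Y) = adj X - adj Y"
  by (intro ext) (simp add: adj_def)

lemma adj_zero [simp]: "adj 0 = 0"
  by (intro ext) (simp add: adj_def)

lemma adj_sum: "adj (\<Sum>i\<in>I. f i) = (\<Sum>i\<in>I. adj (f i))"
  by (intro ext) (simp add: adj_def sum_fun_apply)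

lemma adj_one [simp]: "adj one = one"
  by (intro ext) (auto simp: adj_def one_def)

lemma mm_one_left: "one \<diamondop> X = (\<lambda>i j. if i < p then X i j else 0)"
  by (intro ext) (auto simp: mm_def one_def if_distrib[of "\<lambda>x. x * _"] cong: if_cong)

lemma mm_one_right: "X \<diamondop> one = (\<lambda>i j. if j < p then X i j else 0)"
  by (intro ext) (auto simp: mm_def one_def if_distrib[of "\<lambda>x. _ * x"] cong: if_cong)

lemma supp_mm_one [simp]: "supp X \<Longrightarrow> X \<diamondop> one = X" "supp X \<Longrightarrow> one \<diamondop> X = X"
  by (auto simp: mm_one_left mm_one_right supp_def fun_eq_iff)

lemma supp_one [simp, intro]: "supp one"
  by (auto simp: supp_def one_def)

lemma supp_zero [simp, intro]: "supp 0"
  by (auto simp: supp_def)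

lemma supp_mm [intro]: "supp X \<Longrightarrow> supp Y \<Longrightarrow> supp (X \<diamondop> Y)"
  unfolding supp_def mm_def
  by (smt (verit) mult_eq_0_iff sum.neutral)

lemma supp_add [intro]: "supp X \<Longrightarrow> supp Y \<Longrightarrow> supp (X + Y)"
  unfolding supp_def by (metis add_0 plus_fun_apply)

lemma supp_diff [intro]: "supp X \<Longrightarrow> supp Y \<Longrightarrow> supp (X - Y)"
  unfolding supp_def by (metis cancel_comm_monoid_add_class.diff_zero diff_self fun_diff_def)

lemma supp_sum [intro]: "(\<And>i. i \<in> I \<Longrightarrow> supp (f i)) \<Longrightarrow> supp (\<Sum>i\<in>I. f i)"
  unfolding supp_def sum_fun_apply by (meson sum.neutral)

lemma supp_adj [intro]: "supp X \<Longrightarrow> supp (adj X)"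
  by (auto simp: supp_def adj_def)

lemma herm_supp [intro]: "herm X \<Longrightarrow> supp X"
  by (simp add: herm_def)

lemma herm_adj: "herm X \<Longrightarrow> adj X = X"
  by (simp add: herm_def)

lemma herm_one [simp, intro]: "herm one"
  by (simp add: herm_def supp_one)

lemma herm_add [intro]: "herm X \<Longrightarrow> herm Y \<Longrightarrow> herm (X + Y)"
  by (auto simp: herm_def adj_add)

lemma herm_diff [intro]: "herm X \<Longrightarrow> herm Y \<Longrightarrow> herm (X - Y)"
  by (auto simp: herm_def adj_diff)

lemma herm_conj: "herm X \<Longrightarrow> supp Y \<Longrightarrow> herm (Y \<diamondop> X \<diamondop> adj Y)"
  unfolding herm_def by (simp add: adj_mm mm_assoc supp_mm supp_adj)

lemma qf_eq: "(adj Y \<diamondop> X \<diamondop> Y) i i = qf X (\<lambda>j. Y j i)"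
  by (simp add: mm_def adj_def qf_def sum_distrib_left sum_distrib_right mult.assoc, rule sum.swap)

lemma qf_diff: "qf (X - Y) v = qf X v - qf Y v"
  by (simp add: qf_def algebra_simps sum_subtractf)

lemma qf_one: "qf one v = (\<Sum>i<p. of_real ((cmod (v i))\<^sup>2))"
proof -
  have "qf one v = (\<Sum>i<p. cnj (v i) * v i)"
    unfolding qf_def one_def
    by (intro sum.cong refl) (auto simp: if_distrib[of "\<lambda>x. _ * x"] if_distrib[of "\<lambda>x. x * _"] cong: if_cong)
  then show ?thesis by (simp add: complex_norm_square mult.commute del: of_real_power)
qed

lemma Re_qf_one_nonneg: "0 \<le> Re (qf one v)"
  by (auto simp: qf_one intro!: sum_nonneg)

lemma Re_qf_one_pos: "\<exists>i<p. v i \<noteq> 0 \<Longrightarrow> 0 < Re (qf one v)"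
  unfolding qf_one by (auto intro!: sum_pos2 simp flip: of_real_power)

lemma posdef_one [simp, intro]: "posdef one"
  by (simp add: posdef_def Re_qf_one_pos)

lemma posdef_herm [intro]: "posdef X \<Longrightarrow> herm X"
  by (simp add: posdef_def)

lemma posdef_psd: "posdef X \<Longrightarrow> psd X"
  unfolding posdef_def psd_def
proof (intro conjI allI)
  fix v assume "herm X \<and> (\<forall>v. (\<exists>i<p. v i \<noteq> 0) \<longrightarrow> 0 < Re (qf X v))"
  then show "0 \<le> Re (qf X v)"
    by (cases "\<exists>i<p. v i \<noteq> 0") (auto intro: less_imp_le simp: qf_def)
qed auto

section \<open>Determinants, inverses and Cholesky factors\<close>

lemma jmat_carrier [simp]: "jmat X \<in> carrier_mat p p"
  by (simp add: jmat_def)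

lemma jmat_mm: "jmat (X \<diamondop> Y) = jmat X * jmat Y"
  by (rule eq_matI) (auto simp: jmat_def mm_def scalar_prod_def lessThan_atLeast0)

lemma jmat_one: "jmat one = 1\<^sub>m p"
  by (rule eq_matI) (auto simp: jmat_def one_def)

lemma fdet_mm: "fdet (X \<diamondop> Y) = fdet X * fdet Y"
  by (simp add: fdet_def jmat_mm det_mult[OF jmat_carrier jmat_carrier])

lemma fdet_one [simp]: "fdet one = 1"
  by (simp add: fdet_def jmat_one)

lemma fdet_Leibniz: "fdet X = (\<Sum>\<pi> | \<pi> permutes {..<p}. signof \<pi> * (\<Prod>i<p. X i (\<pi> i)))"
  unfolding fdet_def det_def'[OF jmat_carrier] lessThan_atLeast0[symmetric]
  by (intro sum.cong refl arg_cong2[of _ _ _ _ "(*)"] prod.cong)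
    (simp_all add: jmat_def, metis lessThan_iff permutes_in_image index_mat(1) case_prod_conv)

lemma fdet_adj: "fdet (adj X) = cnj (fdet X)"
proof -
  have "jmat (adj X) = transpose_mat (jmat (\<lambda>i j. cnj (X i j)))"
    by (rule eq_matI) (auto simp: jmat_def adj_def)
  then have "fdet (adj X) = fdet (\<lambda>i j. cnj (X i j))"
    by (simp add: fdet_def det_transpose[OF jmat_carrier])
  also have "\<dots> = cnj (fdet X)"
    unfolding fdet_Leibniz by (simp add: sign_def)
  finally show ?thesis .
qed

lemma jmat_inj: "supp X \<Longrightarrow> supp Y \<Longrightarrow> jmat X = jmat Y \<Longrightarrow> X = Y"
proof (intro ext)
  fix i j assume "supp X" "supp Y" "jmat X = jmat Y"
  then show "X i j = Y i j"
    by (cases "i < p \<and> j < p")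
      (metis (no_types, lifting) jmat_def index_mat(1) case_prod_conv, metis supp_def)
qed

lemma supp_finv [simp, intro]: "supp (finv X)"
  by (auto simp: supp_def finv_def)

lemma jmat_finv: "jmat (finv X) = (1 / fdet X) \<cdot>\<^sub>m adj_mat (jmat X)"
  by (rule eq_matI) (use adj_mat(1)[OF jmat_carrier, of X] in \<open>auto simp: jmat_def finv_def\<close>)

lemma finv_right:
  assumes "supp X" "fdet X \<noteq> 0"
  shows "X \<diamondop> finv X = one"
proof (rule jmat_inj)
  show "jmat (X \<diamondop> finv X) = jmat one"
    using assms(2) adj_mat[OF jmat_carrier, of X]
    by (simp add: jmat_mm jmat_finv jmat_one fdet_def mult_smult_distrib[OF jmat_carrier])
      (rule eq_matI; simp)
qed (use assms in auto)

lemma finv_left: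
  assumes "supp X" "fdet X \<noteq> 0"
  shows "finv X \<diamondop> X = one"
proof (rule jmat_inj)
  show "jmat (finv X \<diamondop> X) = jmat one"
    using assms(2) adj_mat[OF jmat_carrier, of X]
    by (simp add: jmat_mm jmat_finv jmat_one fdet_def mult_smult_assoc_mat[OF _ jmat_carrier])
      (rule eq_matI; simp)
qed (use assms in auto)

lemma finv_unique:
  assumes "supp X" "fdet X \<noteq> 0" "supp Y" "X \<diamondop> Y = one"
  shows "finv X = Y"
proof -
  have "finv X = finv X \<diamondop> (X \<diamondop> Y)" by (simp add: assms(4))
  also have "\<dots> = (finv X \<diamondop> X) \<diamondop> Y" by (simp add: mm_assoc)
  also have "\<dots> = Y" using assms(1-3) by (simp add: finv_left)
  finally show ?thesis .
qed

lemma herm_finv: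
  assumes "herm X" "fdet X \<noteq> 0"
  shows "herm (finv X)"
proof -
  have "X \<diamondop> adj (finv X) = adj (finv X \<diamondop> X)" using assms by (simp add: adj_mm herm_adj)
  also have "\<dots> = one" using assms by (simp add: finv_left herm_supp)
  finally have "finv X = adj (finv X)"
    using assms by (intro finv_unique) auto
  then show ?thesis by (simp add: herm_def)
qed

text \<open>\<open>d\<close> is the diagonal as a real vector: in real coordinates, the congruence
  by \<open>L\<close> multiplies the coordinate at position (i, j) by
  \<open>d i * d j\<close>.\<close>

definition chol :: "cmx \<Rightarrow> (nat \<Rightarrow> real) \<Rightarrow> bool" where
  "chol L d \<longleftrightarrow> supp L \<and> (\<forall>i j. i < j \<longrightarrow> L i j = 0) \<and> (\<forall>i<p. 0 < d i \<and> L i i = complex_of_real (d i))"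

lemma posdef_chol:
  assumes "posdef X"
  obtains L d where "chol L d" "X = L \<diamondop> adj L"
proof -
  have 1: "X i j = cnj (X j i)" for i j
    using assms unfolding posdef_def herm_def adj_def by metis
  have 2: "0 < Re (\<Sum>i<p. \<Sum>j<p. cnj (v i) * X i j * v j)" if "\<exists>i<p. v i \<noteq> 0" for v
    using assms that unfolding posdef_def qf_def by blast
  obtain L d where L: "\<And>i j. i < j \<Longrightarrow> L i j = 0" "\<And>i. i<p \<Longrightarrow> 0 < d i \<and> L i i = complex_of_real (d i)"
    "\<And>i j. i < p \<Longrightarrow> j < p \<Longrightarrow> X i j = (\<Sum>l<p. L i l * cnj (L j l))"
    using cholesky_exists[OF 1 2] by blast
  define L' where "L' i j = (if i < p \<and> j < p then L i j else 0)" for i j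
  have "chol L' d"
    using L(1,2) by (auto simp: chol_def L'_def supp_def)
  moreover have "X = L' \<diamondop> adj L'"
  proof (intro ext)
    fix i j
    show "X i j = (L' \<diamondop> adj L') i j"
    proof (cases "i < p \<and> j < p")
      case True
      then show ?thesis using L(3)[of i j] by (auto simp: mm_def adj_def L'_def)
    next
      case False
      then have "X i j = 0" using assms by (auto simp: posdef_def herm_def supp_def)
      then show ?thesis using False by (auto simp: mm_def adj_def L'_def)
    qed
  qed
  ultimately show ?thesis by (rule that)
qed

lemma fdet_chol:
  assumes "chol L d"
  shows "fdet L = of_real (\<Prod>i<p. d i)"
proof -
  have "fdet L = prod_list (diag_mat (jmat L))"
    unfolding fdet_def
    by (rule det_lower_triangular[OF _ jmat_carrier]) (use assms in \<open>auto simp: chol_def jmat_def\<close>)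
  also have "\<dots> = (\<Prod>i<p. L i i)"
    by (simp add: prod_list_diag_prod lessThan_atLeast0 jmat_def)
  finally show ?thesis using assms by (simp add: chol_def)
qed

lemma fdet_chol_pos: "chol L d \<Longrightarrow> 0 < (\<Prod>i<p. d i)"
  by (rule prod_pos) (auto simp: chol_def)

lemma fdet_chol_sq: "chol L d \<Longrightarrow> fdet (L \<diamondop> adj L) = of_real ((\<Prod>i<p. d i)\<^sup>2)"
  by (simp add: fdet_mm fdet_adj fdet_chol power2_eq_square)

lemma posdef_fdet:
  assumes "posdef X"
  shows "0 < Re (fdet X)" "fdet X = of_real (Re (fdet X))" "fdet X \<noteq> 0"
proof -
  obtain L d where L: "chol L d" "X = L \<diamondop> adj L" using posdef_chol[OF assms] .
  show "0 < Re (fdet X)" "fdet X = of_real (Re (fdet X))"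
    using zero_less_power[OF fdet_chol_pos[OF L(1)], of 2]
    unfolding L(2) fdet_chol_sq[OF L(1)] Re_complex_of_real by auto
  then show "fdet X \<noteq> 0" by auto
qed

text \<open>\<open>Re (X i i)\<close> is the squared norm of row \<open>i\<close> of the Cholesky
  factor, hence at least \<open>(d i)\<^sup>2\<close>. The bound t \<le> exp (t - 1), applied to
  each factor of the determinant, turns the product into a trace.\<close>

lemma posdef_fdet_le:
  assumes "posdef X"
  shows "Re (fdet X) \<le> exp (Re (ftr X) - real p)"
proof -
  obtain L d where L: "chol L d" "X = L \<diamondop> adj L" using posdef_chol[OF assms] .
  have d: "d i > 0" "L i i = complex_of_real (d i)" if "i < p" for i using L(1) that by (auto simp: chol_def)
  have "(d i)\<^sup>2 \<le> Re (X i i)" if "i < p" for i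
  proof -
    have "Re (X i i) = (\<Sum>l<p. (cmod (L i l))\<^sup>2)"
      by (simp add: L(2) mm_def adj_def cmod_power2) (simp add: power2_eq_square)
    also have "\<dots> \<ge> (cmod (L i i))\<^sup>2"
      using that by (intro member_le_sum) auto
    finally show ?thesis using d[OF that] by simp
  qed
  then have "(\<Sum>i<p. (d i)\<^sup>2) \<le> Re (ftr X)"
    by (auto simp: ftr_def intro!: sum_mono)
  moreover have "Re (fdet X) = (\<Prod>i<p. (d i)\<^sup>2)"
    by (simp add: L(2) fdet_chol_sq[OF L(1)] prod_power_distrib del: of_real_power of_real_prod)
  moreover have "(\<Prod>i<p. (d i)\<^sup>2) \<le> (\<Prod>i<p. exp ((d i)\<^sup>2 - 1))"
    by (intro prod_mono conjI) (auto intro: order_trans[OF _ exp_ge_add_one_self])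
  moreover have "(\<Prod>i<p. exp ((d i)\<^sup>2 - 1)) = exp ((\<Sum>i<p. (d i)\<^sup>2) - real p)"
    by (simp add: exp_sum[symmetric] sum_subtractf)
  ultimately show ?thesis
    by (smt (verit) exp_le_cancel_iff)
qed

lemma qf_conj: "qf (adj Y \<diamondop> X \<diamondop> Y) v = qf X (\<lambda>i. \<Sum>j<p. Y i j * v j)"
proof -
  define V :: cmx where "V = (\<lambda>i j. v i)"
  have "qf (adj Y \<diamondop> X \<diamondop> Y) v = (adj V \<diamondop> (adj Y \<diamondop> X \<diamondop> Y) \<diamondop> V) 0 0"
    unfolding qf_eq by (simp add: V_def)
  also have "\<dots> = (adj (Y \<diamondop> V) \<diamondop> X \<diamondop> (Y \<diamondop> V)) 0 0"
    by (simp add: adj_mm mm_assoc)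
  also have "\<dots> = qf X (\<lambda>i. \<Sum>j<p. Y i j * v j)"
    unfolding qf_eq by (simp add: V_def mm_def)
  finally show ?thesis .
qed

lemma posdef_conj:
  assumes X: "posdef X" and Y: "supp Y" "fdet Y \<noteq> 0"
  shows "posdef (Y \<diamondop> X \<diamondop> adj Y)"
  unfolding posdef_def
proof (intro conjI allI impI)
  show "herm (Y \<diamondop> X \<diamondop> adj Y)" using X Y by (auto intro: herm_conj)
  fix v :: "nat \<Rightarrow> complex" assume v: "\<exists>i<p. v i \<noteq> 0"
  define w where "w i = (\<Sum>j<p. adj Y i j * v j)" for i
  \<comment> \<open>\<open>adj Y\<close> is injective: \<open>adj (finv Y)\<close> recovers
    \<open>v\<close> from \<open>w\<close>.\<close>
  have "\<exists>i<p. w i \<noteq> 0"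
  proof (rule ccontr)
    assume "\<not> (\<exists>i<p. w i \<noteq> 0)"
    then have w0: "w i = 0" if "i < p" for i using that by blast
    define V :: cmx where "V = (\<lambda>i j. v i)"
    have "one \<diamondop> V = adj (finv Y) \<diamondop> (adj Y \<diamondop> V)"
      using finv_right[OF Y] by (simp add: mm_assoc[symmetric] flip: adj_mm)
    also have "\<dots> = 0"
      by (intro ext) (use w0 in \<open>auto simp: mm_def[of "adj (finv Y)"] mm_def[of "adj Y"] V_def w_def\<close>)
    finally have "one \<diamondop> V = 0" .
    then have "(one \<diamondop> V) i 0 = 0" for i by simp
    with v show False by (metis (no_types, lifting) mm_one_left V_def)
  qed
  then have "0 < Re (qf X w)" using X by (auto simp: posdef_def)
  then show "0 < Re (qf (Y \<diamondop> X \<diamondop> adj Y) v)"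
    using qf_conj[of "adj Y" X v] by (simp add: w_def[abs_def])
qed

lemma posdef_conj_iff:
  assumes Y: "supp Y" "fdet Y \<noteq> 0" and X: "supp X"
  shows "posdef (Y \<diamondop> X \<diamondop> adj Y) \<longleftrightarrow> posdef X"
proof
  assume *: "posdef (Y \<diamondop> X \<diamondop> adj Y)"
  have "fdet Y * fdet (finv Y) = 1" using finv_right[OF Y] fdet_mm[of Y "finv Y"] by simp
  then have "fdet (finv Y) \<noteq> 0" by auto
  from posdef_conj[OF * _ this] have "posdef (finv Y \<diamondop> (Y \<diamondop> X \<diamondop> adj Y) \<diamondop> adj (finv Y))" by auto
  also have "finv Y \<diamondop> (Y \<diamondop> X \<diamondop> adj Y) \<diamondop> adj (finv Y) = (finv Y \<diamondop> Y) \<diamondop> X \<diamondop> adj (finv Y \<diamondop> Y)"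
    by (simp add: adj_mm mm_assoc)
  also have "\<dots> = X" using finv_left[OF Y] X by simp
  finally show "posdef X" .
qed (rule posdef_conj[OF _ Y])

end

section \<open>Block Toeplitz forms and the Levinson recursion\<close>

text \<open>Subtraction is truncated, so one summand is always 0 and the value is |i - j|.\<close>

definition dd :: "nat \<Rightarrow> nat \<Rightarrow> nat" where
  "dd i j = (i - j) + (j - i)"

lemma dd_sym: "dd i j = dd j i" and dd_0 [simp]: "dd i i = 0" "dd 0 j = j" "dd j 0 = j"
  by (auto simp: dd_def)

lemma dd_flip: "i \<le> K \<Longrightarrow> j \<le> K \<Longrightarrow> dd (K - i) (K - j) = dd i j"
  by (auto simp: dd_def)

context cmats
begin

text \<open>For the block Toeplitz matrix \<open>T\<close> with blocks \<open>C (dd i j)\<close>, \<open>i, j \<le> k\<close>: \<open>LP C k\<close> is the Schur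
  complement of the block at \<open>(0, 0)\<close>, and \<open>LA C k\<close> is the block column with \<open>LA C k 0 = 1\<close> such that
  \<open>T (LA C k)\<close> has \<open>LP C k\<close> in position \<open>0\<close> and zeros elsewhere. The new moment \<open>C (Suc k)\<close> enters step
  \<open>Suc k\<close> only through \<open>LE C k = C (Suc k) + LM C k\<close>.\<close>

primrec lev :: "(nat \<Rightarrow> cmx) \<Rightarrow> nat \<Rightarrow> (nat \<Rightarrow> cmx) \<times> cmx" where
  "lev C 0 = ((\<lambda>j. if j = 0 then one else 0), one)"
| "lev C (Suc k) = (let A = fst (lev C k); P = snd (lev C k);
      E = (\<Sum>j\<le>k. C (Suc k - j) \<diamondop> A j)
     in ((\<lambda>j. if j \<le> Suc k then A j - A (Suc k - j) \<diamondop> (finv P \<diamondop> E) else 0), P - E \<diamondop> (finv P \<diamondop> E)))"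

definition LA where "LA C k = fst (lev C k)"
definition LP where "LP C k = snd (lev C k)"
definition LE where "LE C k = (\<Sum>j\<le>k. C (Suc k - j) \<diamondop> LA C k j)"
definition LM where "LM C k = (\<Sum>j\<in>{1..k}. C (Suc k - j) \<diamondop> LA C k j)"

lemma LA_0: "LA C 0 j = (if j = 0 then one else 0)" and LP_0 [simp]: "LP C 0 = one"
  by (simp_all add: LA_def LP_def)

lemma LA_Suc: "LA C (Suc k) j =
    (if j \<le> Suc k then LA C k j - LA C k (Suc k - j) \<diamondop> (finv (LP C k) \<diamondop> LE C k) else 0)"
  and LP_Suc: "LP C (Suc k) = LP C k - LE C k \<diamondop> (finv (LP C k) \<diamondop> LE C k)"
  by (simp_all add: LA_def LP_def LE_def Let_def)

lemma LA_gt: "k < j \<Longrightarrow> LA C k j = 0"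
  by (cases k) (auto simp: LA_0 LA_Suc)

lemma LA_at_0 [simp]: "LA C k 0 = one"
  by (induct k) (auto simp: LA_0 LA_Suc LA_gt)

text \<open>In step \<open>Suc k\<close> the indices \<open>Suc k - j\<close> with
  \<open>j \<le> k\<close> run from 1 to \<open>Suc k\<close>. This locality lets the last moment
  vary while the data of the earlier steps stay fixed.\<close>

lemma lev_cong: "(\<And>j. 1 \<le> j \<Longrightarrow> j \<le> k \<Longrightarrow> C j = C' j) \<Longrightarrow> lev C k = lev C' k"
proof (induct k)
  case (Suc k)
  then have "lev C k = lev C' k" by simp
  moreover have "(\<Sum>j\<le>k. C (Suc k - j) \<diamondop> X j) = (\<Sum>j\<le>k. C' (Suc k - j) \<diamondop> X j)" for X
    using Suc.prems by (intro sum.cong refl) auto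
  ultimately show ?case by simp
qed simp

lemma LP_cong: "(\<And>j. 1 \<le> j \<Longrightarrow> j \<le> k \<Longrightarrow> C j = C' j) \<Longrightarrow> LP C k = LP C' k"
  and LA_cong: "(\<And>j. 1 \<le> j \<Longrightarrow> j \<le> k \<Longrightarrow> C j = C' j) \<Longrightarrow> LA C k = LA C' k"
  using lev_cong[of k C C'] by (auto simp: LP_def LA_def)

lemma LM_cong: "(\<And>j. 1 \<le> j \<Longrightarrow> j \<le> k \<Longrightarrow> C j = C' j) \<Longrightarrow> LM C k = LM C' k"
  unfolding LM_def using LA_cong[of k C C'] by (intro sum.cong refl) auto

definition htup :: "(nat \<Rightarrow> cmx) \<Rightarrow> bool" where
  "htup C \<longleftrightarrow> C 0 = one \<and> (\<forall>j. herm (C j))"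

lemma htupD: "htup C \<Longrightarrow> C 0 = one" "htup C \<Longrightarrow> herm (C j)" "htup C \<Longrightarrow> supp (C j)"
  by (auto simp: htup_def)

lemma supp_lev: "htup C \<Longrightarrow> supp (LP C k) \<and> (\<forall>j. supp (LA C k j))"
proof (induct k)
  case (Suc k)
  then have "supp (LE C k)" unfolding LE_def by (intro supp_sum supp_mm) (auto simp: htupD)
  with Suc have "supp (LP C (Suc k)) \<and> (\<forall>j. supp (LA C (Suc k) j))"
    by (auto simp: LA_Suc LP_Suc intro!: supp_diff supp_mm)
  then show ?case .
qed (auto simp: LA_0)

lemma supp_LP: "htup C \<Longrightarrow> supp (LP C k)" and supp_LA: "htup C \<Longrightarrow> supp (LA C k j)"
  and supp_LE: "htup C \<Longrightarrow> supp (LE C k)" and supp_LM: "htup C \<Longrightarrow> supp (LM C k)"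
  using supp_lev[of C k] unfolding LE_def LM_def by (auto intro!: supp_sum supp_mm simp: htupD)

lemma LE_eq: "htup C \<Longrightarrow> LE C k = C (Suc k) + LM C k"
proof -
  assume "htup C"
  have "{..k} = insert 0 {1..k}" by auto
  then show ?thesis using \<open>htup C\<close> by (simp add: LE_def LM_def htupD)
qed

text \<open>Invertibility of the earlier Schur complements is all that the normal equations and the
  symmetry of \<open>LP\<close> and \<open>LE\<close> rest on; positivity is not assumed here, so
  the lemma can be used while positivity is being established.\<close>

lemma levinson:
  assumes C: "htup C" and "\<And>j. j < k \<Longrightarrow> fdet (LP C j) \<noteq> 0"
  shows "(\<forall>i\<le>k. (\<Sum>j\<le>k. C (dd i j) \<diamondop> LA C k j) = (if i = 0 then LP C k else 0)) \<and> herm (LP C k)"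
    and levinson_LE: "herm (LE C k)"
proof -
  have step: "herm (LE C k) \<and> (\<forall>i\<le>Suc k. (\<Sum>j\<le>Suc k. C (dd i j) \<diamondop> LA C k j) = (if i = 0 then LP C k else if i = Suc k then LE C k else 0))"
    if IH: "\<forall>i\<le>k. (\<Sum>j\<le>k. C (dd i j) \<diamondop> LA C k j) = (if i = 0 then LP C k else 0)" for k
  proof -
    define F where "F i = (\<Sum>j\<le>Suc k. C (dd i j) \<diamondop> LA C k j)" for i
    have F1: "F i = (\<Sum>j\<le>k. C (dd i j) \<diamondop> LA C k j)" for i
      by (simp add: F_def LA_gt)
    have F2: "F i = (if i = 0 then LP C k else 0)" if "i \<le> k" for i
      using IH that by (simp add: F1)
    have F3: "F (Suc k) = LE C k"
      unfolding F1 LE_def by (intro sum.cong refl) (simp add: dd_def)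
    \<comment> \<open>\<open>B\<close> pairs the column \<open>LA C k\<close> with its own reversal.
      Row by row only the last row survives, because \<open>LA C k (Suc k) = 0\<close> kills row 0,
      and it gives \<open>LE C k\<close>. Invariance of \<open>dd\<close> under the reversal makes
      \<open>B\<close> self-adjoint.\<close>
    define B where "B = (\<Sum>i\<le>Suc k. \<Sum>j\<le>Suc k. adj (LA C k (Suc k - i)) \<diamondop> C (dd i j) \<diamondop> LA C k j)"
    have "B = (\<Sum>i\<le>Suc k. adj (LA C k (Suc k - i)) \<diamondop> F i)"
      by (simp only: B_def F_def mm_sum_right mm_assoc)
    also have "\<dots> = (\<Sum>i\<le>k. adj (LA C k (Suc k - i)) \<diamondop> F i) + LE C k"
      using C by (simp add: F3 supp_LE)
    also have "(\<Sum>i\<le>k. adj (LA C k (Suc k - i)) \<diamondop> F i) = 0"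
      by (intro sum.neutral ballI) (simp add: F2 LA_gt)
    finally have BE: "B = LE C k" by simp
    have "adj B = (\<Sum>i\<le>Suc k. \<Sum>j\<le>Suc k. adj (LA C k j) \<diamondop> C (dd i j) \<diamondop> LA C k (Suc k - i))"
      using C by (simp only: B_def adj_sum adj_mm adj_adj herm_adj[OF htupD(2)[OF C]] mm_assoc)
    also have "\<dots> = (\<Sum>i\<le>Suc k. \<Sum>j\<le>Suc k. adj (LA C k (Suc k - j)) \<diamondop> C (dd (Suc k - i) (Suc k - j)) \<diamondop> LA C k i)"
      unfolding sum.cartesian_product
      by (rule sum.reindex_bij_witness[of _ "\<lambda>(i, j). (Suc k - i, Suc k - j)" "\<lambda>(i, j). (Suc k - i, Suc k - j)"]) auto
    also have "\<dots> = (\<Sum>i\<le>Suc k. \<Sum>j\<le>Suc k. adj (LA C k (Suc k - j)) \<diamondop> C (dd j i) \<diamondop> LA C k i)"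
      by (intro sum.cong refl) (simp add: dd_flip dd_sym)
    also have "\<dots> = B"
      unfolding B_def by (rule sum.swap)
    finally have "herm (LE C k)"
      using C by (simp add: herm_def BE supp_LE)
    moreover have "F i = (if i = 0 then LP C k else if i = Suc k then LE C k else 0)" if "i \<le> Suc k" for i
      using F2[of i] F3 that by (cases "i = Suc k") auto
    ultimately show ?thesis by (simp add: F_def)
  qed
  show 1: "(\<forall>i\<le>k. (\<Sum>j\<le>k. C (dd i j) \<diamondop> LA C k j) = (if i = 0 then LP C k else 0)) \<and> herm (LP C k)"
    using assms(2)
  proof (induction k)
    case 0
    then show ?case using C by (auto simp: LA_0 htupD)
  next
    case (Suc k)
    then have IH: "\<forall>i\<le>k. (\<Sum>j\<le>k. C (dd i j) \<diamondop> LA C k j) = (if i = 0 then LP C k else 0)"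
      and hP: "herm (LP C k)" by auto
    define F where "F i = (\<Sum>j\<le>Suc k. C (dd i j) \<diamondop> LA C k j)" for i
    define E where "E = LE C k"
    define Q where "Q = finv (LP C k)"
    have hE: "herm E" and F: "\<And>i. i \<le> Suc k \<Longrightarrow> F i = (if i = 0 then LP C k else if i = Suc k then E else 0)"
      using step[OF IH] by (simp_all add: F_def E_def)
    have d: "fdet (LP C k) \<noteq> 0" using Suc.prems by simp
    have hQ: "herm Q" unfolding Q_def by (rule herm_finv[OF hP d])
    have "(\<Sum>j\<le>Suc k. C (dd i j) \<diamondop> LA C (Suc k) j) = (if i = 0 then LP C (Suc k) else 0)" if i: "i \<le> Suc k" for i
    proof -
      \<comment> \<open>The old column padded by a zero is mapped to (P, 0, ..., 0, E), its reversal
        to (E, 0, ..., 0, P). Subtracting the reversal times \<open>Q \<diamondop> E\<close> clears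
        the last entry and leaves the new Schur complement in front.\<close>
      have "(\<Sum>j\<le>Suc k. C (dd i j) \<diamondop> LA C (Suc k) j) =
         F i - (\<Sum>j\<le>Suc k. C (dd i j) \<diamondop> LA C k (Suc k - j)) \<diamondop> (Q \<diamondop> E)"
        unfolding F_def mm_sum_left sum_subtractf[symmetric]
        by (intro sum.cong refl) (simp add: LA_Suc mm_distribs mm_assoc Q_def E_def)
      also have "(\<Sum>j\<le>Suc k. C (dd i j) \<diamondop> LA C k (Suc k - j)) = F (Suc k - i)"
        unfolding F_def
        using i
        by (intro sum.reindex_bij_witness[of _ "\<lambda>j. Suc k - j" "\<lambda>j. Suc k - j"]) (auto simp: dd_def add.commute)
      also have "F i - F (Suc k - i) \<diamondop> (Q \<diamondop> E) = (if i = 0 then LP C (Suc k) else 0)"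
      proof -
        have "LP C k \<diamondop> (Q \<diamondop> E) = E"
          using finv_right[OF herm_supp[OF hP] d] hE by (simp add: Q_def mm_assoc[symmetric] herm_supp)
        then show ?thesis using i F[of i] F[of "Suc k - i"]
          by (auto simp: LP_Suc E_def Q_def)
      qed
      finally show ?thesis .
    qed
    moreover have "herm (LP C (Suc k))"
    proof -
      have "herm (E \<diamondop> Q \<diamondop> adj E)" using hE hQ by (intro herm_conj) auto
      then show ?thesis using hP hE by (auto simp: LP_Suc E_def Q_def mm_assoc herm_adj)
    qed
    ultimately show ?case by blast
  qed
  then show "herm (LE C k)" using step by blast
qed

lemma herm_LM:
  assumes "htup C" "\<And>j. j < k \<Longrightarrow> fdet (LP C j) \<noteq> 0"
  shows "herm (LM C k)"
proof -
  have "LM C k = LE C k - C (Suc k)" by (simp add: LE_eq[OF assms(1)])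
  then show ?thesis using levinson_LE[OF assms] assms(1) by (auto simp: htupD)
qed

definition TF :: "nat \<Rightarrow> (nat \<Rightarrow> cmx) \<Rightarrow> (nat \<Rightarrow> cmx) \<Rightarrow> (nat \<Rightarrow> cmx) \<Rightarrow> cmx" where
  "TF k C u w = (\<Sum>i\<le>k. \<Sum>j\<le>k. adj (u i) \<diamondop> C (dd i j) \<diamondop> w j)"

lemma TF_adj: "htup C \<Longrightarrow> adj (TF k C u w) = TF k C w u"
proof -
  assume C: "htup C"
  have "adj (TF k C u w) = (\<Sum>i\<le>k. \<Sum>j\<le>k. adj (w j) \<diamondop> C (dd j i) \<diamondop> u i)"
    by (simp add: TF_def adj_sum adj_mm mm_assoc herm_adj[OF htupD(2)[OF C]] dd_sym)
  also have "\<dots> = TF k C w u"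
    unfolding TF_def by (rule sum.swap)
  finally show ?thesis .
qed

lemma TF_add: "TF k C (\<lambda>i. x i + y i) w = TF k C x w + TF k C y w"
   "TF k C w (\<lambda>i. x i + y i) = TF k C w x + TF k C w y"
  by (simp_all add: TF_def adj_add mm_distribs sum.distrib)

text \<open>Pythagoras: \<open>b\<close> is orthogonal to every family vanishing at index \<open>m\<close>.\<close>

lemma TF_split:
  assumes C: "htup C" and b: "\<And>i. i \<le> k \<Longrightarrow> (\<Sum>j\<le>k. C (dd i j) \<diamondop> b j) = (if i = m then Q else 0)"
    and m: "m \<le> k" and ubm: "u m = b m"
  shows "TF k C u u = TF k C (\<lambda>i. u i - b i) (\<lambda>i. u i - b i) + adj (b m) \<diamondop> Q"
proof -
  define y where "y i = u i - b i" for i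
  have xb: "TF k C x b = adj (x m) \<diamondop> Q" for x
  proof -
    have "TF k C x b = (\<Sum>i\<le>k. adj (x i) \<diamondop> (\<Sum>j\<le>k. C (dd i j) \<diamondop> b j))"
      by (simp add: TF_def mm_sum_right mm_assoc)
    also have "\<dots> = (\<Sum>i\<le>k. if i = m then adj (x i) \<diamondop> Q else 0)"
      by (intro sum.cong refl) (simp add: b)
    finally show ?thesis using m by simp
  qed
  have yb: "TF k C y b = 0" using ubm by (simp add: xb y_def)
  then have by0: "TF k C b y = 0" using TF_adj[OF C, of k y b] by simp
  have "TF k C u u = TF k C (\<lambda>i. y i + b i) (\<lambda>i. y i + b i)"
    by (simp add: y_def)
  also have "\<dots> = TF k C y y + TF k C b b"
    by (simp only: TF_add yb by0 add_0_left add_0_right)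
  finally show ?thesis by (simp add: xb y_def[abs_def])
qed

text \<open>Weaker than \<open>supp\<close>: only the rows are confined to the box, so that a vector
  repeated in every column is admissible as a test matrix.\<close>

definition rsupp :: "cmx \<Rightarrow> bool" where "rsupp u \<longleftrightarrow> one \<diamondop> u = u"

lemma rsupp_diff [intro]: "rsupp u \<Longrightarrow> rsupp w \<Longrightarrow> rsupp (u - w)"
  by (simp add: rsupp_def mm_distribs)

lemma rsupp_mm [intro]: "rsupp u \<Longrightarrow> rsupp (u \<diamondop> w)"
  by (simp add: rsupp_def mm_assoc[symmetric])

lemma supp_rsupp [intro]: "supp u \<Longrightarrow> rsupp u"
  by (simp add: rsupp_def)

lemma rsupp_zero [simp]: "rsupp 0"
  by (simp add: rsupp_def)

lemma rsupp_one [simp]: "rsupp u \<Longrightarrow> one \<diamondop> u = u"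
  by (simp add: rsupp_def)

text \<open>Block elimination from the last index. The reversed predictor times
  \<open>u (Suc k)\<close> is orthogonal to all families vanishing at \<open>Suc k\<close>;
  splitting it off leaves a family of size \<open>k\<close> and the form of
  \<open>LP C (Suc k)\<close>.\<close>

lemma TF_nonneg:
  assumes C: "htup C" and "\<And>j. j \<le> k \<Longrightarrow> posdef (LP C j)" and "\<And>i. rsupp (u i)"
  shows "0 \<le> Re (TF k C u u c c)"
  using assms(2,3)
proof (induction k arbitrary: u)
  case 0
  then show ?case
    using C Re_qf_one_nonneg[of "\<lambda>i. u 0 i c"] by (simp add: TF_def htupD qf_eq)
next
  case (Suc k)
  define b where "b j = LA C (Suc k) (Suc k - j) \<diamondop> u (Suc k)" for j
  have reg: "\<And>j. j < Suc k \<Longrightarrow> fdet (LP C j) \<noteq> 0"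
    using Suc.prems(1) posdef_fdet(3) by auto
  have bK: "b (Suc k) = u (Suc k)" using Suc.prems(2) by (simp add: b_def)
  have nb: "(\<Sum>j\<le>Suc k. C (dd i j) \<diamondop> b j) = (if i = Suc k then LP C (Suc k) \<diamondop> u (Suc k) else 0)" if "i \<le> Suc k" for i
  proof -
    have "(\<Sum>j\<le>Suc k. C (dd i j) \<diamondop> b j) = (\<Sum>j\<le>Suc k. C (dd i j) \<diamondop> LA C (Suc k) (Suc k - j)) \<diamondop> u (Suc k)"
      by (simp only: b_def mm_sum_left mm_assoc)
    also have "(\<Sum>j\<le>Suc k. C (dd i j) \<diamondop> LA C (Suc k) (Suc k - j)) =
       (\<Sum>j\<le>Suc k. C (dd (Suc k - i) j) \<diamondop> LA C (Suc k) j)"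
      using that dd_flip[of i "Suc k"]
      by (intro sum.reindex_bij_witness[of _ "\<lambda>j. Suc k - j" "\<lambda>j. Suc k - j"]) (auto simp: dd_def add.commute)
    also have "\<dots> = (if Suc k - i = 0 then LP C (Suc k) else 0)"
      using conjunct1[OF levinson(1)[OF C reg], rule_format, of "Suc k" "Suc k - i"] by simp
    finally have *: "(\<Sum>j\<le>Suc k. C (dd i j) \<diamondop> b j) = (if Suc k - i = 0 then LP C (Suc k) else 0) \<diamondop> u (Suc k)" .
    show ?thesis
    proof (cases "i = Suc k")
      case True
      then show ?thesis using * by simp
    next
      case False
      then have "Suc k - i \<noteq> 0" using that by simp
      then show ?thesis using * by (simp only: if_False mm_zero_left False)
    qed
  qed
  define y where "y i = u i - b i" for i
  have y: "rsupp (y i)" "y (Suc k) = 0" for i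
    unfolding y_def
    by (unfold b_def, intro rsupp_diff Suc.prems(2) rsupp_mm supp_rsupp supp_LA C)
      (use Suc.prems(2) in simp)
  have "TF (Suc k) C u u = TF (Suc k) C y y + adj (u (Suc k)) \<diamondop> (LP C (Suc k) \<diamondop> u (Suc k))"
    using TF_split[where k = "Suc k" and m = "Suc k" and u = u and b = b, OF C nb _ bK[symmetric]] unfolding y_def[abs_def] bK by simp
  also have "TF (Suc k) C y y = TF k C y y"
    by (simp add: TF_def y(2))
  finally have "TF (Suc k) C u u c c = TF k C y y c c + qf (LP C (Suc k)) (\<lambda>i. u (Suc k) i c)"
    by (simp add: qf_eq mm_assoc[symmetric])
  moreover have "0 \<le> Re (TF k C y y c c)"
    using Suc y(1) by simp
  moreover have "0 \<le> Re (qf (LP C (Suc k)) (\<lambda>i. u (Suc k) i c))"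
    using posdef_psd[of "LP C (Suc k)"] Suc.prems(1) by (simp add: psd_def)
  ultimately show ?case by simp
qed

lemma normal_LA:
  assumes C: "htup C" and reg: "\<And>j. j < k \<Longrightarrow> fdet (LP C j) \<noteq> 0" and i: "i \<le> k"
  shows "(\<Sum>j\<le>k. C (dd i j) \<diamondop> (LA C k j \<diamondop> w)) = (if i = 0 then LP C k \<diamondop> w else 0)"
proof -
  have "(\<Sum>j\<le>k. C (dd i j) \<diamondop> (LA C k j \<diamondop> w)) = (\<Sum>j\<le>k. C (dd i j) \<diamondop> LA C k j) \<diamondop> w"
    by (simp only: mm_sum_left mm_assoc)
  then show ?thesis using levinson(1)[OF C reg] i by auto
qed

text \<open>Minimality of the Schur complement: for prescribed \<open>u 0\<close> the form is
  smallest at the predictor family \<open>LA C k j \<diamondop> u 0\<close>, since what remains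
  after splitting it off is nonnegative.\<close>

lemma qf_LP_le:
  assumes C: "htup C" and pos: "\<And>j. j \<le> k \<Longrightarrow> posdef (LP C j)" and u: "\<And>i. rsupp (u i)"
  shows "Re (qf (LP C k) (\<lambda>i. u 0 i c)) \<le> Re (TF k C u u c c)"
proof -
  have reg: "\<And>j. j < k \<Longrightarrow> fdet (LP C j) \<noteq> 0"
    using pos posdef_fdet(3) by auto
  define b where "b j = LA C k j \<diamondop> u 0" for j
  have b0: "u 0 = b 0" using u by (simp add: b_def)
  have "TF k C u u = TF k C (\<lambda>i. u i - b i) (\<lambda>i. u i - b i) + adj (b 0) \<diamondop> (LP C k \<diamondop> u 0)"
    by (rule TF_split[where m = 0 and u = u and b = b, OF C _ _ b0]) (auto simp: b_def normal_LA[OF C reg] simp del: LA_at_0)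
  then have "TF k C u u c c = TF k C (\<lambda>i. u i - b i) (\<lambda>i. u i - b i) c c + qf (LP C k) (\<lambda>i. u 0 i c)"
    by (simp add: b0[symmetric] qf_eq mm_assoc[symmetric])
  moreover have "0 \<le> Re (TF k C (\<lambda>i. u i - b i) (\<lambda>i. u i - b i) c c)"
  proof (rule TF_nonneg[OF C pos])
    show "rsupp (u i - b i)" for i
      unfolding b_def by (intro rsupp_diff u rsupp_mm supp_rsupp supp_LA C)
  qed
  ultimately show ?thesis by simp
qed

text \<open>The case of equality in \<open>qf_LP_le\<close>. It needs no positivity, and so serves
  to carry positivity of the form over to \<open>LP\<close>.\<close>

lemma TF_LA:
  assumes C: "htup C" and reg: "\<And>j. j < k \<Longrightarrow> fdet (LP C j) \<noteq> 0" and w: "rsupp w"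
  shows "TF k C (\<lambda>j. LA C k j \<diamondop> w) (\<lambda>j. LA C k j \<diamondop> w) c c = qf (LP C k) (\<lambda>i. w i c)"
proof -
  define b where "b j = LA C k j \<diamondop> w" for j
  have "TF k C b b = TF k C (\<lambda>i. b i - b i) (\<lambda>i. b i - b i) + adj (b 0) \<diamondop> (LP C k \<diamondop> w)"
    by (rule TF_split[where m = 0, OF C]) (auto simp: b_def normal_LA[OF C reg] simp del: LA_at_0)
  then show ?thesis
    using w by (simp add: b_def[abs_def] TF_def qf_eq mm_assoc[symmetric])
qed

text \<open>Testing the form on families supported at \<open>0\<close> and \<open>j\<close> only.\<close>

lemma Re_qf_LP_le:
  assumes C: "htup C" and pos: "\<And>j. j \<le> k \<Longrightarrow> posdef (LP C j)" and j: "1 \<le> j" "j \<le> k"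
  shows "Re (qf (LP C k) v) \<le> Re (qf (one - C j \<diamondop> C j) v)"
proof -
  define V :: cmx where "V = (\<lambda>i l. if i < p then v i else 0)"
  \<comment> \<open>The entry \<open>- (C j \<diamondop> V)\<close> at \<open>j\<close> minimises
    the two-point form and completes the square to
    \<open>one - C j \<diamondop> C j\<close>.\<close>
  define u where "u i = (if i = 0 then V else if i = j then - (C j \<diamondop> V) else 0)" for i :: nat
  have V: "rsupp V" by (simp add: rsupp_def mm_one_left V_def fun_eq_iff)
  have qV: "qf X (\<lambda>i. V i 0) = qf X v" for X
    unfolding qf_def V_def by (intro sum.cong refl) auto
  have u: "rsupp (u i)" for i
    using V C by (auto simp: u_def rsupp_def mm_distribs mm_assoc[symmetric] htupD)
  have "TF k C u u = (\<Sum>i\<in>{0,j}. \<Sum>l\<in>{0,j}. adj (u i) \<diamondop> C (dd i l) \<diamondop> u l)"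
    unfolding TF_def using j
    by (intro sum.mono_neutral_cong_right sum.mono_neutral_cong_right ballI) (auto simp: u_def)
  also have "\<dots> = adj V \<diamondop> (one - C j \<diamondop> C j) \<diamondop> V"
    using j C V
    by (simp add: u_def htupD mm_distribs adj_mm herm_adj mm_assoc adj_diff[of 0 "_ \<diamondop> _", simplified]
        rsupp_one[OF rsupp_mm[OF supp_rsupp[OF htupD(3)[OF C]]]])
  finally have "TF k C u u 0 0 = qf (one - C j \<diamondop> C j) v"
    by (simp only: qf_eq qV)
  with qf_LP_le[where u = u and k = k and c = 0, OF C pos u] show ?thesis
    by (simp add: u_def qV)
qed

text \<open>Only the \<open>(0, 0)\<close> entry of the form is tested; any vector can be the column \<open>0\<close> of \<open>u\<close>.\<close>

definition tpsd :: "nat \<Rightarrow> (nat \<Rightarrow> cmx) \<Rightarrow> bool" where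
  "tpsd n C \<longleftrightarrow> (\<forall>u. (\<forall>i. rsupp (u i)) \<longrightarrow> 0 \<le> Re (TF n C u u 0 0))"

definition csc :: "real \<Rightarrow> cmx \<Rightarrow> cmx" where
  "csc t X = (\<lambda>i j. complex_of_real t * X i j)"

text \<open>Dilation towards the tuple (1, 0, 0, ...), whose Toeplitz matrix is the identity. It
  serves twice: with factor below 1 to enter the interior, and with factor tending to 0 for the
  scaling limit.\<close>

definition tsc :: "real \<Rightarrow> (nat \<Rightarrow> cmx) \<Rightarrow> nat \<Rightarrow> cmx" where
  "tsc t C = (\<lambda>j. if j = 0 then one else csc t (C j))"

lemma csc_mm: "csc t X \<diamondop> Y = csc t (X \<diamondop> Y)" "X \<diamondop> csc t Y = csc t (X \<diamondop> Y)"
  by (simp_all add: csc_def mm_def sum_distrib_left mult_ac)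

lemma csc_sum: "csc t (\<Sum>i\<in>I. f i) = (\<Sum>i\<in>I. csc t (f i))"
  by (simp add: csc_def sum_fun_apply fun_eq_iff sum_distrib_left)

lemma csc_split: "X = csc t X + csc (1 - t) X"
  by (simp add: csc_def fun_eq_iff algebra_simps)

lemma supp_csc: "supp X \<Longrightarrow> supp (csc t X)"
  by (auto simp: supp_def csc_def)

lemma herm_csc: "herm X \<Longrightarrow> herm (csc t X)"
  by (auto simp: herm_def supp_csc) (auto simp: csc_def adj_def fun_eq_iff)

lemma htup_tsc: "htup C \<Longrightarrow> htup (tsc t C)"
  by (auto simp: htup_def tsc_def herm_csc)

lemma tpsd_mono:
  assumes "tpsd n C" "k \<le> n" "\<And>i. rsupp (u i)"
  shows "0 \<le> Re (TF k C u u 0 0)"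
proof -
  define u' where "u' i = (if i \<le> k then u i else 0)" for i
  have "TF n C u' u' = TF k C u u"
    unfolding TF_def using assms(2)
    by (intro sum.mono_neutral_cong_right sum.mono_neutral_cong_right ballI) (auto simp: u'_def)
  moreover have "0 \<le> Re (TF n C u' u' 0 0)"
    using assms(1,3) by (auto simp: tpsd_def u'_def)
  ultimately show ?thesis by simp
qed

lemma TF_tsc:
  assumes C: "htup C" and u: "\<And>i. rsupp (u i)"
  shows "TF k (tsc t C) u u = csc t (TF k C u u) + csc (1 - t) (\<Sum>i\<le>k. adj (u i) \<diamondop> u i)"
proof -
  have "TF k (tsc t C) u u = (\<Sum>i\<le>k. \<Sum>j\<le>k. csc t (adj (u i) \<diamondop> C (dd i j) \<diamondop> u j) +
      (if i = j then csc (1 - t) (adj (u i) \<diamondop> u i) else 0))"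
    unfolding TF_def
  proof (intro sum.cong refl)
    fix i j
    show "adj (u i) \<diamondop> tsc t C (dd i j) \<diamondop> u j = csc t (adj (u i) \<diamondop> C (dd i j) \<diamondop> u j) +
        (if i = j then csc (1 - t) (adj (u i) \<diamondop> u i) else 0)"
      using u C csc_split[of "adj (u i) \<diamondop> u i" t]
      by (cases "i = j") (auto simp: tsc_def htupD mm_assoc csc_mm dd_def)
  qed
  also have "\<dots> = csc t (TF k C u u) + csc (1 - t) (\<Sum>i\<le>k. adj (u i) \<diamondop> u i)"
    by (simp add: TF_def sum.distrib csc_sum)
  finally show ?thesis .
qed

text \<open>The dilated form is t times that of \<open>C\<close> plus 1 - t times the identity form,
  hence positive definite. \<open>TF_LA\<close> evaluates it on the predictor family, where it
  equals the form of \<open>LP\<close>; strong induction supplies the invertibility behind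
  \<open>TF_LA\<close>.\<close>

lemma tpsd_tsc_posdef:
  assumes C: "htup C" and T: "tpsd n C" and t: "0 \<le> t" "t < 1" and k: "k \<le> n"
  shows "posdef (LP (tsc t C) k)"
  using k
proof (induction k rule: less_induct)
  case (less k)
  have Ct: "htup (tsc t C)" by (rule htup_tsc[OF C])
  have reg: "fdet (LP (tsc t C) j) \<noteq> 0" if "j < k" for j
    using less that posdef_fdet(3) by auto
  show ?case
    unfolding posdef_def
  proof (intro conjI allI impI)
    show "herm (LP (tsc t C) k)" using levinson(1)[OF Ct reg] by blast
    fix v :: "nat \<Rightarrow> complex" assume v: "\<exists>i<p. v i \<noteq> 0"
    define V :: cmx where "V = (\<lambda>i l. if i < p then v i else 0)"
    have V: "rsupp V" by (simp add: rsupp_def mm_one_left V_def fun_eq_iff)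
    have qV: "qf X (\<lambda>i. V i 0) = qf X v" for X
      unfolding qf_def V_def by (intro sum.cong refl) auto
    define a where "a j = LA (tsc t C) k j \<diamondop> V" for j
    have a: "rsupp (a j)" for j unfolding a_def using Ct by (intro rsupp_mm supp_rsupp supp_LA)
    have qa: "(adj (a i) \<diamondop> a i) 0 0 = qf one (\<lambda>j. a i j 0)" for i
      using a[of i] by (simp add: qf_eq[symmetric] mm_assoc)
    have "qf (LP (tsc t C) k) v = TF k (tsc t C) a a 0 0"
      unfolding a_def by (simp add: TF_LA[OF Ct reg V] qV)
    also have "\<dots> = of_real t * TF k C a a 0 0 + of_real (1 - t) * (\<Sum>i\<le>k. qf one (\<lambda>j. a i j 0))"
      unfolding TF_tsc[OF C a] by (simp add: csc_def sum_fun_apply qa)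
    finally have "Re (qf (LP (tsc t C) k) v) = t * Re (TF k C a a 0 0) + (1 - t) * (\<Sum>i\<le>k. Re (qf one (\<lambda>j. a i j 0)))"
      by simp
    moreover have "0 \<le> Re (TF k C a a 0 0)" by (rule tpsd_mono[OF T less.prems a])
    moreover have "Re (qf one (\<lambda>j. a 0 j 0)) \<le> (\<Sum>i\<le>k. Re (qf one (\<lambda>j. a i j 0)))"
      by (intro member_le_sum Re_qf_one_nonneg) auto
    moreover have "0 < Re (qf one (\<lambda>j. a 0 j 0))"
      using Re_qf_one_pos[OF v] V by (simp add: a_def qV)
    ultimately show "0 < Re (qf (LP (tsc t C) k) v)"
      using t by (smt (verit) mult_nonneg_nonneg mult_pos_pos)
  qed
qed

lemma posdef_tpsd: "htup C \<Longrightarrow> (\<And>k. k \<le> n \<Longrightarrow> posdef (LP C k)) \<Longrightarrow> tpsd n C"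
  by (auto simp: tpsd_def intro: TF_nonneg)

text \<open>The choice \<open>- LM C' N\<close> for the next moment makes the innovation
  \<open>LE\<close> vanish, so \<open>LP\<close> does not change: the central, or maximum entropy,
  extension.\<close>

lemma extend_htup:
  assumes C: "htup C" and pos: "\<And>k. k \<le> n \<Longrightarrow> posdef (LP C k)" and "n \<le> N"
  shows "\<exists>C'. htup C' \<and> (\<forall>j\<le>n. C' j = C j) \<and> (\<forall>k\<le>N. posdef (LP C' k))"
  using \<open>n \<le> N\<close>
proof (induction N rule: dec_induct)
  case base
  then show ?case using C pos by blast
next
  case (step N)
  then obtain C' where C': "htup C'" "\<And>j. j \<le> n \<Longrightarrow> C' j = C j" "\<And>k. k \<le> N \<Longrightarrow> posdef (LP C' k)"
    by blast
  define D where "D = C'(Suc N := - LM C' N)"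
  have "herm (LM C' N)" using C'(3) posdef_fdet(3) by (intro herm_LM[OF C'(1)]) auto
  then have "herm (0 - LM C' N)" by (intro herm_diff) (auto simp: herm_def)
  then have D: "htup D" using C'(1) by (auto simp: htup_def D_def)
  have LPD: "LP D k = LP C' k" if "k \<le> N" for k
    by (rule LP_cong) (use that in \<open>auto simp: D_def\<close>)
  have "LM D N = LM C' N" by (rule LM_cong) (auto simp: D_def)
  then have "LE D N = 0" by (simp add: LE_eq[OF D]) (simp add: D_def)
  then have "LP D (Suc N) = LP C' N" by (simp add: LP_Suc LPD)
  then have "\<forall>k\<le>Suc N. posdef (LP D k)"
    using C'(3) LPD by (metis le_Suc_eq order_refl)
  moreover have "\<forall>j\<le>n. D j = C j" using C'(2) step.hyps by (auto simp: D_def)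
  ultimately show ?case using D by blast
qed

text \<open>\<open>finv (LP C k)\<close> is \<open>adj (finv L) \<diamondop> finv L\<close>, so the
  inner Cholesky factors cancel in the quadratic term of the recursion and
  \<open>V \<diamondop> V\<close> is left between \<open>L\<close> and \<open>adj L\<close>.\<close>

lemma LP_Suc_chol:
  assumes C: "htup C" and L: "supp L" "fdet L \<noteq> 0" and P: "LP C k = L \<diamondop> adj L"
    and E: "LE C k = L \<diamondop> V \<diamondop> adj L" and V: "supp V"
  shows "LP C (Suc k) = L \<diamondop> (one - V \<diamondop> V) \<diamondop> adj L"
proof -
  have aL: "supp (adj L)" "fdet (adj L) \<noteq> 0" using L by (auto simp: fdet_adj)
  have "finv (LP C k) = adj (finv L) \<diamondop> finv L"
  proof (rule finv_unique)
    show "LP C k \<diamondop> (adj (finv L) \<diamondop> finv L) = one"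
      using finv_left[OF L] finv_right[OF L] L(1)
      by (simp add: P mm_assoc) (simp add: mm_assoc[symmetric] adj_mm[symmetric])
  qed (use C L aL in \<open>auto simp: P fdet_mm\<close>)
  moreover have "adj L \<diamondop> adj (finv L) = one"
    using finv_left[OF L] by (simp add: adj_mm[symmetric])
  ultimately have "adj L \<diamondop> (finv (LP C k) \<diamondop> (L \<diamondop> X)) = X" if "rsupp X" for X
    using finv_left[OF L] that by (simp add: mm_assoc[symmetric])
  from this[of "V \<diamondop> adj L"] show ?thesis
    using V L by (simp add: LP_Suc E P mm_assoc mm_distribs supp_rsupp rsupp_mm)
qed

end

section \<open>Changes of variables\<close>

interpretation lb: product_sigma_finite "\<lambda>_::'i. lborel :: real measure"
  by standard

text \<open>A shift depends only on coordinates of strictly smaller rank, so the coordinate of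
  largest rank occurs in no shift. It is integrated first, by the affine substitution in one
  variable, and the rest is the same statement for fewer coordinates.\<close>

lemma nn_integral_PiM_triangular:
  fixes a :: "'i \<Rightarrow> real" and g :: "'i \<Rightarrow> ('i \<Rightarrow> real) \<Rightarrow> real" and r :: "'i \<Rightarrow> nat"
  assumes "finite I" and "\<And>i. i \<in> I \<Longrightarrow> a i \<noteq> 0"
    and "\<And>i. i \<in> I \<Longrightarrow> g i \<in> borel_measurable (PiM I (\<lambda>_. lborel))"
    and "\<And>i x y. i \<in> I \<Longrightarrow> (\<And>j. j \<in> I \<Longrightarrow> r j < r i \<Longrightarrow> x j = y j) \<Longrightarrow> g i x = g i y"
    and "f \<in> borel_measurable (PiM I (\<lambda>_. lborel))"
  shows "(\<integral>\<^sup>+x. f (\<lambda>i\<in>I. a i * x i + g i x) \<partial>PiM I (\<lambda>_. lborel)) * ennreal (\<Prod>i\<in>I. \<bar>a i\<bar>) =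
    (\<integral>\<^sup>+x. f x \<partial>PiM I (\<lambda>_. lborel))"
  using assms
proof (induction I arbitrary: f g rule: finite_ranking_induct[where f = r])
  case empty
  show ?case by (simp add: restrict_def PiM_empty nn_integral_count_space_finite)
next
  case (insert i S)
  show ?case
  proof (cases "i \<in> S")
    case True
    show ?thesis
      using insert.prems unfolding insert_absorb[OF True] by (rule insert.IH)
  next
    case iS: False
    note fin = \<open>finite S\<close>
    have a: "a i \<noteq> 0" using insert.prems(1) by simp
    note gm = insert.prems(2) and gd = insert.prems(3)
    \<comment> \<open>The value 0 is arbitrary: coordinate \<open>i\<close> has the largest rank, so
      no shift depends on it.\<close>
    define g' where "g' j x = g j (x(i := 0))" for j x
    have upd: "(\<lambda>x. x(i := y)) \<in> measurable (PiM S (\<lambda>_. lborel)) (PiM (insert i S) (\<lambda>_. lborel :: real measure))" for y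
      by (rule measurable_fun_upd[of _ S]) auto
    have add_dim: "(\<lambda>(x, y). x(i := y)) \<in> measurable (PiM S (\<lambda>_. lborel) \<Otimes>\<^sub>M lborel) (PiM (insert i S) (\<lambda>_. lborel :: real measure))"
      using measurable_add_dim[of i S "\<lambda>_. lborel"] .
    have g'm: "g' j \<in> borel_measurable (PiM S (\<lambda>_. lborel))" if "j \<in> insert i S" for j
      unfolding g'_def using measurable_compose[OF upd gm[OF that]] .
    have rj: "r j \<le> r i" if "j \<in> insert i S" for j using insert.hyps(2) that by auto
    have g': "g j (x(i := y)) = g' j x" if "j \<in> insert i S" for j x y
      unfolding g'_def by (rule gd[OF that]) (use rj[OF that] in auto)
    define z where "z x = (\<lambda>j\<in>S. a j * x j + g' j x)" for x
    have zm: "z \<in> measurable (PiM S (\<lambda>_. lborel)) (PiM S (\<lambda>_. lborel))"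
      unfolding z_def
    proof (rule measurable_restrict)
      fix j assume "j \<in> S"
      then have "g' j \<in> borel_measurable (PiM S (\<lambda>_. lborel))" "(\<lambda>x. x j) \<in> PiM S (\<lambda>_. lborel) \<rightarrow>\<^sub>M lborel"
        using g'm by (auto intro: measurable_component_singleton)
      then show "(\<lambda>x. a j * x j + g' j x) \<in> PiM S (\<lambda>_. lborel) \<rightarrow>\<^sub>M lborel"
        unfolding measurable_lborel1 measurable_lborel2 by (intro borel_measurable_add borel_measurable_times borel_measurable_const)
    qed
    define h where "h x = (\<integral>\<^sup>+y. f (x(i := y)) \<partial>lborel)" for x
    have "(\<lambda>(x, y). f (x(i := y))) \<in> borel_measurable (PiM S (\<lambda>_. lborel) \<Otimes>\<^sub>M lborel)"
      using measurable_compose[OF add_dim insert.prems(4)] by (simp only: case_prod_unfold)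
    then have hm: "h \<in> borel_measurable (PiM S (\<lambda>_. lborel))"
      unfolding h_def by (rule sigma_finite_measure.borel_measurable_nn_integral[OF sigma_finite_lborel])
    have Tm: "(\<lambda>x. f (\<lambda>j\<in>insert i S. a j * x j + g j x)) \<in> borel_measurable (PiM (insert i S) (\<lambda>_. lborel))"
    proof (rule measurable_compose[OF _ insert.prems(4)], rule measurable_restrict)
      fix j assume "j \<in> insert i S"
      then have "g j \<in> borel_measurable (PiM (insert i S) (\<lambda>_. lborel))" "(\<lambda>x. x j) \<in> PiM (insert i S) (\<lambda>_. lborel) \<rightarrow>\<^sub>M lborel"
        using gm by (auto intro: measurable_component_singleton)
      then show "(\<lambda>x. a j * x j + g j x) \<in> PiM (insert i S) (\<lambda>_. lborel) \<rightarrow>\<^sub>M lborel"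
        unfolding measurable_lborel1 measurable_lborel2 by (intro borel_measurable_add borel_measurable_times borel_measurable_const)
    qed
    have inner: "(\<integral>\<^sup>+y. f (\<lambda>j\<in>insert i S. a j * (x(i := y)) j + g j (x(i := y))) \<partial>lborel) * ennreal \<bar>a i\<bar> = h (z x)"
      if x: "x \<in> space (PiM S (\<lambda>_. lborel))" for x
    proof -
      have zx: "z x \<in> space (PiM S (\<lambda>_. lborel))" using measurable_space[OF zm x] .
      have "(\<lambda>y. f ((z x)(i := y))) \<in> borel_measurable borel"
        using measurable_compose[OF measurable_component_update[OF zx iS] insert.prems(4)]
        by (simp only: measurable_lborel2)
      have "(\<lambda>j\<in>insert i S. a j * (x(i := y)) j + g j (x(i := y))) = (z x)(i := g' i x + a i * y)" for y
        using iS by (auto simp: z_def fun_eq_iff g')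
      then show ?thesis
        unfolding h_def
        using nn_integral_real_affine[where c = "a i" and t = "g' i x" and f = "\<lambda>y. f ((z x)(i := y))"]
      by (simp only: mult.commute a not_False_eq_True \<open>(\<lambda>y. f ((z x)(i := y))) \<in> borel_measurable borel\<close>)
    qed
    have IH: "(\<integral>\<^sup>+x. h (z x) \<partial>PiM S (\<lambda>_. lborel)) * ennreal (\<Prod>j\<in>S. \<bar>a j\<bar>) = (\<integral>\<^sup>+x. h x \<partial>PiM S (\<lambda>_. lborel))"
      unfolding z_def
    proof (rule insert.IH)
      show "g' j x = g' j y" if "j \<in> S" "\<And>l. l \<in> S \<Longrightarrow> r l < r j \<Longrightarrow> x l = y l" for j x y
        unfolding g'_def by (rule gd) (use that in auto)
    qed (use insert.prems(1) g'm hm in \<open>simp_all\<close>)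
    have "(\<integral>\<^sup>+x. f (\<lambda>j\<in>insert i S. a j * x j + g j x) \<partial>PiM (insert i S) (\<lambda>_. lborel)) * ennreal \<bar>a i\<bar> =
       (\<integral>\<^sup>+x. (\<integral>\<^sup>+y. f (\<lambda>j\<in>insert i S. a j * (x(i := y)) j + g j (x(i := y))) \<partial>lborel) * ennreal \<bar>a i\<bar> \<partial>PiM S (\<lambda>_. lborel))"
    proof -
      have "(\<lambda>(x, y). f (\<lambda>j\<in>insert i S. a j * (x(i := y)) j + g j (x(i := y)))) \<in>
          borel_measurable (PiM S (\<lambda>_. lborel) \<Otimes>\<^sub>M lborel)"
        using measurable_compose[OF add_dim Tm] by (simp only: case_prod_unfold)
      then have "(\<lambda>x. \<integral>\<^sup>+y. f (\<lambda>j\<in>insert i S. a j * (x(i := y)) j + g j (x(i := y))) \<partial>lborel) \<in>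
          borel_measurable (PiM S (\<lambda>_. lborel))"
        by (rule sigma_finite_measure.borel_measurable_nn_integral[OF sigma_finite_lborel])
      then show ?thesis
        unfolding lb.product_nn_integral_insert[OF fin iS Tm] by (rule nn_integral_multc[symmetric])
    qed
    also have "\<dots> = (\<integral>\<^sup>+x. h (z x) \<partial>PiM S (\<lambda>_. lborel))"
      by (intro nn_integral_cong inner)
    finally have step: "(\<integral>\<^sup>+x. f (\<lambda>j\<in>insert i S. a j * x j + g j x) \<partial>PiM (insert i S) (\<lambda>_. lborel)) *
        ennreal \<bar>a i\<bar> = (\<integral>\<^sup>+x. h (z x) \<partial>PiM S (\<lambda>_. lborel))" .
    have "ennreal (\<Prod>j\<in>insert i S. \<bar>a j\<bar>) = ennreal \<bar>a i\<bar> * ennreal (\<Prod>j\<in>S. \<bar>a j\<bar>)"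
      using fin iS by (simp add: ennreal_mult prod_nonneg)
    then have "(\<integral>\<^sup>+x. f (\<lambda>j\<in>insert i S. a j * x j + g j x) \<partial>PiM (insert i S) (\<lambda>_. lborel)) *
        ennreal (\<Prod>j\<in>insert i S. \<bar>a j\<bar>) = (\<integral>\<^sup>+x. h x \<partial>PiM S (\<lambda>_. lborel))"
      by (simp only: mult.assoc[symmetric] step IH)
    also have "\<dots> = (\<integral>\<^sup>+x. f x \<partial>PiM (insert i S) (\<lambda>_. lborel))"
      unfolding h_def by (rule lb.product_nn_integral_insert[OF fin iS insert.prems(4), symmetric])
    finally show ?thesis .
  qed
qed

text \<open>The two measures agree on boxes. This identifies the slice of coordinates of a single
  moment with the coordinates of one matrix.\<close>

lemma nn_integral_PiM_reindex:
  fixes h :: "'i \<Rightarrow> 'j"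
  assumes J: "finite J" and h: "inj_on h J" and f: "f \<in> borel_measurable (PiM J (\<lambda>_. lborel :: real measure))"
  shows "(\<integral>\<^sup>+x. f (\<lambda>i\<in>J. x (h i)) \<partial>PiM (h ` J) (\<lambda>_. lborel)) = (\<integral>\<^sup>+x. f x \<partial>PiM J (\<lambda>_. lborel))"
proof -
  let ?T = "\<lambda>x :: 'j \<Rightarrow> real. \<lambda>i\<in>J. x (h i)"
  have T [measurable]: "?T \<in> measurable (PiM (h ` J) (\<lambda>_. lborel)) (PiM J (\<lambda>_. lborel))"
    by (rule measurable_restrict) auto
  have "distr (PiM (h ` J) (\<lambda>_. lborel)) (PiM J (\<lambda>_. lborel)) ?T = PiM J (\<lambda>_. lborel)"
  proof (rule lb.PiM_eqI[OF J])
    fix A :: "'i \<Rightarrow> real set" assume A: "\<And>i. i \<in> J \<Longrightarrow> A i \<in> sets lborel"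
    have "?T -` Pi\<^sub>E J A \<inter> space (PiM (h ` J) (\<lambda>_. lborel)) = Pi\<^sub>E (h ` J) (\<lambda>j. A (the_inv_into J h j))"
      using the_inv_into_f_f[OF h] by (auto simp: space_PiM PiE_def Pi_def extensional_def)
    moreover have "Pi\<^sub>E J A \<in> sets (PiM J (\<lambda>_. lborel))"
      using A J by (intro sets_PiM_I_finite) auto
    ultimately have "emeasure (distr (PiM (h ` J) (\<lambda>_. lborel)) (PiM J (\<lambda>_. lborel)) ?T) (Pi\<^sub>E J A) =
        emeasure (PiM (h ` J) (\<lambda>_. lborel)) (Pi\<^sub>E (h ` J) (\<lambda>j. A (the_inv_into J h j)))"
      by (simp add: emeasure_distr[OF T])
    also have "\<dots> = (\<Prod>j\<in>h ` J. emeasure lborel (A (the_inv_into J h j)))"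
      using A J the_inv_into_f_f[OF h] by (intro lb.emeasure_PiM) auto
    also have "\<dots> = (\<Prod>i\<in>J. emeasure lborel (A i))"
      using the_inv_into_f_f[OF h] by (subst prod.reindex[OF h]) (auto intro!: prod.cong)
    finally show "emeasure (distr (PiM (h ` J) (\<lambda>_. lborel)) (PiM J (\<lambda>_. lborel)) ?T) (Pi\<^sub>E J A) =
        (\<Prod>i\<in>J. emeasure lborel (A i))" .
  qed simp
  then show ?thesis
    using nn_integral_distr[OF T, of f] f by simp
qed

section \<open>Real coordinates of hermitian matrices\<close>

abbreviation lbI :: "'i set \<Rightarrow> ('i \<Rightarrow> real) measure" where
  "lbI I \<equiv> PiM I (\<lambda>_. lborel)"

definition ibox :: "nat \<Rightarrow> (nat \<times> nat) set" where
  "ibox p = {..<p} \<times> {..<p}"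

lemma finite_ibox [simp]: "finite (ibox p)"
  by (simp add: ibox_def)

text \<open>Inverse of \<open>herm_of_coords\<close>: the imaginary part of an entry above the
  diagonal is stored at the transposed position.\<close>

definition herm_coord :: "(nat \<Rightarrow> nat \<Rightarrow> complex) \<Rightarrow> nat \<times> nat \<Rightarrow> real" where
  "herm_coord X = (\<lambda>(i, j). if i \<le> j then Re (X i j) else Im (X j i))"

context cmats
begin

lemma herm_of_coords_herm: "herm (herm_of_coords p c)"
  by (auto simp: herm_def supp_def adj_def herm_of_coords_def fun_eq_iff complex_eq_iff)

lemma herm_of_coords_coord:
  assumes "herm X" "\<And>i j. i < p \<Longrightarrow> j < p \<Longrightarrow> c (i, j) = herm_coord X (i, j)"
  shows "herm_of_coords p c = X"
proof (intro ext)
  fix i j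
  have s: "X i j = cnj (X j i)" for i j
    using assms(1) unfolding herm_def adj_def by metis
  have 0: "X i j = 0" if "\<not> (i < p \<and> j < p)" for i j
    using assms(1) that unfolding herm_def supp_def by blast
  have "Im (X i i) = 0" using arg_cong[OF s[of i i], of Im] by simp
  then show "herm_of_coords p c i j = X i j"
    using 0[of i j] arg_cong[OF s[of i j], of Re] arg_cong[OF s[of i j], of Im]
    by (auto simp: herm_of_coords_def assms(2) herm_coord_def complex_eq_iff)
qed

lemma measurable_herm_of_coords [measurable]:
  "(\<lambda>c. herm_of_coords p c i j) \<in> borel_measurable (lbI (ibox p))"
proof (cases "i < p \<and> j < p")
  case True
  then have "(i, j) \<in> ibox p" "(j, i) \<in> ibox p" "(i, i) \<in> ibox p"
    by (auto simp: ibox_def)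
  then have [measurable]: "(\<lambda>c. c (i, j)) \<in> borel_measurable (lbI (ibox p))"
      "(\<lambda>c. c (j, i)) \<in> borel_measurable (lbI (ibox p))" "(\<lambda>c. c (i, i)) \<in> borel_measurable (lbI (ibox p))"
    using measurable_component_singleton[of _ "ibox p" "\<lambda>_. lborel :: real measure"] by auto
  show ?thesis
  proof (cases i j rule: linorder_cases)
    case less
    then have "herm_of_coords p c i j = complex_of_real (c (i, j)) + \<i> * complex_of_real (c (j, i))" for c
      using True by (simp add: herm_of_coords_def Complex_eq)
    then show ?thesis by simp
  next
    case equal
    then have "herm_of_coords p c i j = complex_of_real (c (i, i))" for c
      using True by (simp add: herm_of_coords_def)
    then show ?thesis by simp
  next
    case greater
    then have "herm_of_coords p c i j = complex_of_real (c (j, i)) - \<i> * complex_of_real (c (i, j))" for c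
      using True by (simp add: herm_of_coords_def Complex_eq)
    then show ?thesis by simp
  qed
next
  case False
  then have "(\<lambda>c. herm_of_coords p c i j) = (\<lambda>_. 0)" by (auto simp: herm_of_coords_def)
  then show ?thesis by simp
qed

lemma herm_of_coords_cong:
  assumes "i < p" "j < p" "c (i, j) = c' (i, j)" "c (j, i) = c' (j, i)"
  shows "herm_of_coords p c i j = herm_of_coords p c' i j"
  using assms by (auto simp: herm_of_coords_def)

text \<open>For triangular \<open>L\<close>, the congruence is triangular in the entries ordered by \<open>i + j\<close>.\<close>

lemma nn_integral_herm_congruence:
  assumes L: "chol L d" and M: "herm M"
    and G: "(\<lambda>c. G (herm_of_coords p c)) \<in> borel_measurable (lbI (ibox p))"
  shows "(\<integral>\<^sup>+c. G (M + L \<diamondop> herm_of_coords p c \<diamondop> adj L) \<partial>lbI (ibox p)) * ennreal ((\<Prod>i<p. d i) ^ (2 * p)) =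
    (\<integral>\<^sup>+c. G (herm_of_coords p c) \<partial>lbI (ibox p))"
proof -
  let ?H = "herm_of_coords p"
  have d: "0 < d i" "L i i = complex_of_real (d i)" if "i < p" for i
    using L that by (auto simp: chol_def)
  have L0: "L i j = 0" if "i < j" for i j using L that by (auto simp: chol_def)
  define R where "R X i j = (\<Sum>a<p. \<Sum>b<p. if a = i \<and> b = j then 0 else L i a * X a b * cnj (L j b))" for X i j
  have LXL: "(L \<diamondop> X \<diamondop> adj L) i j = of_real (d i * d j) * X i j + R X i j" if "i < p" "j < p" for X i j
  proof -
    have "(L \<diamondop> X \<diamondop> adj L) i j = (\<Sum>a<p. \<Sum>b<p. L i a * X a b * cnj (L j b))"
      by (simp add: mm_def adj_def sum_distrib_right) (rule sum.swap)
    also have "\<dots> = (\<Sum>a<p. \<Sum>b<p. (if a = i \<and> b = j then L i a * X a b * cnj (L j b) else 0)) + R X i j"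
      unfolding R_def sum.distrib[symmetric] by (intro sum.cong refl) auto
    also have "(\<Sum>a<p. \<Sum>b<p. (if a = i \<and> b = j then L i a * X a b * cnj (L j b) else 0)) =
        (\<Sum>a<p. if a = i then \<Sum>b<p. (if b = j then L i a * X a b * cnj (L j b) else 0) else 0)"
      by (intro sum.cong refl) auto
    also have "\<dots> = of_real (d i * d j) * X i j"
      using that by (simp add: d mult_ac)
    finally show ?thesis .
  qed
  define g where "g = (\<lambda>(i, j) c. if i \<le> j then Re (M i j + R (?H c) i j) else Im (M j i + R (?H c) j i))"
  define a where "a = (\<lambda>(i, j). d i * d j)"
  have eq: "?H (\<lambda>ij\<in>ibox p. a ij * c ij + g ij c) = M + L \<diamondop> ?H c \<diamondop> adj L" for c
  proof (rule herm_of_coords_coord)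
    show "herm (M + L \<diamondop> ?H c \<diamondop> adj L)"
      using M L by (intro herm_add herm_conj herm_of_coords_herm) (auto simp: chol_def)
    fix i j assume ij: "i < p" "j < p"
    then have "(i, j) \<in> ibox p" by (simp add: ibox_def)
    then show "(\<lambda>ij\<in>ibox p. a ij * c ij + g ij c) (i, j) = herm_coord (M + L \<diamondop> ?H c \<diamondop> adj L) (i, j)"
      using ij by (cases i j rule: linorder_cases) (auto simp: a_def g_def herm_coord_def LXL herm_of_coords_def)
  qed
  \<comment> \<open>Triangularity of \<open>L\<close> leaves only a \<le> i and b \<le> j, and the
    term with both equalities is excluded, so a + b < i + j. The entry (a, b) reads the coordinates
    (a, b) and (b, a), which have the same rank.\<close>
  have Rcong: "R (?H x) i j = R (?H y) i j"
    if *: "i < p" "j < p" "\<And>ab. ab \<in> ibox p \<Longrightarrow> fst ab + snd ab < i + j \<Longrightarrow> x ab = y ab" for x y i j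
    unfolding R_def
  proof (intro sum.cong refl)
    fix a b assume ab: "a \<in> {..<p}" "b \<in> {..<p}"
    show "(if a = i \<and> b = j then 0 else L i a * ?H x a b * cnj (L j b)) =
      (if a = i \<and> b = j then 0 else L i a * ?H y a b * cnj (L j b))"
    proof (cases "i < a \<or> j < b \<or> a = i \<and> b = j")
      case False
      then have "?H x a b = ?H y a b"
        using ab by (intro herm_of_coords_cong *(3)) (auto simp: ibox_def)
      then show ?thesis by simp
    qed (auto simp: L0)
  qed
  have "(\<integral>\<^sup>+c. G (?H (\<lambda>ij\<in>ibox p. a ij * c ij + g ij c)) \<partial>lbI (ibox p)) * ennreal (\<Prod>ij\<in>ibox p. \<bar>a ij\<bar>) =
    (\<integral>\<^sup>+c. G (?H c) \<partial>lbI (ibox p))"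
  proof (rule nn_integral_PiM_triangular[where r = "\<lambda>ij. fst ij + snd ij"])
    fix ij assume "ij \<in> ibox p"
    then obtain i j where ij: "ij = (i, j)" "i < p" "j < p" by (auto simp: ibox_def)
    show "a ij \<noteq> 0" using d(1)[OF ij(2)] d(1)[OF ij(3)] by (simp add: a_def ij)
    have "(\<lambda>c. R (?H c) i j) \<in> borel_measurable (lbI (ibox p))" for i j
      unfolding R_def by measurable
    then show "g ij \<in> borel_measurable (lbI (ibox p))"
      by (cases "i \<le> j") (simp_all add: g_def ij)
    fix x y :: "nat \<times> nat \<Rightarrow> real" assume "\<And>l. l \<in> ibox p \<Longrightarrow> fst l + snd l < fst ij + snd ij \<Longrightarrow> x l = y l"
    then show "g ij x = g ij y"
      using Rcong[of i j x y] Rcong[of j i x y] ij by (auto simp: g_def)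
  qed (use G in auto)
  \<comment> \<open>Each \<open>d i\<close> occurs p times as a row factor and p times as a column
    factor.\<close>
  moreover have "(\<Prod>ij\<in>ibox p. \<bar>a ij\<bar>) = (\<Prod>i<p. d i) ^ (2 * p)"
  proof -
    have "(\<Prod>ij\<in>ibox p. \<bar>a ij\<bar>) = (\<Prod>ij\<in>ibox p. a ij)"
      using d(1) by (intro prod.cong refl) (auto simp: ibox_def a_def abs_of_pos)
    also have "\<dots> = (\<Prod>i<p. \<Prod>j<p. d i * d j)"
      by (simp add: ibox_def a_def prod.cartesian_product)
    also have "\<dots> = (\<Prod>i<p. d i) ^ (2 * p)"
      by (simp add: prod.distrib prod_power_distrib[symmetric] power_mult mult_2 power_add mult.commute power2_eq_square)
    finally show ?thesis .
  qed
  ultimately show ?thesis by (simp add: eq)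
qed

section \<open>Measurability of determinants, inverses and the recursion\<close>

lemma measurable_det_mat:
  assumes "\<And>i j. i < n \<Longrightarrow> j < n \<Longrightarrow> (\<lambda>x. f x (i, j)) \<in> borel_measurable N"
  shows "(\<lambda>x. Determinant.det (Matrix.mat n n (f x) :: complex mat)) \<in> borel_measurable N"
proof -
  have "Determinant.det (Matrix.mat n n (f x)) = (\<Sum>\<pi> | \<pi> permutes {0..<n}. signof \<pi> * (\<Prod>i = 0..<n. f x (i, \<pi> i)))" for x
    by (subst det_def'[of _ n]) (auto intro!: sum.cong prod.cong simp: permutes_in_image)
  moreover have "(\<lambda>x. f x (i, \<pi> i)) \<in> borel_measurable N" if "\<pi> permutes {0..<n}" "i \<in> {0..<n}" for \<pi> i
    using that permutes_in_image[OF that(1), of i] by (intro assms) auto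
  ultimately show ?thesis
    by (simp add: borel_measurable_sum borel_measurable_times borel_measurable_prod)
qed

lemma measurable_fdet [measurable (raw)]:
  assumes "\<And>i j. (\<lambda>x. X x i j) \<in> borel_measurable N"
  shows "(\<lambda>x. fdet (X x)) \<in> borel_measurable N"
  unfolding fdet_def jmat_def by (rule measurable_det_mat) (use assms in auto)

lemma finv_entry:
  assumes "i < p" "j < p"
  shows "finv X i j = (- 1) ^ (j + i) * Determinant.det (Matrix.mat (p - 1) (p - 1)
        (\<lambda>(i', j'). X (if i' < j then i' else Suc i') (if j' < i then j' else Suc j'))) / fdet X"
  using assms by (auto simp: finv_def adj_mat_def jmat_def cofactor_def mat_delete_def
          intro!: arg_cong[of _ _ Determinant.det] eq_matI)

lemma measurable_finv [measurable (raw)]: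
  assumes [measurable]: "\<And>i j. (\<lambda>x. X x i j) \<in> borel_measurable N"
  shows "(\<lambda>x. finv (X x) i j) \<in> borel_measurable N"
proof (cases "i < p \<and> j < p")
  case True
  then show ?thesis
    by (simp add: finv_entry)
      (intro borel_measurable_divide borel_measurable_times borel_measurable_const measurable_det_mat measurable_fdet, auto)
next
  case False
  then have "(\<lambda>x. finv (X x) i j) = (\<lambda>_. 0)" by (auto simp: finv_def)
  then show ?thesis by simp
qed

lemma measurable_mm [measurable (raw)]:
  assumes [measurable]: "\<And>i j. (\<lambda>x. X x i j) \<in> borel_measurable N" "\<And>i j. (\<lambda>x. Y x i j) \<in> borel_measurable N"
  shows "(\<lambda>x. (X x \<diamondop> Y x) i j) \<in> borel_measurable N"
  unfolding mm_def by measurable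

lemma measurable_LA_LP:
  assumes C: "\<And>j a b. (\<lambda>x. C x j a b) \<in> borel_measurable N"
  shows "(\<forall>j a b. (\<lambda>x. LA (C x) k j a b) \<in> borel_measurable N) \<and> (\<forall>a b. (\<lambda>x. LP (C x) k a b) \<in> borel_measurable N)"
proof (induction k)
  case 0
  have "(\<lambda>x. LA (C x) 0 j a b) \<in> borel_measurable N" for j a b
    by (cases "j = 0") (simp_all add: LA_0)
  then show ?case by simp
next
  case (Suc k)
  then have [measurable]: "(\<lambda>x. LA (C x) k j a b) \<in> borel_measurable N" "(\<lambda>x. LP (C x) k a b) \<in> borel_measurable N" for j a b
    by auto
  note C [measurable]
  have E [measurable]: "(\<lambda>x. LE (C x) k a b) \<in> borel_measurable N" for a b
    unfolding LE_def sum_fun_apply by (intro borel_measurable_sum measurable_mm) measurable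
  have Q [measurable]: "(\<lambda>x. (finv (LP (C x) k) \<diamondop> LE (C x) k) a b) \<in> borel_measurable N" for a b
    by (intro measurable_mm measurable_finv) measurable
  have "(\<lambda>x. LA (C x) (Suc k) j a b) \<in> borel_measurable N" for j a b
  proof (cases "j \<le> Suc k")
    case True
    have "(\<lambda>x. LA (C x) k j a b - (LA (C x) k (Suc k - j) \<diamondop> (finv (LP (C x) k) \<diamondop> LE (C x) k)) a b) \<in> borel_measurable N"
      by (intro borel_measurable_diff measurable_mm) measurable
    then show ?thesis using True by (simp add: LA_Suc)
  qed (simp add: LA_Suc)
  moreover have "(\<lambda>x. LP (C x) (Suc k) a b) \<in> borel_measurable N" for a b
  proof -
    have "(\<lambda>x. LP (C x) k a b - (LE (C x) k \<diamondop> (finv (LP (C x) k) \<diamondop> LE (C x) k)) a b) \<in> borel_measurable N"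
      by (intro borel_measurable_diff measurable_mm) measurable
    then show ?thesis by (simp add: LP_Suc)
  qed
  ultimately show ?case by blast
qed

lemmas measurable_LP = conjunct2[OF measurable_LA_LP, rule_format]

lemma csc_diff: "csc t (X - Y) = csc t X - csc t Y"
  by (simp add: csc_def fun_eq_iff algebra_simps)

text \<open>If the form vanishes at v, moving from v to v - e X v changes it by -2 e |X v|^2 to
  first order in e, so nonnegativity forces X v = 0, and invertibility forces v = 0.\<close>

lemma psd_fdet_posdef:
  assumes X: "psd X" and d: "fdet X \<noteq> 0"
  shows "posdef X"
  unfolding posdef_def
proof (intro conjI allI impI)
  show h: "herm X" using X by (simp add: psd_def)
  fix v :: "nat \<Rightarrow> complex" assume v: "\<exists>i<p. v i \<noteq> 0"
  have pos: "0 \<le> Re (qf X u)" for u using X by (simp add: psd_def)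
  show "0 < Re (qf X v)"
  proof (rule ccontr)
    assume "\<not> 0 < Re (qf X v)"
    then have q0: "Re (qf X v) = 0" using pos[of v] by simp
    define V :: cmx where "V = (\<lambda>i l. if i < p then v i else 0)"
    define W where "W = X \<diamondop> V"
    have qV: "qf Y (\<lambda>i. V i 0) = qf Y v" for Y
      unfolding qf_def V_def by (intro sum.cong refl) auto
    define s where "s = Re (qf one (\<lambda>i. W i 0))"
    have W1: "(adj W \<diamondop> W) 0 0 = qf one (\<lambda>i. W i 0)"
      using h by (simp add: qf_eq[symmetric] W_def mm_assoc herm_supp) (simp add: mm_assoc[symmetric] herm_supp)
    have le: "2 * s \<le> e * Re (qf X (\<lambda>i. W i 0))" if e: "e > 0" for e
    proof -
      define U where "U = V - csc e W"
      have "adj (csc e W) = csc e (adj W)" by (auto simp: csc_def adj_def fun_eq_iff)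
      then have "adj U \<diamondop> X \<diamondop> U = adj V \<diamondop> X \<diamondop> V - csc e (adj V \<diamondop> X \<diamondop> W) - csc e (adj W \<diamondop> X \<diamondop> V)
         + csc e (csc e (adj W \<diamondop> X \<diamondop> W))"
        by (simp add: U_def adj_diff mm_distribs csc_mm csc_diff algebra_simps)
      also have "adj V \<diamondop> X \<diamondop> W = adj W \<diamondop> W" using h by (simp add: W_def adj_mm herm_adj)
      also have "adj W \<diamondop> X \<diamondop> V = adj W \<diamondop> W" by (simp add: W_def mm_assoc)
      finally have *: "adj U \<diamondop> X \<diamondop> U = adj V \<diamondop> X \<diamondop> V - csc e (adj W \<diamondop> W) - csc e (adj W \<diamondop> W)
         + csc e (csc e (adj W \<diamondop> X \<diamondop> W))" .
      have "qf X (\<lambda>i. U i 0) = qf X v - 2 * of_real e * qf one (\<lambda>i. W i 0) + of_real e * of_real e * qf X (\<lambda>i. W i 0)"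
        using fun_cong[OF fun_cong[OF *], of 0 0] by (simp add: qf_eq W1 qV csc_def)
      from arg_cong[OF this, of Re] have "0 \<le> e * (e * Re (qf X (\<lambda>i. W i 0)) - 2 * s)"
        using pos[of "\<lambda>i. U i 0"] q0 by (simp add: s_def algebra_simps)
      then show ?thesis using e by (simp add: zero_le_mult_iff)
    qed
    have "s \<le> 0"
    proof (rule ccontr)
      assume "\<not> s \<le> 0"
      define K where "K = Re (qf X (\<lambda>i. W i 0))"
      have "K \<ge> 0" using pos by (simp add: K_def)
      \<comment> \<open>For this e the right-hand side is at most s, which contradicts 2 s on the
        left.\<close>
      from le[of "s / (K + 1)"] \<open>\<not> s \<le> 0\<close> this have "2 * s \<le> s / (K + 1) * K" by (simp add: K_def)
      also have "\<dots> = s * (K / (K + 1))" by simp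
      also have "\<dots> \<le> s * 1" using \<open>\<not> s \<le> 0\<close> \<open>K \<ge> 0\<close> by (intro mult_left_mono) auto
      finally show False using \<open>\<not> s \<le> 0\<close> by simp
    qed
    then have W0: "W i 0 = 0" if "i < p" for i
      using Re_qf_one_pos[of "\<lambda>i. W i 0"] that unfolding s_def by force
    have "V = finv X \<diamondop> W"
      unfolding W_def using finv_left[OF herm_supp[OF h] d]
      by (simp add: mm_assoc[symmetric] mm_one_left) (simp add: V_def fun_eq_iff)
    then have "V i 0 = 0" for i
      using W0 by (simp add: mm_def[of "finv X"])
    then show False using v by (metis V_def)
  qed
qed

text \<open>Positive definite means semidefinite with nonzero determinant. Unlike strict positivity,
  semidefiniteness can by continuity be tested on a countable dense set of vectors.\<close>

lemma measurable_posdef: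
  assumes X: "\<And>i j. (\<lambda>x. X x i j) \<in> borel_measurable N" and h: "\<And>x. x \<in> space N \<Longrightarrow> herm (X x)"
  shows "{x \<in> space N. posdef (X x)} \<in> sets N"
proof -
  obtain D :: "(nat \<Rightarrow> complex) set" where D: "countable D" "\<And>U. open U \<Longrightarrow> U \<noteq> {} \<Longrightarrow> \<exists>d\<in>D. d \<in> U"
    using countable_dense_exists by blast
  have psd: "psd Y \<longleftrightarrow> (\<forall>v\<in>D. 0 \<le> Re (qf Y v))" if "herm Y" for Y
  proof
    assume *: "\<forall>v\<in>D. 0 \<le> Re (qf Y v)"
    have "0 \<le> Re (qf Y v)" for v
    proof (rule ccontr)
      assume "\<not> 0 \<le> Re (qf Y v)"
      then have "v \<in> {v. Re (qf Y v) < 0}" by simp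
      then have "{v. Re (qf Y v) < 0} \<noteq> {}" by blast
      moreover have "open {v. Re (qf Y v) < 0}"
        unfolding qf_def
        by (intro open_Collect_less continuous_intros continuous_on_product_coordinates)
      ultimately show False using D(2) * by fastforce
    qed
    then show "psd Y" using that by (simp add: psd_def)
  qed (simp add: psd_def)
  have "{x \<in> space N. posdef (X x)} = {x \<in> space N. (\<forall>v\<in>D. 0 \<le> Re (qf (X x) v)) \<and> fdet (X x) \<noteq> 0}"
    using h psd psd_fdet_posdef posdef_psd posdef_fdet(3) by blast
  also have "\<dots> \<in> sets N"
  proof -
    note X [measurable]
    have [measurable]: "(\<lambda>x. fdet (X x)) \<in> borel_measurable N" by (rule measurable_fdet[OF X])
    have [measurable]: "(\<lambda>x. Re (qf (X x) v)) \<in> borel_measurable N" for v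
      unfolding qf_def by measurable
    show ?thesis using D(1) by measurable
  qed
  finally show ?thesis .
qed

section \<open>Integrating out the last Chebyshev moment\<close>

definition cube :: "nat \<Rightarrow> (nat \<times> nat \<times> nat) set" where
  "cube n = {1..n} \<times> ibox p"

lemma finite_cube [simp]: "finite (cube n)"
  by (simp add: cube_def)

definition Ctup :: "nat \<Rightarrow> (nat \<times> nat \<times> nat \<Rightarrow> real) \<Rightarrow> nat \<Rightarrow> cmx" where
  "Ctup n c = (\<lambda>j. if j = 0 then one else if j \<le> n then herm_of_coords p (\<lambda>(i, l). c (j, i, l)) else 0)"

definition regular :: "nat \<Rightarrow> (nat \<Rightarrow> cmx) \<Rightarrow> bool" where
  "regular k C \<longleftrightarrow> (\<forall>j\<le>k. posdef (LP C j))"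

text \<open>By \<open>fold_integral\<close>, \<open>dens k (p * (n - k))\<close> is, up to a constant, the marginal density of the
  first \<open>k\<close> Chebyshev moments when the first \<open>n\<close> are uniformly distributed.\<close>

definition dens :: "nat \<Rightarrow> nat \<Rightarrow> (nat \<Rightarrow> cmx) \<Rightarrow> real" where
  "dens k q C = (if regular k C then Re (fdet (LP C k)) ^ q else 0)"

text \<open>What is left of \<open>dens\<close> in the normalised coordinate V of the last moment.
  It does not involve the earlier moments, so its integral \<open>kconst\<close>, a matrix beta
  integral, is a constant.\<close>

definition kern :: "nat \<Rightarrow> cmx \<Rightarrow> real" where
  "kern q V = (if posdef (one - V \<diamondop> V) then Re (fdet (one - V \<diamondop> V)) ^ q else 0)"

lemma dens_nonneg: "0 \<le> dens k q C"
  using posdef_fdet(1) by (auto simp: dens_def regular_def intro!: zero_le_power less_imp_le)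

lemma kern_nonneg: "0 \<le> kern q V"
  using posdef_fdet(1) by (auto simp: kern_def intro!: zero_le_power less_imp_le)

lemma herm_zero [simp]: "herm 0"
  by (simp add: herm_def)

lemma htup_Ctup: "htup (Ctup n c)"
  by (auto simp: htup_def Ctup_def herm_of_coords_herm)

lemma herm_of_coords_restrict: "herm_of_coords p (restrict c (ibox p)) = herm_of_coords p c"
  by (intro ext) (auto simp: herm_of_coords_def ibox_def)

lemma measurable_regular:
  assumes C: "\<And>j a b. (\<lambda>x. C x j a b) \<in> borel_measurable N" and h: "\<And>x. x \<in> space N \<Longrightarrow> htup (C x)"
  shows "{x \<in> space N. regular k (C x)} \<in> sets N"
proof (induction k)
  case 0
  then show ?case by (simp add: regular_def)
next
  case (Suc k)
  note Suc [measurable] and measurable_LP[OF C, measurable]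
  \<comment> \<open>Off the regular set \<open>LP\<close> need not be hermitian, so it is replaced
    by \<open>one\<close> to meet the hypothesis of \<open>measurable_posdef\<close>.\<close>
  define X where "X x = (if regular k (C x) then LP (C x) (Suc k) else one)" for x
  have "{x \<in> space N. posdef (X x)} \<in> sets N"
  proof (rule measurable_posdef)
    fix i j
    have "(\<lambda>x. if regular k (C x) then LP (C x) (Suc k) i j else one i j) \<in> borel_measurable N"
      by measurable
    then show "(\<lambda>x. X x i j) \<in> borel_measurable N"
      by (simp add: X_def if_distrib[of "\<lambda>f. f _"] if_distribR cong: if_cong)
  next
    fix x assume x: "x \<in> space N"
    show "herm (X x)"
      using conjunct2[OF levinson(1)[OF h[OF x], of "Suc k"]] posdef_fdet(3)
      by (auto simp: X_def regular_def)
  qed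
  then have "{x \<in> space N. regular k (C x)} \<inter> {x \<in> space N. posdef (X x)} \<in> sets N"
    using Suc by blast
  also have "{x \<in> space N. regular k (C x)} \<inter> {x \<in> space N. posdef (X x)} = {x \<in> space N. regular (Suc k) (C x)}"
    by (auto simp: X_def regular_def le_Suc_eq)
  finally show ?case .
qed

lemma measurable_dens:
  assumes C: "\<And>j a b. (\<lambda>x. C x j a b) \<in> borel_measurable N" and h: "\<And>x. x \<in> space N \<Longrightarrow> htup (C x)"
  shows "(\<lambda>x. dens k q (C x)) \<in> borel_measurable N"
proof -
  have [measurable]: "{x \<in> space N. regular k (C x)} \<in> sets N" by (rule measurable_regular[OF C h])
  have [measurable]: "(\<lambda>x. fdet (LP (C x) k)) \<in> borel_measurable N"
    by (rule measurable_fdet[OF measurable_LP[OF C]])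
  show ?thesis unfolding dens_def by measurable
qed

lemma measurable_Ctup:
  assumes "n \<le> m"
  shows "(\<lambda>c. Ctup n c j a b) \<in> borel_measurable (lbI (cube m))"
proof -
  consider "j = 0" | "n < j" | "1 \<le> j" "j \<le> n" by linarith
  then show ?thesis
  proof cases
    case 3
    have T: "(\<lambda>c. \<lambda>il\<in>ibox p. c (j, il)) \<in> measurable (lbI (cube m)) (lbI (ibox p))"
      using 3 assms by (intro measurable_restrict) (auto simp: cube_def)
    have "Ctup n c j = herm_of_coords p (\<lambda>il\<in>ibox p. c (j, il))" for c
      using 3 by (simp add: Ctup_def herm_of_coords_restrict case_prod_unfold)
    then show ?thesis
      using measurable_compose[OF T measurable_herm_of_coords] by simp
  qed (auto simp: Ctup_def)
qed

lemma dens_cong: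
  assumes "\<And>j. 1 \<le> j \<Longrightarrow> j \<le> k \<Longrightarrow> C j = C' j"
  shows "dens k q C = dens k q C'"
proof -
  have "LP C j = LP C' j" if "j \<le> k" for j using assms that by (intro LP_cong) auto
  then have "regular k C \<longleftrightarrow> regular k C'" "LP C k = LP C' k" by (auto simp: regular_def)
  then show ?thesis by (simp add: dens_def)
qed

lemma herm_sq: "herm V \<Longrightarrow> herm (V \<diamondop> V)"
  using herm_conj[OF herm_one, of V] by (auto simp: herm_adj herm_supp)

lemma herm_one_minus_sq: "herm V \<Longrightarrow> herm (one - V \<diamondop> V)"
  using herm_sq by blast

lemma measurable_kern: "(\<lambda>c. kern q (herm_of_coords p c)) \<in> borel_measurable (lbI (ibox p))"
proof -
  have X: "(\<lambda>c. (one - herm_of_coords p c \<diamondop> herm_of_coords p c) i j) \<in> borel_measurable (lbI (ibox p))" for i j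
    unfolding minus_apply by (intro borel_measurable_diff borel_measurable_const measurable_mm measurable_herm_of_coords)
  have [measurable]: "(\<lambda>c. fdet (one - herm_of_coords p c \<diamondop> herm_of_coords p c)) \<in> borel_measurable (lbI (ibox p))"
    by (rule measurable_fdet[OF X])
  have [measurable]: "{c \<in> space (lbI (ibox p)). posdef (one - herm_of_coords p c \<diamondop> herm_of_coords p c)} \<in> sets (lbI (ibox p))"
    by (rule measurable_posdef[OF X]) (rule herm_one_minus_sq[OF herm_of_coords_herm])
  show ?thesis unfolding kern_def by measurable
qed

text \<open>Of the exponent q + p, the part q comes from the determinant of
  \<open>L \<diamondop> (one - V \<diamondop> V) \<diamondop> adj L\<close>, and the part p from the
  Jacobian of the congruence by \<open>L\<close>.\<close>

lemma fiber_integral: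
  assumes C: "htup C" and reg: "regular k C"
  shows "(\<integral>\<^sup>+c. ennreal (dens (Suc k) q (C(Suc k := herm_of_coords p c))) \<partial>lbI (ibox p)) =
    ennreal (Re (fdet (LP C k)) ^ (q + p)) * (\<integral>\<^sup>+c. ennreal (kern q (herm_of_coords p c)) \<partial>lbI (ibox p))"
proof -
  have pos: "posdef (LP C k)" using reg by (simp add: regular_def)
  obtain L d where L: "chol L d" and P: "LP C k = L \<diamondop> adj L" using posdef_chol[OF pos] .
  define D where "D = (\<Prod>i<p. d i)"
  have D: "D > 0" "fdet L = of_real D" "supp L" using fdet_chol_pos[OF L] fdet_chol[OF L] L by (auto simp: D_def chol_def)
  then have dL: "fdet L \<noteq> 0" by simp
  have dP: "Re (fdet (LP C k)) = D ^ 2" using fdet_chol_sq[OF L] by (simp only: P D_def Re_complex_of_real)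
  define M where "M = 0 - LM C k"
  have "herm (LM C k)" using reg posdef_fdet(3) by (intro herm_LM[OF C]) (auto simp: regular_def)
  then have M: "herm M" unfolding M_def by (intro herm_diff) auto
  define G where "G X = ennreal (dens (Suc k) q (C(Suc k := X)))" for X
  have G: "G (M + L \<diamondop> V \<diamondop> adj L) = ennreal (D ^ (2 * q)) * ennreal (kern q V)" if V: "herm V" for V
  proof -
    define X where "X = M + L \<diamondop> V \<diamondop> adj L"
    have X: "herm X" unfolding X_def using M V D(3) by (intro herm_add herm_conj) auto
    define C' where "C' = C(Suc k := X)"
    have C': "htup C'" using C X by (auto simp: C'_def htup_def)
    have LP': "LP C' j = LP C j" if "j \<le> k" for j by (rule LP_cong) (use that in \<open>auto simp: C'_def\<close>)
    have "LM C' k = LM C k" by (rule LM_cong) (auto simp: C'_def)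
    then have "LE C' k = L \<diamondop> V \<diamondop> adj L" by (simp add: LE_eq[OF C']) (simp add: C'_def X_def M_def)
    then have eq: "LP C' (Suc k) = L \<diamondop> (one - V \<diamondop> V) \<diamondop> adj L"
      using V by (intro LP_Suc_chol[OF C' D(3) dL]) (auto simp: LP' P)
    have "posdef (LP C' (Suc k)) \<longleftrightarrow> posdef (one - V \<diamondop> V)"
      unfolding eq using V by (intro posdef_conj_iff D(3) dL) (auto simp: herm_supp)
    then have "regular (Suc k) C' \<longleftrightarrow> posdef (one - V \<diamondop> V)"
      using reg LP' by (auto simp: regular_def le_Suc_eq)
    moreover have "Re (fdet (LP C' (Suc k))) = D ^ 2 * Re (fdet (one - V \<diamondop> V))"
      by (simp add: eq fdet_mm fdet_adj D power2_eq_square)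
    ultimately have "dens (Suc k) q C' = D ^ (2 * q) * kern q V"
      by (simp add: dens_def kern_def power_mult_distrib power_mult)
    then show ?thesis
      using D kern_nonneg by (simp add: G_def C'_def X_def ennreal_mult)
  qed
  have hm: "(\<lambda>c. G (herm_of_coords p c)) \<in> borel_measurable (lbI (ibox p))"
  proof -
    have "(\<lambda>c. dens (Suc k) q (C(Suc k := herm_of_coords p c))) \<in> borel_measurable (lbI (ibox p))"
    proof (rule measurable_dens)
      show "(\<lambda>c. (C(Suc k := herm_of_coords p c)) j a b) \<in> borel_measurable (lbI (ibox p))" for j a b
        by (cases "j = Suc k") simp_all
      show "htup (C(Suc k := herm_of_coords p c))" for c
        using C herm_of_coords_herm by (auto simp: htup_def)
    qed
    then show ?thesis by (simp add: G_def)
  qed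
  have "(\<integral>\<^sup>+c. G (herm_of_coords p c) \<partial>lbI (ibox p)) =
     (\<integral>\<^sup>+c. ennreal (D ^ (2 * q)) * ennreal (kern q (herm_of_coords p c)) \<partial>lbI (ibox p)) * ennreal (D ^ (2 * p))"
    unfolding nn_integral_herm_congruence[OF L M hm, symmetric] D_def[symmetric]
    by (simp add: G herm_of_coords_herm)
  also have "\<dots> = ennreal (D ^ (2 * q)) * (\<integral>\<^sup>+c. ennreal (kern q (herm_of_coords p c)) \<partial>lbI (ibox p)) * ennreal (D ^ (2 * p))"
  proof -
    show ?thesis using measurable_kern[of q] by (subst nn_integral_cmult) auto
  qed
  also have "\<dots> = ennreal (Re (fdet (LP C k)) ^ (q + p)) * (\<integral>\<^sup>+c. ennreal (kern q (herm_of_coords p c)) \<partial>lbI (ibox p))"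
    using D by (simp add: dP power_mult[symmetric] ennreal_mult power_add mult_ac distrib_left)
  finally show ?thesis by (simp add: G_def)
qed

definition kconst :: "nat \<Rightarrow> ennreal" where
  "kconst q = (\<integral>\<^sup>+c. ennreal (kern q (herm_of_coords p c)) \<partial>lbI (ibox p))"

lemma cube_Suc: "cube (Suc k) = cube k \<union> {Suc k} \<times> ibox p" "cube k \<inter> {Suc k} \<times> ibox p = {}"
  by (auto simp: cube_def)

text \<open>\<open>F\<close> sees only the first \<open>k\<close> moments, so after Fubini the inner
  integral is that of \<open>fiber_integral\<close>. Where regularity already fails at level
  \<open>k\<close>, both sides vanish.\<close>

lemma fold_step:
  assumes F: "F \<in> borel_measurable (lbI (cube k))"
  shows "(\<integral>\<^sup>+c. ennreal (dens (Suc k) q (Ctup (Suc k) c)) * F (restrict c (cube k)) \<partial>lbI (cube (Suc k))) =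
     kconst q * (\<integral>\<^sup>+c. ennreal (dens k (q + p) (Ctup k c)) * F c \<partial>lbI (cube k))"
proof -
  let ?J = "{Suc k} \<times> ibox p"
  let ?m = "\<lambda>x y. merge (cube k) ?J (x, y)"
  have m1: "(\<lambda>c. dens (Suc k) q (Ctup (Suc k) c)) \<in> borel_measurable (lbI (cube (Suc k)))"
    by (rule measurable_dens) (auto intro: measurable_Ctup htup_Ctup)
  have m2: "(\<lambda>c. F (restrict c (cube k))) \<in> borel_measurable (lbI (cube (Suc k)))"
    by (rule measurable_compose[OF measurable_restrict_subset F]) (auto simp: cube_def)
  have m3: "(\<lambda>c. dens k (q + p) (Ctup k c)) \<in> borel_measurable (lbI (cube k))"
    by (rule measurable_dens) (auto intro: measurable_Ctup htup_Ctup)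
  have "(\<integral>\<^sup>+c. ennreal (dens (Suc k) q (Ctup (Suc k) c)) * F (restrict c (cube k)) \<partial>lbI (cube (Suc k))) =
     (\<integral>\<^sup>+x. (\<integral>\<^sup>+y. ennreal (dens (Suc k) q (Ctup (Suc k) (?m x y))) * F (restrict (?m x y) (cube k)) \<partial>lbI ?J) \<partial>lbI (cube k))"
    unfolding cube_Suc(1)
    by (rule lb.product_nn_integral_fold) (use cube_Suc(2) m1 m2 in \<open>auto simp: cube_Suc(1)\<close>)
  also have "\<dots> = (\<integral>\<^sup>+x. kconst q * (ennreal (dens k (q + p) (Ctup k x)) * F x) \<partial>lbI (cube k))"
  proof (rule nn_integral_cong)
    fix x assume "x \<in> space (lbI (cube k))"
    then have xr: "restrict x (cube k) = x" by (auto simp: space_PiM PiE_def extensional_restrict)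
    let ?C = "Ctup k x"
    let ?f = "\<lambda>z. ennreal (dens (Suc k) q (?C(Suc k := herm_of_coords p z)))"
    have fm: "?f \<in> borel_measurable (lbI (ibox p))"
    proof -
      have "(\<lambda>c. dens (Suc k) q (?C(Suc k := herm_of_coords p c))) \<in> borel_measurable (lbI (ibox p))"
      proof (rule measurable_dens)
        show "(\<lambda>c. (?C(Suc k := herm_of_coords p c)) j a b) \<in> borel_measurable (lbI (ibox p))" for j a b
          by (cases "j = Suc k") simp_all
        show "htup (?C(Suc k := herm_of_coords p c))" for c
          using htup_Ctup herm_of_coords_herm by (auto simp: htup_def)
      qed
      then show ?thesis by simp
    qed
    have "dens (Suc k) q (Ctup (Suc k) (?m x y)) = dens (Suc k) q (?C(Suc k := herm_of_coords p (\<lambda>il\<in>ibox p. y (Suc k, il))))" for y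
    proof (rule dens_cong)
      fix j assume j: "1 \<le> j" "j \<le> Suc k"
      show "Ctup (Suc k) (?m x y) j = (?C(Suc k := herm_of_coords p (\<lambda>il\<in>ibox p. y (Suc k, il)))) j"
        using j by (intro ext) (auto simp: Ctup_def herm_of_coords_restrict herm_of_coords_def merge_def cube_def ibox_def)
    qed
    then have "(\<integral>\<^sup>+y. ennreal (dens (Suc k) q (Ctup (Suc k) (?m x y))) * F (restrict (?m x y) (cube k)) \<partial>lbI ?J) =
       (\<integral>\<^sup>+y. ?f (\<lambda>il\<in>ibox p. y (Suc k, il)) * F x \<partial>lbI ?J)"
      using cube_Suc(2) xr by simp
    also have "\<dots> = (\<integral>\<^sup>+y. ?f (\<lambda>il\<in>ibox p. y (Suc k, il)) \<partial>lbI ?J) * F x"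
    proof (rule nn_integral_multc)
      show "(\<lambda>y. ?f (\<lambda>il\<in>ibox p. y (Suc k, il))) \<in> borel_measurable (lbI ?J)"
        by (rule measurable_compose[OF _ fm], rule measurable_restrict) auto
    qed
    also have "(\<integral>\<^sup>+y. ?f (\<lambda>il\<in>ibox p. y (Suc k, il)) \<partial>lbI ?J) = (\<integral>\<^sup>+z. ?f z \<partial>lbI (ibox p))"
    proof -
      have J: "?J = Pair (Suc k) ` ibox p" by auto
      show ?thesis unfolding J by (rule nn_integral_PiM_reindex[OF finite_ibox _ fm]) (auto simp: inj_on_def)
    qed
    also have "\<dots> = ennreal (dens k (q + p) ?C) * kconst q"
    proof (cases "regular k ?C")
      case True
      then show ?thesis using fiber_integral[OF htup_Ctup True] by (simp add: kconst_def dens_def)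
    next
      case False
      have "\<not> regular (Suc k) (?C(Suc k := X))" for X
      proof -
        have "LP (?C(Suc k := X)) j = LP ?C j" if "j \<le> k" for j by (rule LP_cong) (use that in auto)
        then show ?thesis using False unfolding regular_def by (metis le_Suc_eq)
      qed
      then show ?thesis using False by (simp add: dens_def)
    qed
    also have "\<dots> * F x = kconst q * (ennreal (dens k (q + p) ?C) * F x)"
      by (simp only: mult_ac)
    finally show "(\<integral>\<^sup>+y. ennreal (dens (Suc k) q (Ctup (Suc k) (?m x y))) * F (restrict (?m x y) (cube k)) \<partial>lbI ?J) =
      kconst q * (ennreal (dens k (q + p) ?C) * F x)" .
  qed
  also have "\<dots> = kconst q * (\<integral>\<^sup>+x. (ennreal (dens k (q + p) (Ctup k x)) * F x) \<partial>lbI (cube k))"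
    using m3 F by (intro nn_integral_cmult) auto
  finally show ?thesis .
qed

text \<open>By Cauchy-Schwarz the form of \<open>X - one\<close> at v is at most e p |v|^2 in
  modulus, which stays below the form |v|^2 of \<open>one\<close>.\<close>

lemma posdef_near_one:
  assumes h: "herm X" and e: "\<And>i j. i < p \<Longrightarrow> j < p \<Longrightarrow> cmod (X i j - one i j) \<le> e" and "e * real p < 1"
  shows "posdef X"
  unfolding posdef_def
proof (intro conjI allI impI h)
  fix v :: "nat \<Rightarrow> complex" assume v: "\<exists>i<p. v i \<noteq> 0"
  define s where "s = (\<Sum>i<p. (cmod (v i))\<^sup>2)"
  have s1: "Re (qf one v) = s" by (simp add: qf_one s_def)
  have s: "s > 0" using Re_qf_one_pos[OF v] s1 by simp
  have "(\<Sum>i<p. cmod (v i))\<^sup>2 \<le> (\<Sum>i<p. 1\<^sup>2) * s"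
    unfolding s_def using Cauchy_Schwarz_ineq_sum[of "\<lambda>i. 1" "\<lambda>i. cmod (v i)" "{..<p}"] by simp
  then have cs: "(\<Sum>i<p. cmod (v i))\<^sup>2 \<le> real p * s" by simp
  obtain i0 where "i0 < p" using v by blast
  then have e0: "0 \<le> e" using e[of i0 i0] norm_ge_zero order_trans by blast
  have "cmod (qf (X - one) v) \<le> (\<Sum>i<p. \<Sum>j<p. e * (cmod (v i) * cmod (v j)))"
    unfolding qf_def
  proof (intro sum_norm_le order_trans[OF norm_sum] sum_mono)
    fix i j assume "i \<in> {..<p}" "j \<in> {..<p}"
    then have "cmod (X i j - one i j) * (cmod (v i) * cmod (v j)) \<le> e * (cmod (v i) * cmod (v j))"
      using e by (intro mult_right_mono) auto
    then show "cmod (cnj (v i) * (X - one) i j * v j) \<le> e * (cmod (v i) * cmod (v j))"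
      by (simp add: norm_mult mult_ac)
  qed
  also have "\<dots> = e * (\<Sum>i<p. cmod (v i))\<^sup>2"
    unfolding power2_eq_square sum_product by (simp only: sum_distrib_left)
  also have "\<dots> \<le> e * (real p * s)" by (rule mult_left_mono[OF cs e0])
  also have "\<dots> < s" using assms(3) s by (simp add: mult.assoc[symmetric])
  finally have "- Re (qf (X - one) v) < s"
    using abs_Re_le_cmod[of "qf (X - one) v"] by linarith
  then show "0 < Re (qf X v)" using s1 by (simp add: qf_diff)
qed

lemma diag_sq:
  assumes "herm V"
  shows "(V \<diamondop> V) i i = of_real (\<Sum>l<p. (cmod (V i l))\<^sup>2)"
proof -
  have "V l i = cnj (V i l)" for l using assms unfolding herm_def adj_def by metis
  then show ?thesis by (simp add: mm_def complex_norm_square del: of_real_power)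
qed

text \<open>Diagonal entries of 1 - V^2 are 1 minus squared row norms of V, which bounds the
  entries; the same sums bound the trace by p, and \<open>posdef_fdet_le\<close> then bounds the
  determinant by 1. The kernel is thus dominated by the indicator of a box.\<close>

lemma kern_bounds:
  assumes V: "herm V" and k0: "kern q V \<noteq> 0"
  shows "kern q V \<le> 1" and "i < p \<Longrightarrow> j < p \<Longrightarrow> cmod (V i j) \<le> 1"
proof -
  have pos: "posdef (one - V \<diamondop> V)" using k0 by (auto simp: kern_def split: if_splits)
  have diag: "(\<Sum>l<p. (cmod (V i l))\<^sup>2) \<le> 1" if "i < p" for i
  proof -
    define v where "v l = (if l = i then 1 else 0 :: complex)" for l
    have "qf X v = X i i" for X
      using that by (simp add: qf_def v_def if_distrib[of "\<lambda>x. _ * x"] if_distrib[of "\<lambda>x. x * _"] if_distrib[of cnj] cong: if_cong)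
    moreover have "0 < Re (qf (one - V \<diamondop> V) v)" using pos that by (auto simp: posdef_def v_def)
    ultimately show ?thesis using that by (simp add: diag_sq[OF V] one_def)
  qed
  show "cmod (V i j) \<le> 1" if "i < p" "j < p"
  proof -
    have "(cmod (V i j))\<^sup>2 \<le> (\<Sum>l<p. (cmod (V i l))\<^sup>2)"
      using that by (intro member_le_sum) auto
    then have "(cmod (V i j))\<^sup>2 \<le> 1\<^sup>2" using diag[OF that(1)] by simp
    then show ?thesis by (rule power2_le_imp_le) simp
  qed
  have "Re (ftr (one - V \<diamondop> V)) \<le> real p"
  proof -
    have "Re (ftr (one - V \<diamondop> V)) \<le> (\<Sum>i<p. 1)"
      unfolding ftr_def Re_sum
      by (intro sum_mono) (auto simp: diag_sq[OF V] one_def intro!: sum_nonneg)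
    then show ?thesis by simp
  qed
  then have "Re (fdet (one - V \<diamondop> V)) \<le> 1"
    using posdef_fdet_le[OF pos] by (smt (verit) exp_le_one_iff)
  then show "kern q V \<le> 1"
    using pos posdef_fdet(1)[OF pos] by (simp add: kern_def power_le_one)
qed

lemma kconst_finite: "kconst q < \<infinity>"
proof -
  have "kconst q \<le> (\<integral>\<^sup>+c. indicator (Pi\<^sub>E (ibox p) (\<lambda>_. {-1..1})) c \<partial>lbI (ibox p))"
    unfolding kconst_def
  proof (rule nn_integral_mono)
    fix c assume c: "c \<in> space (lbI (ibox p))"
    show "ennreal (kern q (herm_of_coords p c)) \<le> indicator (Pi\<^sub>E (ibox p) (\<lambda>_. {-1..1})) c"
    proof (cases "kern q (herm_of_coords p c) = 0")
      case False
      note kb = kern_bounds[OF herm_of_coords_herm False]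
      have "c (i, j) \<in> {-1..1}" if "i < p" "j < p" for i j
      proof -
        have *: "\<bar>Re z\<bar> \<le> 1 \<and> \<bar>Im z\<bar> \<le> 1" if "cmod z \<le> 1" for z
          using abs_Re_le_cmod[of z] abs_Im_le_cmod[of z] that by linarith
        show ?thesis
          using *[OF kb(2)[OF that]] *[OF kb(2)[OF that(2,1)]] that
          by (cases i j rule: linorder_cases) (auto simp: herm_of_coords_def)
      qed
      then have "c \<in> Pi\<^sub>E (ibox p) (\<lambda>_. {-1..1})"
        using c by (auto simp: ibox_def space_PiM PiE_def)
      then show ?thesis using kb(1) by simp
    qed simp
  qed
  also have "\<dots> = emeasure (lbI (ibox p)) (Pi\<^sub>E (ibox p) (\<lambda>_. {-1..1}))"
    by (intro nn_integral_indicator sets_PiM_I_finite) auto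
  also have "\<dots> = (\<Prod>i\<in>ibox p. emeasure lborel {-1..1::real})"
    by (intro lb.emeasure_PiM) auto
  also have "\<dots> = ennreal 2 ^ card (ibox p)" by simp
  also have "\<dots> = ennreal (2 ^ card (ibox p))" by (rule ennreal_power) simp
  also have "\<dots> < \<infinity>" by simp
  finally show ?thesis .
qed

text \<open>The kernel is positive on a small box around 0, which has positive volume.\<close>

lemma kconst_pos: "0 < kconst q"
proof (rule ccontr)
  assume "\<not> 0 < kconst q"
  then have "kconst q = 0" by simp
  then have "AE c in lbI (ibox p). ennreal (kern q (herm_of_coords p c)) = 0"
    unfolding kconst_def using measurable_kern by (subst (asm) nn_integral_0_iff_AE) auto
  then have ae: "AE c in lbI (ibox p). \<not> 0 < kern q (herm_of_coords p c)"
    by eventually_elim (auto simp: ennreal_eq_0_iff)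
  \<comment> \<open>Entries of V are at most 2 e and entries of V^2 at most 4 p e^2, so
    \<open>posdef_near_one\<close> asks for (2 p e)^2 < 1, which this e satisfies.\<close>
  define e where "e = 1 / (4 * real p + 1)"
  have e: "e > 0" by (simp add: e_def)
  let ?B = "Pi\<^sub>E (ibox p) (\<lambda>_. {-e..e})"
  have "AE c in lbI (ibox p). c \<notin> ?B"
    using ae
  proof eventually_elim
    fix c assume *: "\<not> 0 < kern q (herm_of_coords p c)"
    show "c \<notin> ?B"
    proof
      assume c: "c \<in> ?B"
      let ?V = "herm_of_coords p c"
      have cb: "\<bar>c (i, j)\<bar> \<le> e" if "i < p" "j < p" for i j
      proof -
        have "c (i, j) \<in> {-e..e}" using c that by (intro PiE_mem[OF c]) (simp add: ibox_def)
        then show ?thesis by auto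
      qed
      have V: "cmod (?V i j) \<le> 2 * e" for i j
      proof (cases "i < p \<and> j < p")
        case True
        have "cmod z \<le> 2 * e" if "\<bar>Re z\<bar> \<le> e" "\<bar>Im z\<bar> \<le> e" for z
          using cmod_le[of z] that by linarith
        then show ?thesis
          using True cb e by (auto simp: herm_of_coords_def)
      next
        case False
        then show ?thesis using e by (auto simp: herm_of_coords_def)
      qed
      have "posdef (one - ?V \<diamondop> ?V)"
      proof (rule posdef_near_one[OF herm_one_minus_sq[OF herm_of_coords_herm]])
        show "cmod ((one - ?V \<diamondop> ?V) i j - one i j) \<le> real p * (2 * e * (2 * e))" for i j
        proof -
          have "cmod ((?V \<diamondop> ?V) i j) \<le> (\<Sum>l<p. 2 * e * (2 * e))"
            unfolding mm_def using V e by (intro sum_norm_le) (unfold norm_mult, intro mult_mono, auto)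
          then show ?thesis by simp
        qed
        have "real p * (2 * e * (2 * e)) * real p = (2 * real p * e)\<^sup>2"
          by (simp add: power2_eq_square)
        also have "2 * real p * e < 1" by (simp add: e_def)
        then have "(2 * real p * e)\<^sup>2 < 1"
          using e by (simp add: power_less_one_iff abs_square_less_1)
        finally show "real p * (2 * e * (2 * e)) * real p < 1" .
      qed
      then have "0 < kern q ?V" using posdef_fdet(1) by (simp add: kern_def)
      with * show False by simp
    qed
  qed
  moreover have sB: "?B \<in> sets (lbI (ibox p))" by (intro sets_PiM_I_finite) auto
  ultimately have "emeasure (lbI (ibox p)) ?B = 0"
    using sets.sets_into_space[OF sB] by (subst (asm) AE_iff_measurable[OF sB]) (auto simp: Int_absorb1 subset_eq)
  moreover have "emeasure (lbI (ibox p)) ?B = (\<Prod>i\<in>ibox p. emeasure lborel {-e..e})"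
    by (intro lb.emeasure_PiM) auto
  ultimately show False using e by simp
qed

text \<open>Iterates \<open>fold_step\<close>. Removing the last moment raises the exponent, so the
  induction is over all \<open>q\<close>; \<open>K\<close> is a product of values of
  \<open>kconst\<close> and is the same for all \<open>F\<close>.\<close>

lemma fold_integral:
  assumes "k \<le> n"
  shows "\<exists>K. 0 < K \<and> K < \<infinity> \<and> (\<forall>F \<in> borel_measurable (lbI (cube k)).
    (\<integral>\<^sup>+c. ennreal (dens n q (Ctup n c)) * F (restrict c (cube k)) \<partial>lbI (cube n)) =
     K * (\<integral>\<^sup>+c. ennreal (dens k (q + p * (n - k)) (Ctup k c)) * F c \<partial>lbI (cube k)))"
  using \<open>k \<le> n\<close>
proof (induction n arbitrary: q rule: dec_induct)
  case base
  have "(\<integral>\<^sup>+c. ennreal (dens k q (Ctup k c)) * F (restrict c (cube k)) \<partial>lbI (cube k)) =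
     1 * (\<integral>\<^sup>+c. ennreal (dens k (q + p * (k - k)) (Ctup k c)) * F c \<partial>lbI (cube k))" for F
    unfolding mult_1 diff_self_eq_0 mult_0_right add_0_right
  proof (rule nn_integral_cong)
    fix c assume "c \<in> space (lbI (cube k))"
    then have "restrict c (cube k) = c" by (auto simp: space_PiM PiE_def extensional_restrict)
    then show "ennreal (dens k q (Ctup k c)) * F (restrict c (cube k)) = ennreal (dens k q (Ctup k c)) * F c"
      by (simp only:)
  qed
  then show ?case by (intro exI[of _ 1] conjI ballI) (simp, simp, assumption)
next
  case (step n)
  obtain K where K: "0 < K" "K < \<infinity>" "\<And>F. F \<in> borel_measurable (lbI (cube k)) \<Longrightarrow>
    (\<integral>\<^sup>+c. ennreal (dens n (q + p) (Ctup n c)) * F (restrict c (cube k)) \<partial>lbI (cube n)) =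
     K * (\<integral>\<^sup>+c. ennreal (dens k (q + p + p * (n - k)) (Ctup k c)) * F c \<partial>lbI (cube k))"
    using step.IH[of "q + p"] by blast
  have sub: "cube k \<subseteq> cube n" using step.hyps by (auto simp: cube_def)
  have ex: "q + p + p * (n - k) = q + p * (Suc n - k)" using step.hyps by (simp add: Suc_diff_le)
  have "(\<integral>\<^sup>+c. ennreal (dens (Suc n) q (Ctup (Suc n) c)) * F (restrict c (cube k)) \<partial>lbI (cube (Suc n))) =
     kconst q * K * (\<integral>\<^sup>+c. ennreal (dens k (q + p * (Suc n - k)) (Ctup k c)) * F c \<partial>lbI (cube k))"
    if F: "F \<in> borel_measurable (lbI (cube k))" for F
  proof -
    have m: "(\<lambda>c. F (restrict c (cube k))) \<in> borel_measurable (lbI (cube n))"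
      by (rule measurable_compose[OF measurable_restrict_subset F]) (rule sub)
    have "restrict (restrict c (cube n)) (cube k) = restrict c (cube k)" for c :: "nat \<times> nat \<times> nat \<Rightarrow> real"
      using sub by (simp add: Int_absorb1)
    then show ?thesis
      using fold_step[OF m, of q] K(3)[OF F] by (simp add: ex mult.assoc)
  qed
  moreover have "0 < kconst q * K" "kconst q * K < \<infinity>"
    using kconst_pos[of q] kconst_finite[of q] K by (auto simp: ennreal_mult_less_top ennreal_zero_less_mult_iff)
  ultimately show ?case by blast
qed

end

section \<open>Local asymptotics of the marginal density\<close>

text \<open>Product rule at 1, from a b - 1 = (a - 1) b + (b - 1).\<close>

lemma prod_minus_one_tendsto:
  fixes a :: "'i \<Rightarrow> nat \<Rightarrow> complex" and h :: "nat \<Rightarrow> complex"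
  assumes "finite S" "\<And>i. i \<in> S \<Longrightarrow> a i \<longlonglongrightarrow> 1" "\<And>i. i \<in> S \<Longrightarrow> (\<lambda>n. (a i n - 1) / h n) \<longlonglongrightarrow> y i"
  shows "(\<lambda>n. ((\<Prod>i\<in>S. a i n) - 1) / h n) \<longlonglongrightarrow> (\<Sum>i\<in>S. y i)"
  using assms
proof (induction S rule: finite_induct)
  case (insert i S)
  have "(\<lambda>n. (a i n - 1) / h n * (\<Prod>j\<in>S. a j n) + ((\<Prod>j\<in>S. a j n) - 1) / h n) \<longlonglongrightarrow> y i * (\<Prod>j\<in>S. 1) + (\<Sum>j\<in>S. y j)"
    using insert by (intro tendsto_intros) auto
  moreover have "(a i n - 1) / h n * (\<Prod>j\<in>S. a j n) + ((\<Prod>j\<in>S. a j n) - 1) / h n = ((\<Prod>j\<in>insert i S. a j n) - 1) / h n" for n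
    using insert.hyps by (simp add: diff_divide_distrib left_diff_distrib)
  ultimately show ?case using insert.hyps by simp
qed simp

text \<open>With u = r - 1, the logarithm of the power is m e ((ln (1 + u) - u) / e + u / e). The
  first quotient tends to 0 because |ln (1 + u) - u| \<le> 2 u^2 while u / e converges and u tends
  to 0.\<close>

lemma tendsto_power_exp:
  fixes r e :: "nat \<Rightarrow> real" and m :: "nat \<Rightarrow> nat"
  assumes e: "e \<longlonglongrightarrow> 0" "\<And>n. e n \<noteq> 0" and r: "(\<lambda>n. (r n - 1) / e n) \<longlonglongrightarrow> T"
    and m: "(\<lambda>n. real (m n) * e n) \<longlonglongrightarrow> c"
  shows "(\<lambda>n. r n ^ m n) \<longlonglongrightarrow> exp (c * T)"
proof -
  define u where "u n = r n - 1" for n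
  have "(\<lambda>n. (r n - 1) / e n * e n) \<longlonglongrightarrow> T * 0" by (intro tendsto_mult r e)
  then have u0: "u \<longlonglongrightarrow> 0" using e(2) by (simp add: u_def[abs_def])
  have ev: "eventually (\<lambda>n. \<bar>u n\<bar> \<le> 1/2) sequentially"
  proof -
    have "eventually (\<lambda>n. dist (u n) 0 < 1/2) sequentially" using u0 by (rule tendstoD) simp
    then show ?thesis by eventually_elim (simp add: dist_real_def)
  qed
  have lim0: "(\<lambda>n. (ln (1 + u n) - u n) / e n) \<longlonglongrightarrow> 0"
  proof (rule Lim_null_comparison)
    show "eventually (\<lambda>n. norm ((ln (1 + u n) - u n) / e n) \<le> 2 * \<bar>u n\<bar> * \<bar>(r n - 1) / e n\<bar>) sequentially"
      using ev
    proof eventually_elim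
      case (elim n)
      then have "\<bar>ln (1 + u n) - u n\<bar> \<le> 2 * (u n)\<^sup>2"
        by (rule abs_ln_one_plus_x_minus_x_bound)
      then have "\<bar>ln (1 + u n) - u n\<bar> / \<bar>e n\<bar> \<le> 2 * (u n)\<^sup>2 / \<bar>e n\<bar>"
        by (rule divide_right_mono) simp
      also have "2 * (u n)\<^sup>2 / \<bar>e n\<bar> = 2 * \<bar>u n\<bar> * \<bar>(r n - 1) / e n\<bar>"
        by (simp add: u_def power2_eq_square flip: abs_mult)
      finally show ?case by (simp add: abs_divide)
    qed
    have "(\<lambda>n. 2 * \<bar>u n\<bar> * \<bar>(r n - 1) / e n\<bar>) \<longlonglongrightarrow> 2 * \<bar>0\<bar> * \<bar>T\<bar>"
      by (intro tendsto_intros u0 r)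
    then show "(\<lambda>n. 2 * \<bar>u n\<bar> * \<bar>(r n - 1) / e n\<bar>) \<longlonglongrightarrow> 0" by simp
  qed
  have "(\<lambda>n. exp (real (m n) * e n * ((ln (1 + u n) - u n) / e n + (r n - 1) / e n))) \<longlonglongrightarrow> exp (c * (0 + T))"
    by (intro tendsto_exp tendsto_mult tendsto_add m lim0 r)
  moreover have "eventually (\<lambda>n. exp (real (m n) * e n * ((ln (1 + u n) - u n) / e n + (r n - 1) / e n)) = r n ^ m n) sequentially"
    using ev
  proof eventually_elim
    case (elim n)
    then have rp: "r n > 0" unfolding u_def by linarith
    have eq: "real (m n) * e n * ((ln (1 + u n) - u n) / e n + (r n - 1) / e n) = real (m n) * ln (r n)"
      using e(2)[of n] by (simp add: u_def field_simps)
    show ?case unfolding eq using rp by (simp add: exp_of_nat_mult)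
  qed
  ultimately show ?thesis by (auto dest: Lim_transform_eventually)
qed

context cmats
begin

section \<open>Entrywise limits and expansion of the Schur complement\<close>

definition mlim :: "(nat \<Rightarrow> cmx) \<Rightarrow> cmx \<Rightarrow> bool" where
  "mlim X Y \<longleftrightarrow> (\<forall>i j. (\<lambda>n. X n i j) \<longlonglongrightarrow> Y i j)"

lemma mlimD: "mlim X Y \<Longrightarrow> (\<lambda>n. X n i j) \<longlonglongrightarrow> Y i j"
  by (simp add: mlim_def)

lemma mlim_const: "mlim (\<lambda>_. X) X"
  by (simp add: mlim_def)

lemma mlim_diff: "mlim X Y \<Longrightarrow> mlim X' Y' \<Longrightarrow> mlim (\<lambda>n. X n - X' n) (Y - Y')"
  by (auto simp: mlim_def intro!: tendsto_intros)

lemma mlim_mm: "mlim X Y \<Longrightarrow> mlim X' Y' \<Longrightarrow> mlim (\<lambda>n. X n \<diamondop> X' n) (Y \<diamondop> Y')"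
  by (auto simp: mlim_def mm_def intro!: tendsto_intros)

lemma mlim_sum: "(\<And>i. i \<in> I \<Longrightarrow> mlim (X i) (Y i)) \<Longrightarrow> mlim (\<lambda>n. \<Sum>i\<in>I. X i n) (\<Sum>i\<in>I. Y i)"
  by (auto simp: mlim_def sum_fun_apply intro!: tendsto_intros)

lemma mlim_fdet: "mlim X Y \<Longrightarrow> (\<lambda>n. fdet (X n)) \<longlonglongrightarrow> fdet Y"
  unfolding fdet_Leibniz by (auto simp: mlim_def intro!: tendsto_intros)

lemma tendsto_det_mat:
  assumes "\<And>i j. i < m \<Longrightarrow> j < m \<Longrightarrow> (\<lambda>n. f n (i, j)) \<longlonglongrightarrow> g (i, j)"
  shows "(\<lambda>n. Determinant.det (Matrix.mat m m (f n) :: complex mat)) \<longlonglongrightarrow> Determinant.det (Matrix.mat m m g)"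
proof -
  have eq: "Determinant.det (Matrix.mat m m f) = (\<Sum>\<pi> | \<pi> permutes {0..<m}. signof \<pi> * (\<Prod>i = 0..<m. f (i, \<pi> i)))"
    for f :: "nat \<times> nat \<Rightarrow> complex"
    by (subst det_def'[of _ m]) (auto intro!: sum.cong prod.cong simp: permutes_in_image)
  show ?thesis
    unfolding eq
  proof (intro tendsto_sum tendsto_mult tendsto_const tendsto_prod)
    fix \<pi> i assume "\<pi> \<in> {\<pi>. \<pi> permutes {0..<m}}" "i \<in> {0..<m}"
    then show "(\<lambda>n. f n (i, \<pi> i)) \<longlonglongrightarrow> g (i, \<pi> i)"
      using permutes_in_image[of \<pi> "{0..<m}" i] by (intro assms) auto
  qed
qed

lemma mlim_finv:
  assumes X: "mlim X Y" and Y: "fdet Y \<noteq> 0"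
  shows "mlim (\<lambda>n. finv (X n)) (finv Y)"
  unfolding mlim_def
proof (intro allI)
  fix i j
  show "(\<lambda>n. finv (X n) i j) \<longlonglongrightarrow> finv Y i j"
  proof (cases "i < p \<and> j < p")
    case True
    then have "(\<lambda>n. (- 1) ^ (j + i) * Determinant.det (Matrix.mat (p - 1) (p - 1)
        (\<lambda>(i', j'). X n (if i' < j then i' else Suc i') (if j' < i then j' else Suc j'))) / fdet (X n)) \<longlonglongrightarrow>
      (- 1) ^ (j + i) * Determinant.det (Matrix.mat (p - 1) (p - 1)
        (\<lambda>(i', j'). Y (if i' < j then i' else Suc i') (if j' < i then j' else Suc j'))) / fdet Y"
      by (intro tendsto_intros tendsto_det_mat mlim_fdet X Y) (use X in \<open>auto simp: mlim_def\<close>)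
    then show ?thesis using True by (simp add: finv_entry)
  next
    case False
    then have "finv Z i j = 0" for Z by (auto simp: finv_def)
    then show ?thesis by simp
  qed
qed

lemma finv_one: "finv one = one"
  by (rule finv_unique) auto

text \<open>The derivative of the determinant at the identity is the trace. In the Leibniz sum, a
  permutation other than the identity moves at least two points and so has two off-diagonal factors:
  one is divided by \<open>h\<close> and converges, the other still tends to 0.\<close>

lemma fdet_minus_one_tendsto:
  fixes h :: "nat \<Rightarrow> complex"
  assumes h: "h \<longlonglongrightarrow> 0" "\<And>n. h n \<noteq> 0" and X: "\<And>i j. (\<lambda>n. (X n i j - one i j) / h n) \<longlonglongrightarrow> Y i j"
  shows "(\<lambda>n. (fdet (X n) - 1) / h n) \<longlonglongrightarrow> ftr Y"
proof -
  have X1: "(\<lambda>n. X n i j) \<longlonglongrightarrow> one i j" for i j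
  proof -
    have "(\<lambda>n. (X n i j - one i j) / h n * h n + one i j) \<longlonglongrightarrow> Y i j * 0 + one i j"
      by (intro tendsto_intros X h)
    then show ?thesis using h(2) by simp
  qed
  let ?S = "{\<pi>. \<pi> permutes {..<p}}"
  have fin: "finite ?S" by (rule finite_permutations) simp
  have id: "id \<in> ?S" by (simp add: permutes_id)
  have eq: "(fdet (X n) - 1) / h n = ((\<Prod>i<p. X n i i) - 1) / h n +
     (\<Sum>\<pi>\<in>?S - {id}. signof \<pi> * ((\<Prod>i<p. X n i (\<pi> i)) / h n))" for n
  proof -
    have "fdet (X n) = (\<Prod>i<p. X n i i) + (\<Sum>\<pi>\<in>?S - {id}. signof \<pi> * (\<Prod>i<p. X n i (\<pi> i)))"
      unfolding fdet_Leibniz by (subst sum.remove[OF fin id]) simp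
    then show ?thesis by (simp add: add_divide_distrib diff_divide_distrib sum_divide_distrib)
  qed
  have 1: "(\<lambda>n. ((\<Prod>i<p. X n i i) - 1) / h n) \<longlonglongrightarrow> (\<Sum>i<p. Y i i)"
  proof (rule prod_minus_one_tendsto)
    fix i assume "i \<in> {..<p}"
    then show "(\<lambda>n. X n i i) \<longlonglongrightarrow> 1" "(\<lambda>n. (X n i i - 1) / h n) \<longlonglongrightarrow> Y i i"
      using X1[of i i] X[of i i] by (auto simp: one_def)
  qed simp
  have 2: "(\<lambda>n. signof \<pi> * ((\<Prod>i<p. X n i (\<pi> i)) / h n)) \<longlonglongrightarrow> 0" if "\<pi> \<in> ?S - {id}" for \<pi>
  proof -
    have \<pi>: "\<pi> permutes {..<p}" "\<pi> \<noteq> id" using that by auto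
    then obtain a where a: "\<pi> a \<noteq> a" by (auto simp: fun_eq_iff)
    then have ap: "a < p" using \<pi>(1) by (metis lessThan_iff permutes_not_in)
    define b where "b = \<pi> a"
    have bp: "b < p" using permutes_in_image[OF \<pi>(1), of a] ap by (simp add: b_def)
    have b: "\<pi> b \<noteq> b" using a permutes_inj[OF \<pi>(1)] by (auto simp: b_def inj_def)
    have ba: "b \<noteq> a" using a by (simp add: b_def)
    have split: "(\<Prod>i<p. X n i (\<pi> i)) / h n =
        (X n a (\<pi> a) - one a (\<pi> a)) / h n * (X n b (\<pi> b) * (\<Prod>i\<in>{..<p} - {a} - {b}. X n i (\<pi> i)))" for n
      using ap bp a ba by (subst prod.remove[of _ a], simp, simp, subst prod.remove[of _ b]) (auto simp: one_def)
    have "(\<lambda>n. signof \<pi> * ((X n a (\<pi> a) - one a (\<pi> a)) / h n * (X n b (\<pi> b) * (\<Prod>i\<in>{..<p} - {a} - {b}. X n i (\<pi> i)))))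
       \<longlonglongrightarrow> signof \<pi> * (Y a (\<pi> a) * (one b (\<pi> b) * (\<Prod>i\<in>{..<p} - {a} - {b}. one i (\<pi> i))))"
      by (intro tendsto_intros X X1)
    then show ?thesis using b by (simp add: split one_def)
  qed
  have "(\<lambda>n. (fdet (X n) - 1) / h n) \<longlonglongrightarrow> (\<Sum>i<p. Y i i) + (\<Sum>\<pi>\<in>?S - {id}. 0)"
    unfolding eq by (intro tendsto_add tendsto_sum 1 2)
  then show ?thesis by (simp add: ftr_def)
qed

text \<open>The innovation is \<open>e n\<close> times a matrix tending to \<open>C (Suc k)\<close>,
  and the predictor column tends to the unit column, so each step of the recursion subtracts the
  square of one moment at order \<open>(e n)\<^sup>2\<close>.\<close>

lemma LP_expansion:
  assumes C: "htup C" and e: "e \<longlonglongrightarrow> 0" "\<And>n. e n \<noteq> 0"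
  shows "(\<forall>j. mlim (\<lambda>n. LA (tsc (e n) C) k j) (if j = 0 then one else 0)) \<and> mlim (\<lambda>n. LP (tsc (e n) C) k) one \<and>
    (\<forall>a b. (\<lambda>n. (LP (tsc (e n) C) k a b - one a b) / of_real ((e n)\<^sup>2)) \<longlonglongrightarrow> - (\<Sum>l=1..k. C l \<diamondop> C l) a b)"
proof (induction k)
  case 0
  have "LA (tsc (e n) C) 0 j = (if j = 0 then one else 0)" for n j by (simp add: LA_0)
  then show ?case by (simp add: mlim_const)
next
  case (Suc k)
  then have A: "\<And>j. mlim (\<lambda>n. LA (tsc (e n) C) k j) (if j = 0 then one else 0)"
    and P: "mlim (\<lambda>n. LP (tsc (e n) C) k) one"
    and D: "\<And>a b. (\<lambda>n. (LP (tsc (e n) C) k a b - one a b) / of_real ((e n)\<^sup>2)) \<longlonglongrightarrow> - (\<Sum>l=1..k. C l \<diamondop> C l) a b"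
    by auto
  define E where "E n = (\<Sum>j\<le>k. C (Suc k - j) \<diamondop> LA (tsc (e n) C) k j)" for n
  \<comment> \<open>Only indices from 1 on occur in the innovation, so the dilation comes out as one
    factor.\<close>
  have LE: "LE (tsc (e n) C) k = csc (e n) (E n)" for n
    unfolding LE_def E_def csc_sum csc_mm(1)[symmetric] by (intro sum.cong refl) (auto simp: tsc_def)
  have "mlim E (\<Sum>j\<le>k. C (Suc k - j) \<diamondop> (if j = 0 then one else 0))"
    unfolding E_def by (intro mlim_sum mlim_mm mlim_const A)
  also have "(\<Sum>j\<le>k. C (Suc k - j) \<diamondop> (if j = 0 then one else 0)) = (\<Sum>j\<le>k. if j = 0 then C (Suc k) else 0)"
    using C by (intro sum.cong refl) (auto simp: htupD)
  also have "\<dots> = C (Suc k)" by simp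
  finally have E: "mlim E (C (Suc k))" .
  have c0: "mlim X Y \<Longrightarrow> mlim (\<lambda>n. csc (e n) (X n)) 0" for X Y
    unfolding mlim_def csc_def using tendsto_mult[OF tendsto_of_real[OF e(1), where 'a = complex]] by fastforce
  have LE0: "mlim (\<lambda>n. LE (tsc (e n) C) k) 0"
    unfolding LE by (rule c0[OF E])
  have Q: "mlim (\<lambda>n. finv (LP (tsc (e n) C) k)) one"
    using mlim_finv[OF P] by (simp add: finv_one)
  define Q where "Q n = finv (LP (tsc (e n) C) k)" for n
  have QE: "mlim (\<lambda>n. Q n \<diamondop> LE (tsc (e n) C) k) 0"
    using mlim_mm[OF Q LE0] by (simp add: Q_def)
  have "mlim (\<lambda>n. LA (tsc (e n) C) (Suc k) j) (if j = 0 then one else 0)" for j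
  proof (cases "j \<le> Suc k")
    case True
    have "mlim (\<lambda>n. LA (tsc (e n) C) k j - LA (tsc (e n) C) k (Suc k - j) \<diamondop> (Q n \<diamondop> LE (tsc (e n) C) k))
       ((if j = 0 then one else 0) - (if Suc k - j = 0 then one else 0) \<diamondop> 0)"
      by (intro mlim_diff mlim_mm[OF A QE] A)
    then show ?thesis using True by (simp add: LA_Suc Q_def)
  next
    case False
    then show ?thesis by (simp add: LA_Suc mlim_const)
  qed
  moreover have "mlim (\<lambda>n. LP (tsc (e n) C) (Suc k)) one"
    using mlim_diff[OF P mlim_mm[OF LE0 QE]] by (simp add: LP_Suc Q_def)
  moreover have "(\<lambda>n. (LP (tsc (e n) C) (Suc k) a b - one a b) / of_real ((e n)\<^sup>2)) \<longlonglongrightarrow> - (\<Sum>l=1..Suc k. C l \<diamondop> C l) a b" for a b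
  proof -
    have "LE (tsc (e n) C) k \<diamondop> (finv (LP (tsc (e n) C) k) \<diamondop> LE (tsc (e n) C) k) = csc (e n) (csc (e n) (E n \<diamondop> (Q n \<diamondop> E n)))" for n
      by (simp add: LE csc_mm Q_def)
    then have "(LP (tsc (e n) C) (Suc k) a b - one a b) / of_real ((e n)\<^sup>2) =
       (LP (tsc (e n) C) k a b - one a b) / of_real ((e n)\<^sup>2) - (E n \<diamondop> (Q n \<diamondop> E n)) a b" for n
      using e(2)[of n] by (simp add: LP_Suc csc_def power2_eq_square field_simps)
    moreover have "(\<lambda>n. (LP (tsc (e n) C) k a b - one a b) / of_real ((e n)\<^sup>2) - (E n \<diamondop> (Q n \<diamondop> E n)) a b)
       \<longlonglongrightarrow> - (\<Sum>l=1..k. C l \<diamondop> C l) a b - (C (Suc k) \<diamondop> (one \<diamondop> C (Suc k))) a b"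
      using Q by (intro tendsto_diff D mlimD[OF mlim_mm] mlim_mm E) (simp add: Q_def[abs_def])
    ultimately show ?thesis using C by (simp add: htupD sum_fun_apply)
  qed
  ultimately show ?case by blast
qed

lemma eventually_regular:
  assumes C: "htup C" and e: "e \<longlonglongrightarrow> 0" "\<And>n. e n \<noteq> 0"
  shows "eventually (\<lambda>n. regular k (tsc (e n) C)) sequentially"
proof (induction k)
  case 0
  then show ?case by (simp add: regular_def)
next
  case (Suc k)
  have "eventually (\<lambda>n. cmod (LP (tsc (e n) C) (Suc k) i j - one i j) < 1 / (real p + 1)) sequentially" for i j
  proof -
    have "mlim (\<lambda>n. LP (tsc (e n) C) (Suc k)) one"
      using LP_expansion[OF C e, of "Suc k"] by blast
    from tendstoD[OF mlimD[OF this, of i j], of "1 / (real p + 1)"] show ?thesis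
      by (simp add: dist_norm)
  qed
  then have "eventually (\<lambda>n. \<forall>i\<in>{..<p}. \<forall>j\<in>{..<p}. cmod (LP (tsc (e n) C) (Suc k) i j - one i j) < 1 / (real p + 1)) sequentially"
    by (intro eventually_ball_finite ballI) auto
  with Suc show ?case
  proof eventually_elim
    case (elim n)
    have "herm (LP (tsc (e n) C) (Suc k))"
      using elim(1) posdef_fdet(3)
      by (intro conjunct2[OF levinson(1)] htup_tsc[OF C]) (auto simp: regular_def)
    then have "posdef (LP (tsc (e n) C) (Suc k))"
      by (rule posdef_near_one[where e = "1 / (real p + 1)"]) (use elim(2) in \<open>auto intro: less_imp_le simp: field_simps\<close>)
    then show ?case using elim(1) by (auto simp: regular_def le_Suc_eq)
  qed
qed

lemma dens_tendsto:
  fixes m :: "nat \<Rightarrow> nat"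
  assumes C: "htup C" and e: "e \<longlonglongrightarrow> 0" "\<And>n. e n \<noteq> 0" and m: "(\<lambda>n. real (m n) * (e n)\<^sup>2) \<longlonglongrightarrow> c"
  shows "(\<lambda>n. dens k (m n) (tsc (e n) C)) \<longlonglongrightarrow> exp (- c * (\<Sum>l=1..k. Re (ftr (C l \<diamondop> C l))))"
proof -
  define r where "r n = Re (fdet (LP (tsc (e n) C) k))" for n
  have e2: "(\<lambda>n. (e n)\<^sup>2) \<longlonglongrightarrow> 0" using tendsto_power[OF e(1), of 2] by simp
  have "(\<lambda>n. (fdet (LP (tsc (e n) C) k) - 1) / of_real ((e n)\<^sup>2)) \<longlonglongrightarrow> ftr (\<lambda>a b. - (\<Sum>l=1..k. C l \<diamondop> C l) a b)"
  proof (rule fdet_minus_one_tendsto)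
    show "(\<lambda>n. complex_of_real ((e n)\<^sup>2)) \<longlonglongrightarrow> 0" using tendsto_of_real[OF e2] by simp
  qed (use LP_expansion[OF C e, of k] e(2) in auto)
  from tendsto_Re[OF this] have "(\<lambda>n. (r n - 1) / (e n)\<^sup>2) \<longlonglongrightarrow> Re (ftr (\<lambda>a b. - (\<Sum>l=1..k. C l \<diamondop> C l) a b))"
    by (simp add: r_def Re_divide_of_real flip: of_real_power)
  also have "Re (ftr (\<lambda>a b. - (\<Sum>l=1..k. C l \<diamondop> C l) a b)) = - (\<Sum>l=1..k. Re (ftr (C l \<diamondop> C l)))"
    by (simp add: ftr_def sum_fun_apply sum_negf) (rule sum.swap)
  finally have "(\<lambda>n. r n ^ m n) \<longlonglongrightarrow> exp (c * - (\<Sum>l=1..k. Re (ftr (C l \<diamondop> C l))))"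
    by (intro tendsto_power_exp[OF e2 _ _ m]) (auto simp: e(2))
  moreover have "eventually (\<lambda>n. r n ^ m n = dens k (m n) (tsc (e n) C)) sequentially"
    using eventually_regular[OF C e, of k] by eventually_elim (simp add: dens_def r_def)
  ultimately show ?thesis by (auto dest: Lim_transform_eventually)
qed

text \<open>At unit vectors, \<open>Re_qf_LP_le\<close> bounds each diagonal entry of
  \<open>LP\<close> by 1 minus that of the square of \<open>C l\<close>, separately for every
  \<open>l\<close>. Averaging over the \<open>k\<close> values of \<open>l\<close> gives the factor
  1 / k, and \<open>posdef_fdet_le\<close> passes from the trace to the determinant.\<close>

lemma dens_le:
  assumes C: "htup C" and k: "1 \<le> k"
  shows "dens k m C \<le> exp (- (real m / real k) * (\<Sum>l=1..k. Re (ftr (C l \<diamondop> C l))))"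
proof (cases "regular k C")
  case True
  then have pos: "\<And>j. j \<le> k \<Longrightarrow> posdef (LP C j)" by (simp add: regular_def)
  have diag: "Re (LP C k i i) \<le> 1 - Re ((C l \<diamondop> C l) i i)" if "i < p" "l \<in> {1..k}" for i l
  proof -
    define v where "v j = (if j = i then 1 else 0 :: complex)" for j
    have "qf X v = X i i" for X
      using that(1) by (simp add: qf_def v_def if_distrib[of "\<lambda>x. _ * x"] if_distrib[of "\<lambda>x. x * _"] if_distrib[of cnj] cong: if_cong)
    then show ?thesis
      using Re_qf_LP_le[OF C pos, of k l v] that by (simp add: one_def)
  qed
  have "real k * Re (LP C k i i) \<le> real k - (\<Sum>l=1..k. Re ((C l \<diamondop> C l) i i))" if "i < p" for i
    using sum_mono[of "{1..k}", OF diag[OF that]] by (simp add: sum_subtractf)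
  then have "(\<Sum>i<p. real k * Re (LP C k i i)) \<le> (\<Sum>i<p. real k - (\<Sum>l=1..k. Re ((C l \<diamondop> C l) i i)))"
    by (intro sum_mono) simp
  also have "\<dots> = real k * real p - (\<Sum>l=1..k. Re (ftr (C l \<diamondop> C l)))"
    unfolding sum_subtractf ftr_def Re_sum by (subst sum.swap) simp
  finally have "real k * (Re (ftr (LP C k)) - real p) \<le> - (\<Sum>l=1..k. Re (ftr (C l \<diamondop> C l)))"
    by (simp add: ftr_def sum_distrib_left algebra_simps)
  then have le: "Re (ftr (LP C k)) - real p \<le> - (\<Sum>l=1..k. Re (ftr (C l \<diamondop> C l))) / real k"
    using k by (simp add: field_simps)
  have "dens k m C \<le> exp (Re (ftr (LP C k)) - real p) ^ m"
    using True posdef_fdet_le[OF pos[of k]] posdef_fdet(1)[OF pos[of k]]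
    by (auto simp: dens_def intro!: power_mono)
  also have "\<dots> = exp (real m * (Re (ftr (LP C k)) - real p))" by (simp add: exp_of_nat_mult)
  also have "\<dots> \<le> exp (real m * (- (\<Sum>l=1..k. Re (ftr (C l \<diamondop> C l))) / real k))"
    using le by (intro iffD2[OF exp_le_cancel_iff] mult_left_mono) auto
  finally show ?thesis by (simp add: field_simps)
qed (simp add: dens_def)

lemma ftr_csc: "ftr (csc t X \<diamondop> csc t X) = of_real (t\<^sup>2) * ftr (X \<diamondop> X)"
  by (simp add: ftr_def csc_mm sum_distrib_left power2_eq_square) (simp add: csc_def mult_ac)

lemma ftr_herm_sq: "Re (ftr (herm_of_coords p c \<diamondop> herm_of_coords p c)) =
    (\<Sum>ij\<in>ibox p. (if fst ij = snd ij then 1 else 2) * (c ij)\<^sup>2)"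
proof -
  let ?H = "herm_of_coords p c"
  have "Re (ftr (?H \<diamondop> ?H)) = (\<Sum>i<p. \<Sum>l<p. Re (?H i l * ?H l i))"
    by (simp add: ftr_def mm_def)
  also have "\<dots> = (\<Sum>i<p. \<Sum>l<p. (if i = l then (c (i, l))\<^sup>2 else (c (i, l))\<^sup>2) + (if i = l then 0 else (c (l, i))\<^sup>2))"
    by (intro sum.cong refl) (auto simp: herm_of_coords_def power2_eq_square)
  also have "\<dots> = (\<Sum>i<p. \<Sum>l<p. (c (i, l))\<^sup>2) + (\<Sum>i<p. \<Sum>l<p. if i = l then 0 else (c (l, i))\<^sup>2)"
    by (simp add: sum.distrib)
  also have "(\<Sum>i<p. \<Sum>l<p. if i = l then 0 else (c (l, i))\<^sup>2) = (\<Sum>i<p. \<Sum>l<p. if i = l then 0 else (c (i, l))\<^sup>2)"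
    by (subst sum.swap) (intro sum.cong refl, auto)
  also have "(\<Sum>i<p. \<Sum>l<p. (c (i, l))\<^sup>2) + (\<Sum>i<p. \<Sum>l<p. if i = l then 0 else (c (i, l))\<^sup>2) =
     (\<Sum>i<p. \<Sum>l<p. (if i = l then 1 else 2) * (c (i, l))\<^sup>2)"
    unfolding sum.distrib[symmetric] by (intro sum.cong refl) auto
  also have "\<dots> = (\<Sum>ij\<in>ibox p. (if fst ij = snd ij then 1 else 2) * (c ij)\<^sup>2)"
    unfolding ibox_def sum.cartesian_product by (intro sum.cong refl) auto
  finally show ?thesis .
qed

lemma Ctup_scale: "Ctup k (\<lambda>i. t * x i) = tsc t (Ctup k x)"
  by (intro ext) (auto simp: Ctup_def tsc_def csc_def herm_of_coords_def complex_eq_iff)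

end

section \<open>Moments of complex measures\<close>

text \<open>Half-open cells of length 1 / (N + 1). The index r = N + 1 gives the single point 1,
  which is why the Riemann sums run up to \<open>Suc N\<close>.\<close>

definition cell :: "nat \<Rightarrow> nat \<Rightarrow> real set" where
  "cell N r = {x \<in> {0..1}. \<lfloor>real (Suc N) * x\<rfloor> = int r}"

lemma sets_M01: "sets M01 = sets (restrict_space borel {0..1::real})" and space_M01 [simp]: "space M01 = {0..1}"
  by (simp_all add: M01_def space_restrict_space)

lemma sets_cell [measurable]: "cell N r \<in> sets M01"
proof -
  have "{x \<in> space borel. \<lfloor>real (Suc N) * x\<rfloor> = int r} \<in> sets borel" by measurable
  then have "{0..1} \<inter> {x. \<lfloor>real (Suc N) * x\<rfloor> = int r} \<in> sets M01"
    unfolding sets_M01 sets_restrict_space by (intro image_eqI[of _ _ "{x. \<lfloor>real (Suc N) * x\<rfloor> = int r}"]) simp_all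
  also have "{0..1} \<inter> {x. \<lfloor>real (Suc N) * x\<rfloor> = int r} = cell N r"
    by (auto simp: cell_def)
  finally show ?thesis .
qed

text \<open>Left end of the cell that contains \<open>x\<close>.\<close>

definition lpt :: "nat \<Rightarrow> real \<Rightarrow> real" where
  "lpt N x = real_of_int \<lfloor>real (Suc N) * x\<rfloor> / real (Suc N)"

lemma lpt_bounds: "0 \<le> x \<Longrightarrow> 0 \<le> lpt N x" "lpt N x \<le> x" "x - 1 / real (Suc N) \<le> lpt N x"
proof -
  show "0 \<le> x \<Longrightarrow> 0 \<le> lpt N x" by (simp add: lpt_def)
  have "real_of_int \<lfloor>real (Suc N) * x\<rfloor> \<le> real (Suc N) * x" by linarith
  then show "lpt N x \<le> x" unfolding lpt_def by (simp add: divide_le_eq mult.commute del: of_nat_Suc)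
  have "real (Suc N) * x - 1 \<le> real_of_int \<lfloor>real (Suc N) * x\<rfloor>" by linarith
  then have "(real (Suc N) * x - 1) / real (Suc N) \<le> lpt N x" unfolding lpt_def by (rule divide_right_mono) simp
  then show "x - 1 / real (Suc N) \<le> lpt N x" by (simp add: diff_divide_distrib del: of_nat_Suc)
qed

lemma lpt_tendsto: "(\<lambda>N. lpt N x) \<longlonglongrightarrow> x"
proof (rule tendsto_sandwich)
  show "eventually (\<lambda>N. x - 1 / real (Suc N) \<le> lpt N x) sequentially" using lpt_bounds by simp
  show "eventually (\<lambda>N. lpt N x \<le> x) sequentially" using lpt_bounds by simp
  have "(\<lambda>N. x - inverse (real (Suc N))) \<longlonglongrightarrow> x - 0" by (intro tendsto_intros LIMSEQ_inverse_real_of_nat)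
  then show "(\<lambda>N. x - 1 / real (Suc N)) \<longlonglongrightarrow> x" by (simp add: inverse_eq_divide)
qed simp

lemma f_lpt_tendsto:
  fixes f :: "real \<Rightarrow> real"
  assumes "continuous_on {0..1} f" "x \<in> {0..1}"
  shows "(\<lambda>N. f (lpt N x)) \<longlonglongrightarrow> f x"
proof (rule continuous_on_tendsto_compose[OF assms(1) lpt_tendsto assms(2)])
  have "lpt N x \<in> {0..1}" for N using lpt_bounds(1)[of x N] lpt_bounds(2)[of N x] assms(2) by auto
  then show "eventually (\<lambda>N. lpt N x \<in> {0..1}) sequentially" by simp
qed

lemma sum_cell:
  fixes g :: "real \<Rightarrow> 'a::real_vector"
  assumes x: "x \<in> {0..1}"
  shows "(\<Sum>r\<le>Suc N. (indicator (cell N r) x :: real) *\<^sub>R g (real r / real (Suc N))) = g (lpt N x)"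
proof -
  define r0 where "r0 = nat \<lfloor>real (Suc N) * x\<rfloor>"
  have i0: "int r0 = \<lfloor>real (Suc N) * x\<rfloor>" using x by (simp add: r0_def)
  have "real (Suc N) * x \<le> real (Suc N) * 1" using x by (intro mult_left_mono) auto
  then have "\<lfloor>real (Suc N) * x\<rfloor> \<le> int (Suc N)"
    using floor_mono[of "real (Suc N) * x" "real (Suc N)"] by (simp del: of_nat_Suc)
  then have r0: "r0 \<le> Suc N" using i0 by linarith
  have "indicator (cell N r) x = (if r = r0 then 1 else 0 :: real)" for r
    using x by (simp add: cell_def indicator_def i0[symmetric] del: of_nat_Suc)
  then have "(\<Sum>r\<le>Suc N. (indicator (cell N r) x :: real) *\<^sub>R g (real r / real (Suc N))) =
      (\<Sum>r\<le>Suc N. if r = r0 then g (real r / real (Suc N)) else 0)"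
    by (intro sum.cong refl) simp
  also have "\<dots> = g (real r0 / real (Suc N))" using r0 by (simp del: of_nat_Suc sum.atMost_Suc)
  also have "real r0 / real (Suc N) = lpt N x"
    unfolding lpt_def i0[symmetric] by simp
  finally show ?thesis .
qed

text \<open>The sum is the integral of the step function \<open>f (lpt N x)\<close>, which is
  bounded by the maximum of |f| and converges pointwise to \<open>f\<close>.\<close>

lemma Riemann_LIMSEQ:
  fixes f :: "real \<Rightarrow> real"
  assumes M: "sets M = sets M01" "finite_measure M" and f: "continuous_on {0..1} f"
  shows "(\<lambda>N. \<Sum>r\<le>Suc N. f (real r / real (Suc N)) * measure M (cell N r)) \<longlonglongrightarrow> (\<integral>x. f x \<partial>M)"
proof -
  interpret finite_measure M by fact
  have sp: "space M = {0..1}" using sets_eq_imp_space_eq[OF M(1)] by simp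
  have cellM [measurable]: "cell N r \<in> sets M" for N r using sets_cell by (simp add: M(1))
  define s where "s N x = (\<Sum>r\<le>Suc N. f (real r / real (Suc N)) * indicator (cell N r) x)" for N x
  have s: "s N x = f (lpt N x)" if "x \<in> {0..1}" for N x
    using sum_cell[OF that, of N f] by (simp add: s_def mult.commute del: sum.atMost_Suc of_nat_Suc)
  have "compact (f ` {0..1})" by (rule compact_continuous_image[OF f]) simp
  then obtain B where B: "\<And>x. x \<in> {0..1} \<Longrightarrow> \<bar>f x\<bar> \<le> B"
    using compact_imp_bounded by (fastforce simp: bounded_iff)
  have fm: "f \<in> borel_measurable M"
    using borel_measurable_continuous_on_restrict[OF f] M(1) by (simp add: M01_def cong: measurable_cong_sets)
  have sm: "s N \<in> borel_measurable M" for N unfolding s_def by measurable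
  have "(\<lambda>N. \<integral>x. s N x \<partial>M) \<longlonglongrightarrow> (\<integral>x. f x \<partial>M)"
  proof (rule integral_dominated_convergence[where w = "\<lambda>_. B"])
    show "AE x in M. (\<lambda>N. s N x) \<longlonglongrightarrow> f x"
      using f_lpt_tendsto[OF f] by (intro AE_I2) (simp add: s sp)
    show "AE x in M. norm (s N x) \<le> B" for N
    proof (rule AE_I2)
      fix x assume x: "x \<in> space M"
      then have "lpt N x \<in> {0..1}" using lpt_bounds(1)[of x N] lpt_bounds(2)[of N x] sp by auto
      then show "norm (s N x) \<le> B" using B x sp by (simp add: s)
    qed
  qed (use fm sm in auto)
  moreover have "(\<integral>x. s N x \<partial>M) = (\<Sum>r\<le>Suc N. f (real r / real (Suc N)) * measure M (cell N r))" for N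
  proof -
    have "(\<integral>x. s N x \<partial>M) = (\<Sum>r\<le>Suc N. \<integral>x. f (real r / real (Suc N)) * indicator (cell N r) x \<partial>M)"
      unfolding s_def by (intro Bochner_Integration.integral_sum integrable_mult_right integrable_real_indicator)
        (auto simp: less_top[symmetric])
    then show ?thesis by (simp del: sum.atMost_Suc of_nat_Suc)
  qed
  ultimately show ?thesis by simp
qed

definition decomp :: "(real set \<Rightarrow> complex) \<Rightarrow> real measure \<Rightarrow> real measure \<Rightarrow> real measure \<Rightarrow> real measure \<Rightarrow> bool" where
  "decomp \<nu> M1 M2 M3 M4 \<longleftrightarrow> (\<forall>M\<in>{M1, M2, M3, M4}. sets M = sets M01 \<and> finite_measure M) \<and>
      (\<forall>B\<in>sets M01. \<nu> B = Complex (measure M1 B - measure M2 B) (measure M3 B - measure M4 B))"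

lemma decomp_LIMSEQ:
  assumes D: "decomp \<nu> M1 M2 M3 M4" and f: "continuous_on {0..1} f"
  shows "(\<lambda>N. \<Sum>r\<le>Suc N. complex_of_real (f (real r / real (Suc N))) * \<nu> (cell N r)) \<longlonglongrightarrow>
    Complex ((\<integral>x. f x \<partial>M1) - (\<integral>x. f x \<partial>M2)) ((\<integral>x. f x \<partial>M3) - (\<integral>x. f x \<partial>M4))"
proof -
  have M: "sets M = sets M01" "finite_measure M" if "M \<in> {M1, M2, M3, M4}" for M
    using D that by (auto simp: decomp_def)
  have "(\<Sum>r\<le>Suc N. complex_of_real (f (real r / real (Suc N))) * \<nu> (cell N r)) =
    Complex ((\<Sum>r\<le>Suc N. f (real r / real (Suc N)) * measure M1 (cell N r)) - (\<Sum>r\<le>Suc N. f (real r / real (Suc N)) * measure M2 (cell N r)))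
      ((\<Sum>r\<le>Suc N. f (real r / real (Suc N)) * measure M3 (cell N r)) - (\<Sum>r\<le>Suc N. f (real r / real (Suc N)) * measure M4 (cell N r)))" for N
  proof -
    have "\<nu> (cell N r) = Complex (measure M1 (cell N r) - measure M2 (cell N r)) (measure M3 (cell N r) - measure M4 (cell N r))" for r
      using D sets_cell by (auto simp: decomp_def)
    then show ?thesis
      by (simp add: complex_eq_iff sum_subtractf[symmetric] right_diff_distrib del: sum.atMost_Suc of_nat_Suc)
  qed
  then show ?thesis
    using Riemann_LIMSEQ[OF M f] by (auto intro!: tendsto_Complex tendsto_diff simp del: sum.atMost_Suc of_nat_Suc)
qed

text \<open>The sums in \<open>decomp_LIMSEQ\<close> involve only \<open>\<nu>\<close>, so any two
  decompositions give the same limit. This resolves the definite description for continuous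
  integrands.\<close>

lemma cm_integral_eq:
  assumes D: "decomp \<nu> M1 M2 M3 M4" and f: "continuous_on {0..1} f"
  shows "cm_integral \<nu> f = Complex ((\<integral>x. f x \<partial>M1) - (\<integral>x. f x \<partial>M2)) ((\<integral>x. f x \<partial>M3) - (\<integral>x. f x \<partial>M4))"
  unfolding cm_integral_def
proof (rule the_equality)
  show "\<exists>N1 N2 N3 N4. (\<forall>M\<in>{N1, N2, N3, N4}. sets M = sets M01 \<and> finite_measure M) \<and>
     (\<forall>B\<in>sets M01. \<nu> B = Complex (measure N1 B - measure N2 B) (measure N3 B - measure N4 B)) \<and>
     Complex (integral\<^sup>L M1 f - integral\<^sup>L M2 f) (integral\<^sup>L M3 f - integral\<^sup>L M4 f) =
     Complex (integral\<^sup>L N1 f - integral\<^sup>L N2 f) (integral\<^sup>L N3 f - integral\<^sup>L N4 f)"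
    using D unfolding decomp_def by blast
next
  fix z assume "\<exists>N1 N2 N3 N4. (\<forall>M\<in>{N1, N2, N3, N4}. sets M = sets M01 \<and> finite_measure M) \<and>
     (\<forall>B\<in>sets M01. \<nu> B = Complex (measure N1 B - measure N2 B) (measure N3 B - measure N4 B)) \<and>
     z = Complex (integral\<^sup>L N1 f - integral\<^sup>L N2 f) (integral\<^sup>L N3 f - integral\<^sup>L N4 f)"
  then obtain N1 N2 N3 N4 where "decomp \<nu> N1 N2 N3 N4"
    "z = Complex (integral\<^sup>L N1 f - integral\<^sup>L N2 f) (integral\<^sup>L N3 f - integral\<^sup>L N4 f)"
    unfolding decomp_def by blast
  then show "z = Complex (integral\<^sup>L M1 f - integral\<^sup>L M2 f) (integral\<^sup>L M3 f - integral\<^sup>L M4 f)"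
    using LIMSEQ_unique[OF decomp_LIMSEQ[OF D f] decomp_LIMSEQ[OF _ f]] by auto
qed

text \<open>By polarisation.\<close>

lemma matrix_measure_decomp:
  assumes \<mu>: "matrix_measure p \<mu>" and ab: "a < p" "b < p"
  shows "\<exists>M1 M2 M3 M4. decomp (\<mu> a b) M1 M2 M3 M4"
proof -
  define q where "q v B = Re (\<Sum>i<p. \<Sum>j<p. cnj (v i) * \<mu> i j B * v j)" for v B
  have q0: "0 \<le> q v B" if "B \<in> sets M01" for v B
    using \<mu> that unfolding matrix_measure_def hermitian_psd_def q_def by blast
  have herm: "\<mu> i j B = cnj (\<mu> j i B)" if "B \<in> sets M01" "i < p" "j < p" for i j B
    using \<mu> that unfolding matrix_measure_def hermitian_psd_def by blast
  define N where "N v = measure_of (space M01) (sets M01) (\<lambda>B. ennreal (q v B))" for v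
  have cm: "(\<lambda>n. \<mu> i j (A n)) sums \<mu> i j (\<Union>(range A))" if "range A \<subseteq> sets M01" "disjoint_family A" "i < p" "j < p" for A i j
    using \<mu> that unfolding matrix_measure_def is_complex_measure_def by blast
  have qs: "(\<lambda>n. q v (A n)) sums q v (\<Union>(range A))" if "range A \<subseteq> sets M01" "disjoint_family A" for A v
    unfolding q_def
  proof (rule sums_Re, rule sums_sum, rule sums_sum)
    fix i j assume "i \<in> {..<p}" "j \<in> {..<p}"
    then show "(\<lambda>n. cnj (v i) * \<mu> i j (A n) * v j) sums (cnj (v i) * \<mu> i j (\<Union>(range A)) * v j)"
      by (intro sums_mult2 sums_mult cm that) auto
  qed
  have pos: "positive (sets M01) (\<lambda>B. ennreal (q v B))" for v
  proof -
    have "\<mu> i j {} = 0" if "i < p" "j < p" for i j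
      using \<mu> that unfolding matrix_measure_def is_complex_measure_def by blast
    then show ?thesis by (simp add: positive_def q_def)
  qed
  have ca: "countably_additive (sets M01) (\<lambda>B. ennreal (q v B))" for v
    unfolding countably_additive_def
  proof (intro allI impI)
    fix A :: "nat \<Rightarrow> real set" assume A: "range A \<subseteq> sets M01" "disjoint_family A"
    show "(\<Sum>i. ennreal (q v (A i))) = ennreal (q v (\<Union>(range A)))"
      by (rule suminf_ennreal_eq[OF _ qs[OF A]]) (use q0 A in auto)
  qed
  have setsN: "sets (N v) = sets M01" for v
    unfolding N_def by (rule sets.sets_measure_of_eq)
  have emN: "emeasure (N v) B = ennreal (q v B)" if "B \<in> sets M01" for v B
    unfolding N_def by (rule emeasure_measure_of_sigma[OF sets.sigma_algebra_axioms pos ca that])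
  have mN: "measure (N v) B = q v B" if "B \<in> sets M01" for v B
    using emN[OF that] q0[OF that] by (simp add: measure_def)
  have finN: "finite_measure (N v)" for v
  proof (rule finite_measureI)
    have sp: "space (N v) = space M01" by (rule sets_eq_imp_space_eq[OF setsN])
    show "emeasure (N v) (space (N v)) \<noteq> \<infinity>" unfolding sp by (simp add: emN del: space_M01)
  qed
  \<comment> \<open>The vector (e_a + s e_b) / 2; the half makes the differences for s = 1, -1 and
    for s = -i, i exactly the real and the imaginary part of \<open>\<mu> a b\<close>.\<close>
  define e where "e s i = ((if i = a then 1 else 0) + s * (if i = b then 1 else 0)) / 2" for s :: complex and i
  have qe: "q (e s) B = Re (\<mu> a a B + cnj s * s * \<mu> b b B + s * \<mu> a b B + cnj s * \<mu> b a B) / 4" for s B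
  proof -
    have r: "(\<Sum>j<p. X j * e s j) = (X a + X b * s) / 2" for X
    proof -
      have "X j * e s j = (if j = a then X j / 2 else 0) + (if j = b then X j * s / 2 else 0)" for j
        by (simp add: e_def distrib_left)
      then show ?thesis using ab by (simp add: sum.distrib add_divide_distrib)
    qed
    have l: "(\<Sum>i<p. cnj (e s i) * Y i) = (Y a + Y b * cnj s) / 2" for Y
      using arg_cong[OF r[of "\<lambda>i. cnj (Y i)"], of cnj] by (simp add: mult.commute)
    have "(\<Sum>i<p. \<Sum>j<p. cnj (e s i) * \<mu> i j B * e s j) = (\<Sum>i<p. cnj (e s i) * (\<Sum>j<p. \<mu> i j B * e s j))"
      by (simp add: sum_distrib_left mult.assoc)
    also have "\<dots> = (\<mu> a a B + cnj s * s * \<mu> b b B + s * \<mu> a b B + cnj s * \<mu> b a B) / 4"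
      unfolding r l by (simp add: field_simps)
    finally show ?thesis unfolding q_def by (simp only: Re_divide_numeral)
  qed
  have "decomp (\<mu> a b) (N (e 1)) (N (e (- 1))) (N (e (- \<i>))) (N (e \<i>))"
    unfolding decomp_def
  proof (intro conjI ballI)
    fix B assume B: "B \<in> sets M01"
    show "\<mu> a b B = Complex (measure (N (e 1)) B - measure (N (e (- 1))) B) (measure (N (e (- \<i>))) B - measure (N (e \<i>)) B)"
      using herm[OF B ab(2,1)] by (simp add: mN[OF B] qe complex_eq_iff field_simps)
  qed (use setsN finN in auto)
  then show ?thesis by blast
qed

lemma cm_integral_LIMSEQ:
  assumes \<mu>: "matrix_measure p \<mu>" and ab: "a < p" "b < p" and f: "continuous_on {0..1} f"
  shows "(\<lambda>N. \<Sum>r\<le>Suc N. complex_of_real (f (real r / real (Suc N))) * \<mu> a b (cell N r)) \<longlonglongrightarrow> cm_integral (\<mu> a b) f"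
proof -
  obtain M1 M2 M3 M4 where D: "decomp (\<mu> a b) M1 M2 M3 M4"
    using matrix_measure_decomp[OF \<mu> ab] by blast
  show ?thesis using decomp_LIMSEQ[OF D f] cm_integral_eq[OF D f] by simp
qed

lemma cm_integral_const:
  assumes \<mu>: "matrix_measure p \<mu>" and ab: "a < p" "b < p"
  shows "cm_integral (\<mu> a b) (\<lambda>_. 1) = (if a = b then 1 else 0)"
proof -
  obtain M1 M2 M3 M4 where D: "decomp (\<mu> a b) M1 M2 M3 M4"
    using matrix_measure_decomp[OF \<mu> ab] by blast
  have "space M = {0..1}" if "M \<in> {M1, M2, M3, M4}" for M
    using D that sets_eq_imp_space_eq[of M M01] by (auto simp: decomp_def)
  moreover have "{0..1} \<in> sets M01" using sets.top[of M01] by simp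
  ultimately have "cm_integral (\<mu> a b) (\<lambda>_. 1) = \<mu> a b {0..1}"
    using D cm_integral_eq[OF D, of "\<lambda>_. 1"] by (simp add: decomp_def)
  then show ?thesis using \<mu> ab by (simp add: matrix_measure_def)
qed

text \<open>Linearity is obtained from the Riemann sums, which avoids choosing
  decompositions.\<close>

lemma cm_integral_lincomb:
  assumes \<mu>: "matrix_measure p \<mu>" and ab: "a < p" "b < p"
    and f: "\<And>i. i \<in> I \<Longrightarrow> continuous_on {0..1} (f i)" and eq: "\<And>x. x \<in> {0..1} \<Longrightarrow> g x = (\<Sum>i\<in>I. c i * f i x)"
  shows "cm_integral (\<mu> a b) g = (\<Sum>i\<in>I. complex_of_real (c i) * cm_integral (\<mu> a b) (f i))"
proof -
  have "continuous_on {0..1} g \<longleftrightarrow> continuous_on {0..1} (\<lambda>x. \<Sum>i\<in>I. c i * f i x)"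
    by (rule continuous_on_cong) (auto simp: eq)
  then have g: "continuous_on {0..1} g" using f by (auto intro!: continuous_intros)
  have "(\<Sum>r\<le>Suc N. complex_of_real (g (real r / real (Suc N))) * \<mu> a b (cell N r)) =
     (\<Sum>i\<in>I. complex_of_real (c i) * (\<Sum>r\<le>Suc N. complex_of_real (f i (real r / real (Suc N))) * \<mu> a b (cell N r)))" for N
  proof -
    have "g (real r / real (Suc N)) = (\<Sum>i\<in>I. c i * f i (real r / real (Suc N)))" if "r \<le> Suc N" for r
      using that by (intro eq) (auto simp: divide_le_eq simp del: of_nat_Suc)
    then have "(\<Sum>r\<le>Suc N. complex_of_real (g (real r / real (Suc N))) * \<mu> a b (cell N r)) =
      (\<Sum>r\<le>Suc N. \<Sum>i\<in>I. complex_of_real (c i) * (complex_of_real (f i (real r / real (Suc N))) * \<mu> a b (cell N r)))"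
      by (intro sum.cong refl) (simp add: sum_distrib_right mult.assoc del: of_nat_Suc)
    then show ?thesis by (subst (asm) sum.swap) (simp add: sum_distrib_left del: sum.atMost_Suc of_nat_Suc)
  qed
  moreover have "(\<lambda>N. \<Sum>i\<in>I. complex_of_real (c i) * (\<Sum>r\<le>Suc N. complex_of_real (f i (real r / real (Suc N))) * \<mu> a b (cell N r)))
     \<longlonglongrightarrow> (\<Sum>i\<in>I. complex_of_real (c i) * cm_integral (\<mu> a b) (f i))"
    by (intro tendsto_intros cm_integral_LIMSEQ[OF \<mu> ab] f)
  ultimately show ?thesis
    using LIMSEQ_unique[OF cm_integral_LIMSEQ[OF \<mu> ab g]] by simp
qed

text \<open>The Chebyshev polynomials shifted to \<open>[0, 1]\<close>.\<close>

definition chebT :: "nat \<Rightarrow> real \<Rightarrow> real" where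
  "chebT i x = cos (real i * arccos (2 * x - 1))"

lemma chebT_0 [simp]: "chebT 0 x = 1"
  by (simp add: chebT_def)

lemma continuous_chebT: "continuous_on {0..1} (chebT i)"
  unfolding chebT_def[abs_def] by (intro continuous_intros) auto

text \<open>\<open>arccos (cos t)\<close> need not be \<open>t\<close>, but cos (j t) is a
  polynomial in cos t by the three-term recurrence. The angles of the Fejer grid below run through a
  full turn.\<close>

lemma cos_arccos_cos: "cos (real j * arccos (cos t)) = cos (real j * t)"
proof (induction j rule: less_induct)
  case (less j)
  have rec: "cos (real (Suc (Suc i)) * s) = 2 * cos s * cos (real (Suc i) * s) - cos (real i * s)" for i s
  proof -
    have "real (Suc (Suc i)) * s = real (Suc i) * s + s" "real i * s = real (Suc i) * s - s"
      by (simp_all add: algebra_simps)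
    then show ?thesis by (simp only: cos_add cos_diff) simp
  qed
  consider "j = 0" | "j = 1" | i where "j = Suc (Suc i)" by (metis One_nat_def not0_implies_Suc)
  then show ?case
  proof cases
    case 3
    have "cos (real i * arccos (cos t)) = cos (real i * t)" "cos (real (Suc i) * arccos (cos t)) = cos (real (Suc i) * t)"
      using less 3 by (simp_all del: of_nat_Suc)
    then show ?thesis unfolding 3 rec by (simp add: cos_arccos del: of_nat_Suc)
  qed (simp_all add: cos_arccos)
qed

text \<open>With \<open>x = cos\<^sup>2 (\<theta> / 2)\<close> this is the binomial expansion of \<open>(e\<^sup>i\<^sup>\<theta>\<^sup>/\<^sup>2 + e\<^sup>-\<^sup>i\<^sup>\<theta>\<^sup>/\<^sup>2)\<^sup>2\<^sup>j\<close>.\<close>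

lemma power_chebT:
  assumes x: "x \<in> {0..1}"
  shows "x ^ j = s0 j + (\<Sum>i=1..j. amat j i / 2 * chebT i x)"
proof -
  define t where "t = arccos (2 * x - 1)"
  have ct: "cos t = 2 * x - 1" using x unfolding t_def by (intro cos_arccos) auto
  have xc: "x = (cos (t / 2))\<^sup>2" using cos_double_cos[of "t / 2"] ct by simp
  have "of_real (4 ^ j * x ^ j) = (2 * complex_of_real (cos (t / 2))) ^ (2 * j)"
    by (simp add: xc power_mult power_mult_distrib)
  also have "2 * complex_of_real (cos (t / 2)) = cis (t / 2) + cis (- (t / 2))"
    by (simp add: complex_eq_iff)
  also have "(cis (t / 2) + cis (- (t / 2))) ^ (2 * j) =
      (\<Sum>l\<le>2 * j. of_nat ((2 * j) choose l) * cis (t / 2) ^ l * cis (- (t / 2)) ^ (2 * j - l))"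
    by (rule binomial_ring)
  also have "Re \<dots> = (\<Sum>l\<le>2 * j. real ((2 * j) choose l) * cos ((real l - real j) * t))"
  proof -
    have "cis (t / 2) ^ l * cis (- (t / 2)) ^ (2 * j - l) = cis ((real l - real j) * t)" if "l \<le> 2 * j" for l
    proof -
      have "real l * (t / 2) + real (2 * j - l) * (- (t / 2)) = (real l - real j) * t"
        using that by (simp add: of_nat_diff field_simps)
      then have "cis (real l * (t / 2) + real (2 * j - l) * (- (t / 2))) = cis ((real l - real j) * t)" by (rule arg_cong)
      then show ?thesis unfolding Complex.DeMoivre cis_mult .
    qed
    then show ?thesis by (simp add: mult.assoc)
  qed
  finally have 1: "4 ^ j * x ^ j = (\<Sum>l\<le>2 * j. real ((2 * j) choose l) * cos ((real l - real j) * t))"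
    by (simp only: Re_complex_of_real)
  \<comment> \<open>The terms l and 2 j - l coincide. The middle one yields \<open>s0 j\<close>; the
    others pair up to twice a binomial over 4^j, which is \<open>amat j i / 2\<close>.\<close>
  have "{..2 * j} = {..<j} \<union> {j} \<union> {j<..2 * j}" by auto
  then have "(\<Sum>l\<le>2 * j. real ((2 * j) choose l) * cos ((real l - real j) * t)) =
     (\<Sum>l<j. real ((2 * j) choose l) * cos ((real l - real j) * t)) + real ((2 * j) choose j) +
     (\<Sum>l\<in>{j<..2 * j}. real ((2 * j) choose l) * cos ((real l - real j) * t))"
    by (simp add: sum.union_disjoint ivl_disj_int_one(4) Int_commute disjoint_iff)
  also have "(\<Sum>l<j. real ((2 * j) choose l) * cos ((real l - real j) * t)) =
     (\<Sum>i=1..j. real ((2 * j) choose (j - i)) * cos (real i * t))"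
    by (rule sum.reindex_bij_witness[of _ "\<lambda>i. j - i" "\<lambda>l. j - l"])
      (auto simp: of_nat_diff algebra_simps cos_diff)
  also have "(\<Sum>l\<in>{j<..2 * j}. real ((2 * j) choose l) * cos ((real l - real j) * t)) =
     (\<Sum>i=1..j. real ((2 * j) choose (j - i)) * cos (real i * t))"
  proof (rule sum.reindex_bij_witness[of _ "\<lambda>i. j + i" "\<lambda>l. l - j"])
    fix l assume l: "l \<in> {j<..2 * j}"
    then have "(2 * j) choose l = (2 * j) choose (j - (l - j))"
    proof -
      have "j - (l - j) = 2 * j - l" using l by auto
      then show ?thesis using binomial_symmetric[of l "2 * j"] l by simp
    qed
    then show "real ((2 * j) choose (j - (l - j))) * cos (real (l - j) * t) =
       real ((2 * j) choose l) * cos ((real l - real j) * t)"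
      using l by (simp add: of_nat_diff)
  qed auto
  finally have "4 ^ j * x ^ j = real ((2 * j) choose j) + (\<Sum>i=1..j. 2 * real ((2 * j) choose (j - i)) * cos (real i * t))"
    unfolding 1 by (simp add: sum_distrib_left mult.assoc)
  then have "x ^ j = s0 j + (\<Sum>i=1..j. 2 * real ((2 * j) choose (j - i)) * cos (real i * t)) / 4 ^ j"
    by (simp add: s0_def field_simps)
  also have "(\<Sum>i=1..j. 2 * real ((2 * j) choose (j - i)) * cos (real i * t)) / 4 ^ j =
     (\<Sum>i=1..j. amat j i / 2 * chebT i x)"
    unfolding sum_divide_distrib
  proof (intro sum.cong refl)
    fix i assume i: "i \<in> {1..j}"
    then obtain j' where "j = Suc j'" by (cases j) auto
    then show "2 * real ((2 * j) choose (j - i)) * cos (real i * t) / 4 ^ j = amat j i / 2 * chebT i x"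
      using i by (simp add: amat_def chebT_def t_def power_one_over field_simps)
  qed
  finally show ?thesis .
qed

section \<open>Positive Toeplitz forms as discrete matrix measures\<close>

lemma linear_dependence:
  fixes y :: "'r \<Rightarrow> 'i \<Rightarrow> real"
  assumes "finite I" "finite R" "card I < card R"
  shows "\<exists>c. (\<exists>r\<in>R. c r \<noteq> 0) \<and> (\<forall>i\<in>I. (\<Sum>r\<in>R. c r * y r i) = 0)"
  using assms
proof (induction I arbitrary: R y rule: finite_induct)
  case empty
  then have "R \<noteq> {}" by auto
  then show ?case by (intro exI[of _ "\<lambda>_. 1"]) auto
next
  case (insert i I)
  show ?case
  proof (cases "\<forall>r\<in>R. y r i = 0")
    case True
    have "card I < card R" using insert by simp
    from insert.IH[OF insert.prems(1) this, of y] show ?thesis using True by auto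
  next
    case False
    then obtain r0 where r0: "r0 \<in> R" "y r0 i \<noteq> 0" by auto
    define y' where "y' r l = y r l - y r i / y r0 i * y r0 l" for r l
    have "card I < card (R - {r0})" using insert r0 by simp
    from insert.IH[OF _ this, of y'] obtain c where c: "\<exists>r\<in>R - {r0}. c r \<noteq> 0"
      "\<And>l. l \<in> I \<Longrightarrow> (\<Sum>r\<in>R - {r0}. c r * y' r l) = 0"
      using insert.prems by auto
    define d where "d r = (if r = r0 then - (\<Sum>r\<in>R - {r0}. c r * y r i) / y r0 i else c r)" for r
    have ds: "(\<Sum>r\<in>R. d r * y r l) = d r0 * y r0 l + (\<Sum>r\<in>R - {r0}. c r * y r l)" for l
      using insert.prems r0 by (subst sum.remove[of _ r0]) (auto simp: d_def intro!: sum.cong)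
    have "(\<Sum>r\<in>R. d r * y r i) = 0" unfolding ds using r0 by (simp add: d_def)
    moreover have "(\<Sum>r\<in>R. d r * y r l) = 0" if "l \<in> I" for l
    proof -
      have "(\<Sum>r\<in>R - {r0}. c r * y' r l) = (\<Sum>r\<in>R - {r0}. c r * y r l) - (\<Sum>r\<in>R - {r0}. c r * y r i) / y r0 i * y r0 l"
        by (simp add: y'_def right_diff_distrib sum_subtractf sum_distrib_right sum_divide_distrib mult.assoc)
      then show ?thesis unfolding ds using c(2)[OF that] by (simp add: d_def)
    qed
    moreover have "\<exists>r\<in>R. d r \<noteq> 0" using c(1) by (auto simp: d_def)
    ultimately show ?thesis by auto
  qed
qed

text \<open>While more than \<open>card I\<close> weights are nonzero, a multiple of a linear
  dependence can be subtracted until one of them vanishes. The bound counts conditions and not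
  vectors, so it stays fixed when the grid of atoms is refined.\<close>

lemma caratheodory_cone:
  fixes y :: "'r \<Rightarrow> 'i \<Rightarrow> real" and t :: "'r \<Rightarrow> real"
  assumes I: "finite I" and R: "finite R" and t: "\<And>r. r \<in> R \<Longrightarrow> 0 \<le> t r"
  shows "\<exists>t'. (\<forall>r\<in>R. 0 \<le> t' r) \<and> card {r \<in> R. t' r \<noteq> 0} \<le> card I \<and>
     (\<forall>i\<in>I. (\<Sum>r\<in>R. t' r * y r i) = (\<Sum>r\<in>R. t r * y r i))"
  using t
proof (induction "card {r \<in> R. t r \<noteq> 0}" arbitrary: t rule: less_induct)
  case less
  define S where "S = {r \<in> R. t r \<noteq> 0}"
  show ?case
  proof (cases "card S \<le> card I")
    case True
    then show ?thesis using less.prems by (intro exI[of _ t]) (auto simp: S_def)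
  next
    case False
    have S: "finite S" "S \<subseteq> R" using R by (auto simp: S_def)
    obtain c0 where c0: "\<exists>r\<in>S. c0 r \<noteq> 0" "\<And>i. i \<in> I \<Longrightarrow> (\<Sum>r\<in>S. c0 r * y r i) = 0"
      using linear_dependence[OF I S(1), of y] False by auto
    obtain c where c: "\<exists>r\<in>S. c r > 0" "\<And>i. i \<in> I \<Longrightarrow> (\<Sum>r\<in>S. c r * y r i) = 0"
    proof (cases "\<exists>r\<in>S. c0 r > 0")
      case True
      then show ?thesis using c0 that by blast
    next
      case False
      then have "\<exists>r\<in>S. - c0 r > 0" using c0(1) by (metis linorder_neqE_linordered_idom neg_0_less_iff_less)
      moreover have "(\<Sum>r\<in>S. - c0 r * y r i) = 0" if "i \<in> I" for i using c0(2)[OF that] by (simp add: sum_negf)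
      ultimately show ?thesis using that[of "\<lambda>r. - c0 r"] by blast
    qed
    \<comment> \<open>The largest multiple of \<open>c\<close> whose subtraction keeps all weights
      nonnegative; the weight where the minimum is attained becomes 0.\<close>
    define \<alpha> where "\<alpha> = Min ((\<lambda>r. t r / c r) ` {r \<in> S. c r > 0})"
    have fin: "finite ((\<lambda>r. t r / c r) ` {r \<in> S. c r > 0})" and ne: "(\<lambda>r. t r / c r) ` {r \<in> S. c r > 0} \<noteq> {}"
      using S(1) c(1) by auto
    obtain r0 where r0: "r0 \<in> S" "c r0 > 0" "\<alpha> = t r0 / c r0"
      using Min_in[OF fin ne] unfolding \<alpha>_def by auto
    have \<alpha>le: "\<alpha> \<le> t r / c r" if "r \<in> S" "c r > 0" for r
      unfolding \<alpha>_def using that fin by (intro Min_le) auto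
    have tS: "0 < t r" if "r \<in> S" for r using that less.prems by (force simp: S_def less_le)
    have \<alpha>0: "0 \<le> \<alpha>" using r0 tS[of r0] by simp
    define t1 where "t1 r = (if r \<in> S then t r - \<alpha> * c r else 0)" for r
    have t1: "0 \<le> t1 r" for r
    proof (cases "r \<in> S \<and> c r > 0")
      case True
      then show ?thesis using \<alpha>le[of r] by (simp add: t1_def field_simps)
    next
      case False
      then have "r \<in> S \<Longrightarrow> \<alpha> * c r \<le> 0" using \<alpha>0 by (simp add: mult_nonneg_nonpos)
      then show ?thesis using tS[of r] by (auto simp: t1_def)
    qed
    have "{r \<in> R. t1 r \<noteq> 0} \<subseteq> S - {r0}" using r0 by (auto simp: t1_def)
    then have "card {r \<in> R. t1 r \<noteq> 0} < card S"
      using S(1) r0(1) by (meson card_Diff1_less card_mono finite_Diff order_le_less_trans)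
    then obtain t' where t': "\<forall>r\<in>R. 0 \<le> t' r" "card {r \<in> R. t' r \<noteq> 0} \<le> card I"
      "\<And>i. i \<in> I \<Longrightarrow> (\<Sum>r\<in>R. t' r * y r i) = (\<Sum>r\<in>R. t1 r * y r i)"
      using less.hyps[of t1] t1 unfolding S_def by blast
    have "(\<Sum>r\<in>R. t1 r * y r i) = (\<Sum>r\<in>R. t r * y r i)" if "i \<in> I" for i
    proof -
      have "(\<Sum>r\<in>R. t1 r * y r i) = (\<Sum>r\<in>S. (t r - \<alpha> * c r) * y r i)"
        using R S by (intro sum.mono_neutral_cong_right) (auto simp: t1_def)
      also have "\<dots> = (\<Sum>r\<in>S. t r * y r i) - \<alpha> * (\<Sum>r\<in>S. c r * y r i)"
        by (simp add: left_diff_distrib sum_subtractf sum_distrib_left mult.assoc)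
      also have "\<dots> = (\<Sum>r\<in>S. t r * y r i)" using c(2)[OF that] by simp
      also have "\<dots> = (\<Sum>r\<in>R. t r * y r i)"
        using R S by (intro sum.mono_neutral_left) (auto simp: S_def)
      finally show ?thesis .
    qed
    then show ?thesis using t' by (intro exI[of _ t']) simp
  qed
qed

lemma convergent_subsequence_finite:
  fixes z :: "'j \<Rightarrow> nat \<Rightarrow> 'a::heine_borel"
  assumes "finite J" "\<And>j. j \<in> J \<Longrightarrow> bounded (range (z j))"
  shows "\<exists>\<sigma> l. strict_mono (\<sigma> :: nat \<Rightarrow> nat) \<and> (\<forall>j\<in>J. (z j \<circ> \<sigma>) \<longlonglongrightarrow> l j)"
  using assms
proof (induction J rule: finite_induct)
  case empty
  then show ?case by (intro exI[of _ id]) (auto simp: strict_mono_id)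
next
  case (insert i J)
  have "\<exists>\<sigma> l. strict_mono (\<sigma> :: nat \<Rightarrow> nat) \<and> (\<forall>j\<in>J. (z j \<circ> \<sigma>) \<longlonglongrightarrow> l j)"
    by (rule insert.IH) (use insert.prems in auto)
  then obtain \<sigma> l where \<sigma>: "strict_mono (\<sigma> :: nat \<Rightarrow> nat)" "\<forall>j\<in>J. (z j \<circ> \<sigma>) \<longlonglongrightarrow> l j" by blast
  have "bounded (range (z i \<circ> \<sigma>))"
    using insert.prems[of i] by (rule bounded_subset) auto
  then obtain l' \<tau> where \<tau>: "strict_mono \<tau>" "((z i \<circ> \<sigma>) \<circ> \<tau>) \<longlonglongrightarrow> l'"
    using bounded_imp_convergent_subsequence by blast
  have "(z j \<circ> (\<sigma> \<circ> \<tau>)) \<longlonglongrightarrow> (l(i := l')) j" if "j \<in> insert i J" for j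
  proof (cases "j = i")
    case True
    then show ?thesis using \<tau>(2) by (simp add: comp_assoc)
  next
    case False
    then have "((z j \<circ> \<sigma>) \<circ> \<tau>) \<longlonglongrightarrow> l j"
      using LIMSEQ_subseq_LIMSEQ[of "z j \<circ> \<sigma>" "l j" \<tau>] \<sigma>(2) \<tau>(1) that by auto
    then show ?thesis using False by (simp add: comp_assoc)
  qed
  then show ?case using strict_mono_o[OF \<sigma>(1) \<tau>(1)] by blast
qed

text \<open>Real part of a geometric sum of M-th roots of unity; |m| < M ensures that the ratio is
  not 1 unless m = 0.\<close>

lemma sum_cos_grid:
  fixes m :: int
  assumes "\<bar>m\<bar> < int M"
  shows "(\<Sum>r<M. cos (real_of_int m * (2 * pi * real r / real M))) = (if m = 0 then real M else 0)"
proof (cases "m = 0")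
  case False
  have M: "M > 0" using assms by auto
  define z where "z = cis (2 * pi * real_of_int m / real M)"
  have "z \<noteq> 1"
  proof
    assume "z = 1"
    then have "cos (2 * pi * real_of_int m / real M) = 1" by (simp add: z_def complex_eq_iff)
    then obtain l :: int where "2 * pi * real_of_int m / real M = of_int l * 2 * pi"
      using cos_one_2pi_int by blast
    then have "real_of_int m = of_int (l * int M)" using M by (simp add: field_simps)
    then have "m = l * int M" by (simp only: of_int_eq_iff)
    then have "\<bar>l\<bar> * int M < 1 * int M" using assms by (simp add: abs_mult)
    then have "l = 0" using M by (simp only: mult_less_cancel_right) auto
    then show False using \<open>m = l * int M\<close> False by simp
  qed
  have "z ^ M = cis (real M * (2 * pi * real_of_int m / real M))" by (simp add: z_def Complex.DeMoivre)
  also have "real M * (2 * pi * real_of_int m / real M) = 2 * pi * real_of_int m" using M by simp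
  also have "cis (2 * pi * real_of_int m) = 1" by (rule cis_multiple_2pi) simp
  finally have "(\<Sum>r<M. z ^ r) = 0" using geometric_sum[OF \<open>z \<noteq> 1\<close>, of M] by simp
  moreover have "Re (z ^ r) = cos (real_of_int m * (2 * pi * real r / real M))" for r
    by (simp add: z_def Complex.DeMoivre field_simps)
  ultimately have "(\<Sum>r<M. cos (real_of_int m * (2 * pi * real r / real M))) = Re 0"
    by (metis (no_types, lifting) Re_sum sum.cong)
  then show ?thesis using False by simp
qed simp

context cmats
begin

section \<open>Discrete matrix measures with boundedly many atoms\<close>

lemma herm_sum [intro]: "(\<And>i. i \<in> I \<Longrightarrow> herm (f i)) \<Longrightarrow> herm (\<Sum>i\<in>I. f i)"
  unfolding herm_def by (auto simp: adj_sum)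

lemma qf_sum: "qf (\<Sum>i\<in>I. f i) v = (\<Sum>i\<in>I. qf (f i) v)"
proof -
  have "qf (\<Sum>i\<in>I. f i) v = (\<Sum>a<p. \<Sum>b<p. \<Sum>i\<in>I. cnj (v a) * f i a b * v b)"
    by (simp add: qf_def sum_fun_apply sum_distrib_left sum_distrib_right)
  also have "\<dots> = (\<Sum>a<p. \<Sum>i\<in>I. \<Sum>b<p. cnj (v a) * f i a b * v b)"
    by (intro sum.cong refl sum.swap)
  also have "\<dots> = (\<Sum>i\<in>I. qf (f i) v)" unfolding qf_def by (rule sum.swap)
  finally show ?thesis .
qed

lemma qf_csc: "qf (csc t X) v = of_real t * qf X v"
  by (simp add: qf_def csc_def sum_distrib_left mult_ac)

lemma psd_csc: "psd X \<Longrightarrow> 0 \<le> t \<Longrightarrow> psd (csc t X)"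
  by (auto simp: psd_def herm_csc qf_csc)

text \<open>The form at e_a + s e_b for s = 0, 1, -1, i, -i is nonnegative, which bounds the entry
  by the diagonal.\<close>

lemma psd_entry_bound:
  assumes X: "psd X" and ab: "a < p" "b < p"
  shows "0 \<le> Re (X a a)" and "cmod (X a b) \<le> Re (X a a) + Re (X b b)"
proof -
  have q: "qf X (\<lambda>i. (if i = a then 1 else 0) + s * (if i = b then 1 else 0)) =
      X a a + cnj s * s * X b b + s * X a b + cnj s * X b a" for s
  proof -
    let ?e = "\<lambda>i. (if i = a then 1 else 0) + s * (if i = b then 1 else 0)"
    have r: "(\<Sum>j<p. Y j * ?e j) = Y a + Y b * s" for Y
    proof -
      have "Y j * ?e j = (if j = a then Y j else 0) + (if j = b then Y j * s else 0)" for j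
        by (simp add: distrib_left)
      then show ?thesis using ab by (simp add: sum.distrib)
    qed
    have l: "(\<Sum>i<p. cnj (?e i) * Y i) = Y a + Y b * cnj s" for Y
      using arg_cong[OF r[of "\<lambda>i. cnj (Y i)"], of cnj] by (simp add: mult.commute)
    have "qf X ?e = (\<Sum>i<p. cnj (?e i) * (\<Sum>j<p. X i j * ?e j))"
      by (simp add: qf_def sum_distrib_left mult.assoc)
    then show ?thesis unfolding r l by (simp add: algebra_simps)
  qed
  have h: "X b a = cnj (X a b)" using X unfolding psd_def herm_def adj_def by metis
  have pos: "0 \<le> Re (X a a + cnj s * s * X b b + s * X a b + cnj s * X b a)" for s
    using X unfolding psd_def q[symmetric] by blast
  show "0 \<le> Re (X a a)" using pos[of 0] by simp
  have "2 * \<bar>Re (X a b)\<bar> \<le> Re (X a a) + Re (X b b)" "2 * \<bar>Im (X a b)\<bar> \<le> Re (X a a) + Re (X b b)"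
    using pos[of 1] pos[of "- 1"] pos[of \<i>] pos[of "- \<i>"] by (auto simp: h)
  then show "cmod (X a b) \<le> Re (X a a) + Re (X b b)"
    using cmod_le[of "X a b"] by linarith
qed

text \<open>A matrix measure with atoms \<open>y r\<close> = cos t in [-1, 1] and weights
  \<open>W r\<close> of total mass \<open>one\<close>, whose Chebyshev moments are the
  \<open>C j\<close>; \<open>arccos\<close> recovers the angle.\<close>

definition repS :: "nat set \<Rightarrow> (nat \<Rightarrow> real) \<Rightarrow> (nat \<Rightarrow> cmx) \<Rightarrow> nat \<Rightarrow> (nat \<Rightarrow> cmx) \<Rightarrow> bool" where
  "repS R y W n C \<longleftrightarrow> finite R \<and> (\<forall>r\<in>R. y r \<in> {-1..1} \<and> psd (W r)) \<and> (\<Sum>r\<in>R. W r) = one \<and>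
     (\<forall>j\<in>{1..n}. C j = (\<Sum>r\<in>R. csc (cos (real j * arccos (y r))) (W r)))"

definition rep :: "nat \<Rightarrow> nat \<Rightarrow> (nat \<Rightarrow> cmx) \<Rightarrow> bool" where
  "rep K n C \<longleftrightarrow> (\<exists>y W. repS {..<K} y W n C)"

text \<open>The number of real linear conditions to preserve: orders 0 to n, matrix positions, real
  and imaginary part.\<close>

definition natoms :: "nat \<Rightarrow> nat" where
  "natoms n = card ({0..n} \<times> ibox p \<times> (UNIV :: bool set))"

text \<open>Caratheodory's theorem rescales the weights \<open>W r\<close> by nonnegative numbers
  \<open>t r\<close>. Order 0 among the conditions preserves the total mass \<open>one\<close>, and
  spare slots are filled with atoms of weight 0.\<close>

lemma repS_reduce:
  assumes "repS R y W n C"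
  shows "rep (natoms n) n C"
proof -
  let ?I = "{0..n} \<times> ibox p \<times> (UNIV :: bool set)"
  have R: "finite R" and y: "\<And>r. r \<in> R \<Longrightarrow> y r \<in> {-1..1}" and W: "\<And>r. r \<in> R \<Longrightarrow> psd (W r)" and W1: "(\<Sum>r\<in>R. W r) = one"
    and C: "\<And>j. j \<in> {1..n} \<Longrightarrow> C j = (\<Sum>r\<in>R. csc (cos (real j * arccos (y r))) (W r))"
    using assms by (auto simp: repS_def)
  define Y where "Y r i = (case i of (j, (a, b), s) \<Rightarrow>
    cos (real j * arccos (y r)) * (if s then Re (W r a b) else Im (W r a b)))" for r and i :: "nat \<times> (nat \<times> nat) \<times> bool"
  have "\<exists>t. (\<forall>r\<in>R. 0 \<le> t r) \<and> card {r \<in> R. t r \<noteq> 0} \<le> card ?I \<and>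
     (\<forall>i\<in>?I. (\<Sum>r\<in>R. t r * Y r i) = (\<Sum>r\<in>R. 1 * Y r i))"
    by (rule caratheodory_cone) (use R in auto)
  then obtain t where t: "\<And>r. r \<in> R \<Longrightarrow> 0 \<le> t r" "card {r \<in> R. t r \<noteq> 0} \<le> card ?I"
     "\<And>i. i \<in> ?I \<Longrightarrow> (\<Sum>r\<in>R. t r * Y r i) = (\<Sum>r\<in>R. 1 * Y r i)"
    by blast
  define S where "S = {r \<in> R. t r \<noteq> 0}"
  have S: "finite S" "S \<subseteq> R" "card S \<le> natoms n" using R t(2) by (auto simp: S_def natoms_def)
  have mom: "(\<Sum>r\<in>S. csc (cos (real j * arccos (y r))) (csc (t r) (W r))) = (\<Sum>r\<in>R. csc (cos (real j * arccos (y r))) (W r))"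
    if j: "j \<le> n" for j
  proof (intro ext)
    fix a b
    let ?c = "\<lambda>r. cos (real j * arccos (y r))"
    have SR: "(\<Sum>r\<in>S. csc (?c r) (csc (t r) (W r))) a b = (\<Sum>r\<in>R. of_real (t r) * (of_real (?c r) * W r a b))"
      unfolding sum_fun_apply using R S by (intro sum.mono_neutral_cong_left) (auto simp: S_def csc_def)
    show "(\<Sum>r\<in>S. csc (?c r) (csc (t r) (W r))) a b = (\<Sum>r\<in>R. csc (?c r) (W r)) a b"
    proof (cases "a < p \<and> b < p")
      case True
      then have "(j, (a, b), s) \<in> ?I" for s using j by (auto simp: ibox_def)
      from t(3)[OF this[of True]] t(3)[OF this[of False]] show ?thesis
        unfolding SR unfolding sum_fun_apply csc_def complex_eq_iff by (simp add: Y_def)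
    next
      case False
      then have "W r a b = 0" if "r \<in> R" for r
        using W[OF that] unfolding psd_def herm_def supp_def by blast
      then show ?thesis unfolding SR unfolding sum_fun_apply csc_def by simp
    qed
  qed
  obtain f where f: "bij_betw f {..<card S} S"
    using ex_bij_betw_nat_finite[OF S(1)] by (auto simp: lessThan_atLeast0)
  have fS: "f i \<in> S" if "i < card S" for i using f that by (auto simp: bij_betw_def)
  define y' where "y' i = (if i < card S then y (f i) else 0)" for i
  define W' where "W' i = (if i < card S then csc (t (f i)) (W (f i)) else 0)" for i
  have sumS: "(\<Sum>i<natoms n. csc (cos (real j * arccos (y' i))) (W' i)) = (\<Sum>r\<in>S. csc (cos (real j * arccos (y r))) (csc (t r) (W r)))" for j
  proof -
    have "(\<Sum>i<natoms n. csc (cos (real j * arccos (y' i))) (W' i)) =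
       (\<Sum>i<card S. csc (cos (real j * arccos (y (f i)))) (csc (t (f i)) (W (f i))))"
      using S(3) by (intro sum.mono_neutral_cong_right) (auto simp: y'_def W'_def csc_def fun_eq_iff)
    also have "\<dots> = (\<Sum>r\<in>S. csc (cos (real j * arccos (y r))) (csc (t r) (W r)))"
      using sum.reindex_bij_betw[OF f] .
    finally show ?thesis .
  qed
  have c1: "csc 1 X = X" for X by (simp add: csc_def)
  have "repS {..<natoms n} y' W' n C"
    unfolding repS_def
  proof (intro conjI ballI)
    fix i assume "i \<in> {..<natoms n}"
    show "y' i \<in> {-1..1}" using y fS[of i] S(2) by (auto simp: y'_def)
    show "psd (W' i)"
      using W t(1) fS[of i] S(2) by (auto simp: W'_def psd_csc) (simp add: psd_def qf_def)
  next
    show "(\<Sum>i<natoms n. W' i) = one"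
      using sumS[of 0] mom[of 0] W1 by (simp add: c1)
  next
    fix j assume "j \<in> {1..n}"
    then show "C j = (\<Sum>i<natoms n. csc (cos (real j * arccos (y' i))) (W' i))"
      using C[of j] mom[of j] sumS[of j] by simp
  qed simp
  then show ?thesis unfolding rep_def by blast
qed

lemma herm_limit:
  assumes X: "mlim X Y" and p: "\<And>n. herm (X n)"
  shows "herm Y"
proof -
  have 0: "X n i j = 0" if "\<not> (i < p \<and> j < p)" for n i j
    using p[of n] that unfolding herm_def supp_def by blast
  have 1: "X n i j = cnj (X n j i)" for n i j
    using p[of n] unfolding herm_def adj_def by metis
  have "supp Y"
    unfolding supp_def
  proof (intro allI impI)
    fix i j assume "Y i j \<noteq> 0"
    show "i < p \<and> j < p"
    proof (rule ccontr)
      assume n: "\<not> (i < p \<and> j < p)"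
      have "(\<lambda>n. X n i j) \<longlonglongrightarrow> Y i j" by (rule mlimD[OF X])
      then have "(\<lambda>n. 0) \<longlonglongrightarrow> Y i j" by (simp add: 0[OF n])
      then show False using \<open>Y i j \<noteq> 0\<close> LIMSEQ_const_iff by metis
    qed
  qed
  moreover have "adj Y = Y"
  proof (intro ext)
    fix i j
    have "(\<lambda>n. cnj (X n j i)) \<longlonglongrightarrow> cnj (Y j i)" by (intro tendsto_cnj mlimD[OF X])
    then have "(\<lambda>n. X n i j) \<longlonglongrightarrow> cnj (Y j i)" unfolding 1[symmetric] .
    then show "adj Y i j = Y i j" using LIMSEQ_unique[OF _ mlimD[OF X, of i j]] by (simp add: adj_def)
  qed
  ultimately show "herm Y" by (simp add: herm_def)
qed

lemma psd_limit:
  assumes X: "mlim X Y" and p: "\<And>n. psd (X n)"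
  shows "psd Y"
  unfolding psd_def
proof (intro conjI allI)
  show "herm Y" by (rule herm_limit[OF X]) (use p in \<open>auto simp: psd_def\<close>)
  fix v
  have "(\<lambda>n. Re (qf (X n) v)) \<longlonglongrightarrow> Re (qf Y v)"
    unfolding qf_def by (intro tendsto_intros mlimD[OF X])
  then show "0 \<le> Re (qf Y v)"
    by (rule LIMSEQ_le_const) (use p in \<open>auto simp: psd_def\<close>)
qed

text \<open>With the number of atoms fixed, the positions lie in [-1, 1], and the weights, being
  semidefinite with sum \<open>one\<close>, have entries of modulus at most 2. A common subsequence
  converges and all conditions are closed.\<close>

lemma rep_limit:
  assumes r: "\<And>m. rep K n (C m)" and lim: "\<And>j. j \<in> {1..n} \<Longrightarrow> mlim (\<lambda>m. C m j) (D j)"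
  shows "rep K n D"
proof -
  obtain y W where yW: "\<And>m. repS {..<K} (y m) (W m) n (C m)"
    using r unfolding rep_def by metis
  have y: "y m r \<in> {-1..1}" and W: "psd (W m r)" if "r < K" for m r
    using yW[of m] that by (auto simp: repS_def)
  have W1: "(\<Sum>r<K. W m r) = one" for m using yW[of m] by (auto simp: repS_def)
  have Wbd: "cmod (W m r a b) \<le> 2" if "r < K" "a < p" "b < p" for m r a b
  proof -
    have d: "Re (W m r a a) \<le> 1" if "r < K" "a < p" for r a
    proof -
      have "Re (W m r a a) \<le> (\<Sum>r<K. Re (W m r a a))"
        using that psd_entry_bound(1)[OF W] by (intro member_le_sum) auto
      also have "\<dots> = Re ((\<Sum>r<K. W m r) a a)" by (simp add: sum_fun_apply)
      also have "\<dots> = 1" using that by (simp add: W1 one_def)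
      finally show ?thesis .
    qed
    show ?thesis using psd_entry_bound(2)[OF W[OF that(1), of m] that(2,3)] d[OF that(1,2)] d[OF that(1,3)] by linarith
  qed
  \<comment> \<open>Positions (\<open>None\<close>) and weight entries (\<open>Some\<close>) are put
    into one finite family, so that a single subsequence serves for all of them.\<close>
  define z where "z i m = (case i of (r, None) \<Rightarrow> complex_of_real (y m r) | (r, Some (a, b)) \<Rightarrow> W m r a b)" for i and m :: nat
  let ?J = "{..<K} \<times> insert None (Some ` ibox p)"
  have "bounded (range (z i))" if "i \<in> ?J" for i
    unfolding bounded_iff
  proof (intro exI[of _ 2] ballI)
    fix x assume "x \<in> range (z i)"
    then obtain m where "x = z i m" by auto
    then show "norm x \<le> 2" using that y Wbd by (auto simp: z_def ibox_def abs_le_iff) (smt (verit))+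
  qed
  then have "\<exists>\<sigma> l. strict_mono (\<sigma> :: nat \<Rightarrow> nat) \<and> (\<forall>i\<in>?J. (z i \<circ> \<sigma>) \<longlonglongrightarrow> l i)"
    by (intro convergent_subsequence_finite) auto
  then obtain \<sigma> l where \<sigma>: "strict_mono (\<sigma> :: nat \<Rightarrow> nat)" and l: "\<And>i. i \<in> ?J \<Longrightarrow> (z i \<circ> \<sigma>) \<longlonglongrightarrow> l i"
    by blast
  define y' where "y' r = Re (l (r, None))" for r
  define W' where "W' r a b = (if a < p \<and> b < p then l (r, Some (a, b)) else 0)" for r a b
  have y': "(\<lambda>m. y (\<sigma> m) r) \<longlonglongrightarrow> y' r" if "r < K" for r
    using tendsto_Re[OF l[of "(r, None)"]] that by (simp add: z_def y'_def comp_def)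
  have W': "mlim (\<lambda>m. W (\<sigma> m) r) (W' r)" if "r < K" for r
    unfolding mlim_def
  proof (intro allI)
    fix a b
    show "(\<lambda>m. W (\<sigma> m) r a b) \<longlonglongrightarrow> W' r a b"
    proof (cases "a < p \<and> b < p")
      case True
      then show ?thesis using l[of "(r, Some (a, b))"] that by (simp add: z_def W'_def comp_def ibox_def)
    next
      case False
      then have "W m r a b = 0" for m using W[OF that, of m] unfolding psd_def herm_def supp_def by blast
      then show ?thesis using False by (auto simp: W'_def)
    qed
  qed
  have y'r: "y' r \<in> {-1..1}" if "r < K" for r
    by (rule closed_sequentially[OF _ _ y'[OF that]]) (use y[OF that] in auto)
  have cl: "mlim (\<lambda>m. \<Sum>r<K. csc (cos (real j * arccos (y (\<sigma> m) r))) (W (\<sigma> m) r)) (\<Sum>r<K. csc (cos (real j * arccos (y' r))) (W' r))" for j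
  proof (rule mlim_sum)
    fix r assume "r \<in> {..<K}"
    then have r: "r < K" by simp
    have "continuous_on {-1..1} (\<lambda>x. cos (real j * arccos x))" by (intro continuous_intros) auto
    then have "(\<lambda>m. cos (real j * arccos (y (\<sigma> m) r))) \<longlonglongrightarrow> cos (real j * arccos (y' r))"
      using y'[OF r] y'r[OF r] y[OF r] by (auto elim!: continuous_on_tendsto_compose)
    then show "mlim (\<lambda>m. csc (cos (real j * arccos (y (\<sigma> m) r))) (W (\<sigma> m) r)) (csc (cos (real j * arccos (y' r))) (W' r))"
      unfolding mlim_def csc_def by (auto intro!: tendsto_intros mlimD[OF W'[OF r]])
  qed
  have uniq: "X = Y" if "mlim Z X" "mlim Z Y" for X Y Z
    using that LIMSEQ_unique unfolding mlim_def by blast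
  have c1: "csc 1 X = X" for X by (simp add: csc_def)
  have "repS {..<K} y' W' n D"
    unfolding repS_def
  proof (intro conjI ballI)
    fix r assume "r \<in> {..<K}"
    then show "y' r \<in> {-1..1}" "psd (W' r)" using y'r psd_limit[OF W' W] by auto
  next
    show "(\<Sum>r<K. W' r) = one"
      using uniq[OF cl[of 0]] W1 mlim_const[of one] by (simp add: c1)
  next
    fix j assume j: "j \<in> {1..n}"
    have "C m j = (\<Sum>r<K. csc (cos (real j * arccos (y m r))) (W m r))" for m
      using yW[of m] j by (auto simp: repS_def)
    moreover have "mlim (\<lambda>m. C (\<sigma> m) j) (D j)"
      using lim[OF j] LIMSEQ_subseq_LIMSEQ[OF _ \<sigma>] unfolding mlim_def by (auto simp: comp_def)
    ultimately show "D j = (\<Sum>r<K. csc (cos (real j * arccos (y' r))) (W' r))"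
      using uniq[OF _ cl[of j]] by simp
  qed simp
  then show ?thesis unfolding rep_def by blast
qed

text \<open>The Fejer kernel turns a positive Toeplitz form of size \<open>N\<close> into a discrete matrix measure
  on the circle whose \<open>j\<close>-th moment is \<open>(1 - j / N) C\<^sub>j\<close>.\<close>

lemma fejer_rep:
  assumes C: "htup C" and T: "tpsd N' C" and n: "n < N" and N: "N = Suc N'"
  shows "rep (natoms n) n (\<lambda>j. csc (1 - real j / real N) (C j))"
proof -
  \<comment> \<open>The frequencies j + a - b and j - (a - b) with j \<le> n and a, b < N are below
    N + n in modulus, so the grid of M angles sums them without aliasing.\<close>
  define M where "M = N + n"
  have M: "M > 0" using N by (simp add: M_def)
  define \<theta> where "\<theta> r = 2 * pi * real r / real M" for r
  \<comment> \<open>The mean of the Toeplitz form along the diagonals: N - j index pairs have a - b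
    = j, which is the origin of the factor 1 - j / N.\<close>
  define W where "W r = csc (1 / (real M * real N)) (\<Sum>a<N. \<Sum>b<N. csc (cos (real_of_int (int a - int b) * \<theta> r)) (C (dd a b)))" for r
  have W: "psd (W r)" for r
    unfolding W_def
  proof (rule psd_csc)
    let ?S = "\<Sum>a<N. \<Sum>b<N. csc (cos (real_of_int (int a - int b) * \<theta> r)) (C (dd a b))"
    show "psd ?S"
      unfolding psd_def
    proof (intro conjI allI)
      show "herm ?S" using C by (intro herm_sum herm_csc) (auto simp: htupD)
      fix v
      define V :: cmx where "V = (\<lambda>i l. if i < p then v i else 0)"
      have V: "rsupp V" by (simp add: rsupp_def mm_one_left V_def fun_eq_iff)
      have qV: "qf X (\<lambda>i. V i 0) = qf X v" for X
        unfolding qf_def V_def by (intro sum.cong refl) auto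
      \<comment> \<open>Cosine and sine parts of the test family exp (i a t) V at the angle t; their
        forms add up to the one with cos ((a - b) t).\<close>
      define u1 where "u1 a = csc (cos (real a * \<theta> r)) V" for a
      define u2 where "u2 a = csc (sin (real a * \<theta> r)) V" for a
      have u: "rsupp (u1 a)" "rsupp (u2 a)" for a
        using V by (simp_all add: u1_def u2_def rsupp_def csc_mm)
      have adj_csc: "adj (csc t X) = csc t (adj X)" for t X by (auto simp: csc_def adj_def fun_eq_iff)
      have cs: "csc s X + csc t X = csc (s + t) X" for s t X by (simp add: csc_def fun_eq_iff algebra_simps)
      have cc: "csc s (csc t X) = csc (s * t) X" for s t X by (simp add: csc_def fun_eq_iff mult.assoc)
      have NN: "{..<N} = {..N'}" using N by auto
      have "TF N' C u1 u1 + TF N' C u2 u2 = (\<Sum>a\<le>N'. \<Sum>b\<le>N'.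
          csc (cos (real a * \<theta> r) * cos (real b * \<theta> r) + sin (real a * \<theta> r) * sin (real b * \<theta> r)) (adj V \<diamondop> C (dd a b) \<diamondop> V))"
        unfolding TF_def sum.distrib[symmetric] u1_def u2_def adj_csc csc_mm cc cs by (simp only: mult.commute)
      also have "\<dots> = (\<Sum>a<N. \<Sum>b<N. adj V \<diamondop> csc (cos (real_of_int (int a - int b) * \<theta> r)) (C (dd a b)) \<diamondop> V)"
        unfolding NN by (intro sum.cong refl) (simp add: csc_mm left_diff_distrib cos_diff)
      also have "\<dots> = adj V \<diamondop> ?S \<diamondop> V" by (simp only: mm_sum_left mm_sum_right)
      finally have **: "TF N' C u1 u1 + TF N' C u2 u2 = adj V \<diamondop> ?S \<diamondop> V" .
      have "qf ?S v = TF N' C u1 u1 0 0 + TF N' C u2 u2 0 0"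
        using fun_cong[OF fun_cong[OF **], of 0 0] unfolding qf_eq qV plus_fun_apply by (rule sym)
      then show "0 \<le> Re (qf ?S v)" using T u by (simp add: tpsd_def)
    qed
  qed (use M N in auto)
  have mom: "(\<Sum>r<M. csc (cos (real j * \<theta> r)) (W r)) = csc (1 - real j / real N) (C j)" if j: "j \<le> n" for j
  proof (intro ext)
    fix x y
    define S where "S d = (\<Sum>r<M. cos (real j * \<theta> r) * cos (real_of_int d * \<theta> r))" for d :: int
    have S: "S d = real M / 2 * ((if d = int j then 1 else 0) + (if d = - int j then 1 else 0))" if d: "\<bar>d\<bar> < int N" for d
    proof -
      have *: "cos (real j * \<theta> r) * cos (real_of_int d * \<theta> r) =
         (cos (real_of_int (int j - d) * \<theta> r) + cos (real_of_int (int j + d) * \<theta> r)) / 2" for r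
        by (simp add: left_diff_distrib distrib_right cos_add cos_diff)
      have "S d = ((\<Sum>r<M. cos (real_of_int (int j - d) * \<theta> r)) + (\<Sum>r<M. cos (real_of_int (int j + d) * \<theta> r))) / 2"
        unfolding S_def * by (simp only: sum_divide_distrib[symmetric] sum.distrib)
      also have "\<dots> = ((if int j - d = 0 then real M else 0) + (if int j + d = 0 then real M else 0)) / 2"
        unfolding \<theta>_def using d j by (subst (1 2) sum_cos_grid) (auto simp: M_def)
      finally show ?thesis by (auto simp: field_simps)
    qed
    have "(\<Sum>r<M. csc (cos (real j * \<theta> r)) (W r)) x y =
      (\<Sum>r<M. \<Sum>a<N. \<Sum>b<N. of_real (cos (real j * \<theta> r)) * (of_real (1 / (real M * real N)) * (of_real (cos (real_of_int (int a - int b) * \<theta> r)) * C (dd a b) x y)))"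
      by (simp add: sum_fun_apply csc_def W_def sum_distrib_left)
    also have "\<dots> = (\<Sum>a<N. \<Sum>b<N. \<Sum>r<M. of_real (cos (real j * \<theta> r)) * (of_real (1 / (real M * real N)) * (of_real (cos (real_of_int (int a - int b) * \<theta> r)) * C (dd a b) x y)))"
      by (rule trans[OF sum.swap], rule sum.cong[OF refl], rule sum.swap)
    also have "\<dots> = of_real (1 / (real M * real N)) * (\<Sum>a<N. \<Sum>b<N. of_real (S (int a - int b)) * C (dd a b) x y)"
    proof -
      have "(\<Sum>r<M. of_real (cos (real j * \<theta> r)) * (of_real (1 / (real M * real N)) * (of_real (cos (real_of_int d * \<theta> r)) * X))) =
          of_real (1 / (real M * real N)) * (of_real (S d) * X)" for d and X :: complex
      proof -
        have "(\<Sum>r<M. of_real (cos (real j * \<theta> r)) * (of_real (1 / (real M * real N)) * (of_real (cos (real_of_int d * \<theta> r)) * X))) =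
          (\<Sum>r<M. of_real (1 / (real M * real N)) * X * of_real (cos (real j * \<theta> r) * cos (real_of_int d * \<theta> r)))"
          by (intro sum.cong refl) (simp only: of_real_mult mult_ac)
        also have "\<dots> = of_real (1 / (real M * real N)) * X * of_real (S d)"
          by (simp only: S_def of_real_sum sum_distrib_left)
        finally show ?thesis by (simp only: mult_ac)
      qed
      then show ?thesis by (simp only: sum_distrib_left)
    qed
    also have "(\<Sum>a<N. \<Sum>b<N. of_real (S (int a - int b)) * C (dd a b) x y) =
      (\<Sum>a<N. \<Sum>b<N. of_real (real M / 2) * ((if a = b + j then C j x y else 0) + (if b = a + j then C j x y else 0)))"
    proof (intro sum.cong refl)
      fix a b assume "a \<in> {..<N}" "b \<in> {..<N}"
      then have "\<bar>int a - int b\<bar> < int N" by auto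
      moreover have "int a - int b = int j \<longleftrightarrow> a = b + j" "int a - int b = - int j \<longleftrightarrow> b = a + j" by auto
      moreover have "a = b + j \<Longrightarrow> dd a b = j" "b = a + j \<Longrightarrow> dd a b = j" by (auto simp: dd_def)
      ultimately show "of_real (S (int a - int b)) * C (dd a b) x y =
         of_real (real M / 2) * ((if a = b + j then C j x y else 0) + (if b = a + j then C j x y else 0))"
        by (auto simp: S)
    qed
    also have "\<dots> = of_real (real M / 2) * ((\<Sum>a<N. \<Sum>b<N. if a = b + j then C j x y else 0) + (\<Sum>a<N. \<Sum>b<N. if b = a + j then C j x y else 0))"
      by (simp only: sum_distrib_left sum.distrib distrib_left)
    also have "(\<Sum>a<N. \<Sum>b<N. if a = b + j then C j x y else 0) = (\<Sum>a<N. \<Sum>b<N. if b = a + j then C j x y else 0)"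
      by (rule sum.swap)
    also have "(\<Sum>a<N. \<Sum>b<N. if b = a + j then C j x y else 0) = (\<Sum>a<N. if a + j < N then C j x y else 0)"
      by (intro sum.cong refl) simp
    also have "\<dots> = (\<Sum>a<N - j. C j x y)"
      by (intro sum.mono_neutral_cong_right) auto
    also have "of_real (1 / (real M * real N)) * (of_real (real M / 2) * ((\<Sum>a<N - j. C j x y) + (\<Sum>a<N - j. C j x y))) =
       csc (1 - real j / real N) (C j) x y"
    proof -
      have alg: "1 / (zM * zN) * (zM / 2 * ((zN - zj) * c + (zN - zj) * c)) = (1 - zj / zN) * c"
        if "zM \<noteq> 0" "zN \<noteq> 0" for zM zN zj c :: complex
        using that by (simp add: field_simps)
      have "complex_of_nat M \<noteq> 0" "complex_of_nat N \<noteq> 0" using M N by (simp_all del: of_nat_Suc)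
      from alg[OF this, of "of_nat j" "C j x y"] show ?thesis
        using j n by (simp add: csc_def of_nat_diff)
    qed
    finally show "(\<Sum>r<M. csc (cos (real j * \<theta> r)) (W r)) x y = csc (1 - real j / real N) (C j) x y" .
  qed
  have c1: "csc 1 X = X" for X by (simp add: csc_def)
  have "repS {..<M} (\<lambda>r. cos (\<theta> r)) W n (\<lambda>j. csc (1 - real j / real N) (C j))"
    unfolding repS_def cos_arccos_cos
    using W mom mom[of 0] C by (auto simp: c1 htupD)
  then show ?thesis by (rule repS_reduce)
qed

text \<open>The Fejer factor tends to 1 only for growing N, so the form must be prolonged;
  prolongation requires positive definiteness, hence the prior dilation by \<open>t m\<close> < 1.
  The number of atoms stays \<open>natoms n\<close> throughout, so \<open>rep_limit\<close>
  applies.\<close>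

lemma tpsd_rep:
  assumes C: "htup C" and T: "tpsd n C"
  shows "rep (natoms n) n C"
proof (rule rep_limit)
  define t where "t m = 1 - 1 / real (Suc m)" for m
  define N where "N m = Suc (n + m)" for m
  have t: "0 \<le> t m" "t m < 1" for m by (auto simp: t_def)
  show "rep (natoms n) n (\<lambda>j. csc (1 - real j / real (N m)) (csc (t m) (C j)))" for m
  proof -
    have pos: "posdef (LP (tsc (t m) C) k)" if "k \<le> n" for k
      by (rule tpsd_tsc_posdef[OF C T t that])
    obtain C' where C': "htup C'" "\<And>j. j \<le> n \<Longrightarrow> C' j = tsc (t m) C j" "\<And>k. k \<le> n + m \<Longrightarrow> posdef (LP C' k)"
      using extend_htup[OF htup_tsc[OF C] pos, of n "n + m"] by auto
    have "rep (natoms n) n (\<lambda>j. csc (1 - real j / real (N m)) (C' j))"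
      by (rule fejer_rep[OF C'(1) posdef_tpsd[OF C'(1) C'(3)]]) (auto simp: N_def)
    moreover have "C' j = csc (t m) (C j)" if "j \<in> {1..n}" for j using C'(2)[of j] that by (simp add: tsc_def)
    ultimately show ?thesis unfolding rep_def repS_def by simp
  qed
  fix j assume "j \<in> {1..n}"
  have s: "(\<lambda>m. 1 / real (Suc m)) \<longlonglongrightarrow> 0" using LIMSEQ_inverse_real_of_nat by (simp add: inverse_eq_divide)
  have "(\<lambda>m. 1 / real (Suc (m + n))) \<longlonglongrightarrow> 0" using LIMSEQ_ignore_initial_segment[OF s, of n] by simp
  then have "(\<lambda>m. real j * (1 / real (Suc (m + n)))) \<longlonglongrightarrow> real j * 0" by (intro tendsto_intros)
  then have "(\<lambda>m. real j / real (N m)) \<longlonglongrightarrow> 0" by (simp add: N_def add.commute)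
  then have "(\<lambda>m. complex_of_real (1 - real j / real (N m)) * (complex_of_real (t m) * C j a b)) \<longlonglongrightarrow> of_real (1 - 0) * (of_real (1 - 0) * C j a b)" for a b
    unfolding t_def using s by (intro tendsto_intros)
  then show "mlim (\<lambda>m. csc (1 - real j / real (N m)) (csc (t m) (C j))) (C j)"
    unfolding mlim_def csc_def by simp
qed

end

section \<open>The moment space\<close>

text \<open>The triangular matrix has powers of 1/4 on its diagonal, hence is invertible; a right
  inverse then gives the uniqueness that the description of \<open>Ainv\<close> requires.\<close>

lemma Ainv_inverse:
  shows Ainv_left: "i \<in> {1..k} \<Longrightarrow> j \<in> {1..k} \<Longrightarrow> (\<Sum>m=1..k. Ainv k i m * amat m j) = (if i = j then 1 else 0)"
    and Ainv_right: "i \<in> {1..k} \<Longrightarrow> j \<in> {1..k} \<Longrightarrow> (\<Sum>m=1..k. amat i m * Ainv k m j) = (if i = j then 1 else 0)"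
proof -
  define A where "A = Matrix.mat k k (\<lambda>(i, j). amat (Suc i) (Suc j))"
  have A: "A \<in> carrier_mat k k" by (simp add: A_def)
  have "Determinant.det A = prod_list (diag_mat A)"
    by (rule det_lower_triangular[OF _ A]) (auto simp: A_def amat_def)
  also have "\<dots> = (\<Prod>i = 0..<k. A $$ (i, i))" using A by (simp add: prod_list_diag_prod)
  also have "\<dots> = (\<Prod>i = 0..<k. (1 / 4) ^ i)" by (intro prod.cong) (auto simp: A_def amat_def)
  finally have dA: "Determinant.det A \<noteq> 0" by simp
  define B where "B = (1 / Determinant.det A) \<cdot>\<^sub>m adj_mat A"
  have B: "B \<in> carrier_mat k k" using adj_mat(1)[OF A] by (simp add: B_def)
  have AB: "A * B = 1\<^sub>m k" "B * A = 1\<^sub>m k"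
    using adj_mat[OF A] dA A unfolding B_def
    by (simp_all add: mult_smult_distrib[OF A] mult_smult_assoc_mat[OF _ A])
      (rule eq_matI; simp)+
  define b where "b i j = (if i \<in> {1..k} \<and> j \<in> {1..k} then B $$ (i - 1, j - 1) else 0)" for i j
  have shift: "(\<Sum>m=1..k. f m) = (\<Sum>m = 0..<k. f (Suc m))" for f :: "nat \<Rightarrow> real"
    by (rule sum.reindex_bij_witness[of _ Suc "\<lambda>m. m - 1"]) auto
  have left: "(\<Sum>m=1..k. b i m * amat m j) = (if i = j then 1 else 0)" if ij: "i \<in> {1..k}" "j \<in> {1..k}" for i j
  proof -
    have "(\<Sum>m=1..k. b i m * amat m j) = (B * A) $$ (i - 1, j - 1)"
      using ij A B unfolding shift by (auto simp: scalar_prod_def b_def A_def intro!: sum.cong)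
    then show ?thesis unfolding AB using ij by auto
  qed
  have right: "(\<Sum>m=1..k. amat i m * b m j) = (if i = j then 1 else 0)" if ij: "i \<in> {1..k}" "j \<in> {1..k}" for i j
  proof -
    have "(\<Sum>m=1..k. amat i m * b m j) = (A * B) $$ (i - 1, j - 1)"
      using ij A B unfolding shift by (auto simp: scalar_prod_def b_def A_def intro!: sum.cong)
    then show ?thesis unfolding AB using ij by auto
  qed
  have "Ainv k = b"
    unfolding Ainv_def
  proof (rule the_equality)
    show "(\<forall>i j. (i \<notin> {1..k} \<or> j \<notin> {1..k}) \<longrightarrow> b i j = 0) \<and>
      (\<forall>i\<in>{1..k}. \<forall>j\<in>{1..k}. (\<Sum>m=1..k. b i m * amat m j) = (if i = j then 1 else 0))"
      using left by (auto simp: b_def)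
    fix B' assume B': "(\<forall>i j. (i \<notin> {1..k} \<or> j \<notin> {1..k}) \<longrightarrow> B' i j = 0) \<and>
      (\<forall>i\<in>{1..k}. \<forall>j\<in>{1..k}. (\<Sum>m=1..k. B' i m * amat m j) = (if i = j then 1 else 0))"
    show "B' = b"
    proof (intro ext)
      fix i j
      show "B' i j = b i j"
      proof (cases "i \<in> {1..k} \<and> j \<in> {1..k}")
        case True
        then have i: "i \<in> {1..k}" and j: "j \<in> {1..k}" by auto
        have "(\<Sum>l=1..k. B' i l * (\<Sum>m=1..k. amat l m * b m j)) = (\<Sum>l=1..k. if l = j then B' i l else 0)"
        proof (intro sum.cong refl)
          fix l assume l: "l \<in> {1..k}"
          show "B' i l * (\<Sum>m=1..k. amat l m * b m j) = (if l = j then B' i l else 0)"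
            unfolding right[OF l j] by simp
        qed
        also have "\<dots> = B' i j" using j by simp
        finally have 1: "B' i j = (\<Sum>l=1..k. B' i l * (\<Sum>m=1..k. amat l m * b m j))" by simp
        also have "\<dots> = (\<Sum>l=1..k. \<Sum>m=1..k. B' i l * amat l m * b m j)"
          by (simp add: sum_distrib_left mult.assoc)
        also have "\<dots> = (\<Sum>m=1..k. (\<Sum>l=1..k. B' i l * amat l m) * b m j)"
          by (subst sum.swap) (simp add: sum_distrib_right)
        also have "\<dots> = (\<Sum>m=1..k. if m = i then b m j else 0)"
        proof (intro sum.cong refl)
          fix m assume m: "m \<in> {1..k}"
          have "(\<Sum>l=1..k. B' i l * amat l m) = (if i = m then 1 else 0)" using B' i m by blast
          then show "(\<Sum>l=1..k. B' i l * amat l m) * b m j = (if m = i then b m j else 0)" by (simp only:) simp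
        qed
        also have "\<dots> = b i j" using i by simp
        finally show ?thesis .
      next
        case False
        then show ?thesis using B' by (auto simp: b_def)
      qed
    qed
  qed
  then show "i \<in> {1..k} \<Longrightarrow> j \<in> {1..k} \<Longrightarrow> (\<Sum>m=1..k. Ainv k i m * amat m j) = (if i = j then 1 else 0)"
    "i \<in> {1..k} \<Longrightarrow> j \<in> {1..k} \<Longrightarrow> (\<Sum>m=1..k. amat i m * Ainv k m j) = (if i = j then 1 else 0)"
    using left right by auto
qed

lemma sum_Ainv_amat:
  fixes x :: "nat \<Rightarrow> complex"
  assumes i: "i \<in> {1..k}"
  shows "(\<Sum>m=1..k. of_real (Ainv k i m) * (\<Sum>l=1..k. of_real (amat m l) * x l)) = x i"
    and "(\<Sum>m=1..k. of_real (amat i m) * (\<Sum>l=1..k. of_real (Ainv k m l) * x l)) = x i"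
proof -
  have gen: "(\<Sum>m=1..k. of_real (f m) * (\<Sum>l=1..k. of_real (g m l) * x l)) = x i"
    if "\<And>l. l \<in> {1..k} \<Longrightarrow> (\<Sum>m=1..k. f m * g m l) = (if i = l then 1 else 0)" for f :: "nat \<Rightarrow> real" and g
  proof -
    have "(\<Sum>m=1..k. of_real (f m) * (\<Sum>l=1..k. of_real (g m l) * x l)) =
      (\<Sum>m=1..k. \<Sum>l=1..k. of_real (f m * g m l) * x l)"
      by (simp add: sum_distrib_left mult.assoc)
    also have "\<dots> = (\<Sum>l=1..k. of_real (\<Sum>m=1..k. f m * g m l) * x l)"
      by (subst sum.swap) (simp only: of_real_sum sum_distrib_right)
    also have "\<dots> = (\<Sum>l=1..k. if l = i then x l else 0)"
      using that by (intro sum.cong refl) auto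
    also have "\<dots> = x i" using i by simp
    finally show ?thesis .
  qed
  show "(\<Sum>m=1..k. of_real (Ainv k i m) * (\<Sum>l=1..k. of_real (amat m l) * x l)) = x i"
    by (rule gen) (rule Ainv_left[OF i])
  show "(\<Sum>m=1..k. of_real (amat i m) * (\<Sum>l=1..k. of_real (Ainv k m l) * x l)) = x i"
    by (rule gen) (rule Ainv_right[OF i])
qed

lemma amat_gt: "i < j \<Longrightarrow> amat i j = 0"
  by (simp add: amat_def)

context cmats
begin

text \<open>The passage from Chebyshev moments \<open>\<integral> chebT i d\<mu>\<close> to power moments, by \<open>power_chebT\<close>.\<close>

definition Psi :: "(nat \<Rightarrow> cmx) \<Rightarrow> nat \<Rightarrow> cmx" where
  "Psi C j = csc (s0 j) one + (\<Sum>i=1..j. csc (amat j i / 2) (C i))"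

definition Psi_inv :: "nat \<Rightarrow> (nat \<Rightarrow> cmx) \<Rightarrow> nat \<Rightarrow> cmx" where
  "Psi_inv n S i = (\<Sum>m=1..n. csc (2 * Ainv n i m) (S m - csc (s0 m) one))"

lemma Psi_entry:
  assumes "j \<le> n"
  shows "Psi C j a b = of_real (s0 j) * one a b + (\<Sum>i=1..n. of_real (amat j i) * (C i a b / 2))"
proof -
  have "Psi C j a b = of_real (s0 j) * one a b + (\<Sum>i=1..j. of_real (amat j i) * (C i a b / 2))"
    by (simp add: Psi_def sum_fun_apply csc_def)
  also have "(\<Sum>i=1..j. of_real (amat j i) * (C i a b / 2)) = (\<Sum>i=1..n. of_real (amat j i) * (C i a b / 2))"
    using assms by (intro sum.mono_neutral_left) (auto simp: amat_gt)
  finally show ?thesis .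
qed

lemma Psi_inv_Psi:
  assumes "i \<in> {1..n}" "\<And>m. m \<in> {1..n} \<Longrightarrow> S m = Psi C m"
  shows "Psi_inv n S i = C i"
proof (intro ext)
  fix a b
  have "Psi_inv n S i a b = 2 * (\<Sum>m=1..n. of_real (Ainv n i m) * (S m a b - of_real (s0 m) * one a b))"
    by (simp add: Psi_inv_def sum_fun_apply csc_def sum_distrib_left mult.assoc)
  also have "\<dots> = 2 * (\<Sum>m=1..n. of_real (Ainv n i m) * (\<Sum>l=1..n. of_real (amat m l) * (C l a b / 2)))"
    by (intro arg_cong[of _ _ "(*) 2"] sum.cong refl) (simp add: assms(2) Psi_entry[of _ n])
  also have "\<dots> = C i a b" unfolding sum_Ainv_amat(1)[OF assms(1)] by simp
  finally show "Psi_inv n S i a b = C i a b" .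
qed

lemma Psi_Psi_inv:
  assumes "j \<in> {1..n}" "\<And>i. i \<in> {1..n} \<Longrightarrow> C i = Psi_inv n S i"
  shows "Psi C j = S j"
proof (intro ext)
  fix a b
  have "Psi C j a b = of_real (s0 j) * one a b + (\<Sum>i=1..n. of_real (amat j i) * (C i a b / 2))"
    using assms(1) by (intro Psi_entry) auto
  also have "(\<Sum>i=1..n. of_real (amat j i) * (C i a b / 2)) =
      (\<Sum>i=1..n. of_real (amat j i) * (\<Sum>m=1..n. of_real (Ainv n i m) * (S m a b - of_real (s0 m) * one a b)))"
    by (intro sum.cong refl) (simp add: assms(2) Psi_inv_def sum_fun_apply csc_def sum_divide_distrib)
  also have "\<dots> = S j a b - of_real (s0 j) * one a b" by (rule sum_Ainv_amat(2)[OF assms(1)])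
  finally show "Psi C j a b = S j a b" by simp
qed

text \<open>One atom at angle t contributes the form of \<open>W\<close> at the cosine sum
  \<open>w1\<close> plus that at the sine sum \<open>w2\<close>, by the addition theorem for cos ((i
  - j) t).\<close>

lemma atom_nonneg:
  assumes W: "psd W"
  shows "0 \<le> Re ((\<Sum>i\<le>n. \<Sum>j\<le>n. adj (u i) \<diamondop> csc (cos (real (dd i j) * t)) W \<diamondop> u j) 0 0)"
proof -
  define w1 where "w1 = (\<Sum>i\<le>n. csc (cos (real i * t)) (u i))"
  define w2 where "w2 = (\<Sum>i\<le>n. csc (sin (real i * t)) (u i))"
  have adj_csc: "adj (csc t X) = csc t (adj X)" for t X by (auto simp: csc_def adj_def fun_eq_iff)
  have cs: "csc s X + csc t X = csc (s + t) X" for s t X by (simp add: csc_def fun_eq_iff algebra_simps)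
  have cc: "csc s (csc t X) = csc (s * t) X" for s t X by (simp add: csc_def fun_eq_iff mult.assoc)
  have exp: "adj (\<Sum>i\<le>n. csc (f i) (u i)) \<diamondop> W \<diamondop> (\<Sum>i\<le>n. csc (f i) (u i)) =
     (\<Sum>i\<le>n. \<Sum>j\<le>n. csc (f i * f j) (adj (u i) \<diamondop> W \<diamondop> u j))" for f
    unfolding adj_sum adj_csc mm_sum_left
    by (intro sum.cong refl) (simp add: mm_sum_right csc_mm cc mult.commute)
  have "(\<Sum>i\<le>n. \<Sum>j\<le>n. adj (u i) \<diamondop> csc (cos (real (dd i j) * t)) W \<diamondop> u j) = adj w1 \<diamondop> W \<diamondop> w1 + adj w2 \<diamondop> W \<diamondop> w2"
    unfolding w1_def w2_def exp sum.distrib[symmetric] cs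
  proof (intro sum.cong refl)
    fix i j
    have "cos (real (dd i j) * t) = cos (real i * t) * cos (real j * t) + sin (real i * t) * sin (real j * t)"
    proof (cases "j \<le> i")
      case True
      then show ?thesis by (simp add: dd_def of_nat_diff left_diff_distrib cos_diff)
    next
      case False
      then have "real (dd i j) * t = real j * t - real i * t" by (simp add: dd_def of_nat_diff left_diff_distrib)
      then show ?thesis by (simp only: cos_diff mult.commute)
    qed
    then show "adj (u i) \<diamondop> csc (cos (real (dd i j) * t)) W \<diamondop> u j =
       csc (cos (real i * t) * cos (real j * t) + sin (real i * t) * sin (real j * t)) (adj (u i) \<diamondop> W \<diamondop> u j)"
      by (simp add: csc_mm)
  qed
  then show ?thesis using W by (simp add: qf_eq psd_def)
qed

text \<open>\<open>D N\<close> are the Chebyshev moments of the measure that moves the mass of each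
  cell to its left end. Their forms are sums of those in \<open>atom_nonneg\<close>, and
  nonnegativity passes to the limit \<open>C\<close>.\<close>

lemma matrix_measure_moments:
  assumes \<mu>: "matrix_measure p \<mu>"
  shows "\<exists>C. htup C \<and> tpsd n C \<and> (\<forall>j. mat_moment p \<mu> j = Psi C j)"
proof -
  define C where "C i = (\<lambda>a b. if a < p \<and> b < p then cm_integral (\<mu> a b) (chebT i) else 0)" for i
  define W where "W N r = (\<lambda>a b. if a < p \<and> b < p then \<mu> a b (cell N r) else 0)" for N r
  define D where "D N i = (\<Sum>r\<le>Suc N. csc (chebT i (real r / real (Suc N))) (W N r))" for N i
  have W: "psd (W N r)" for N r
  proof -
    have h: "hermitian_psd p (\<lambda>i j. \<mu> i j (cell N r))"
      using \<mu> sets_cell unfolding matrix_measure_def by blast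
    have hW: "cnj (W N r j i) = W N r i j" for i j
    proof (cases "i < p \<and> j < p")
      case True
      then have "\<mu> i j (cell N r) = cnj (\<mu> j i (cell N r))"
        using h unfolding hermitian_psd_def by blast
      then show ?thesis using True by (simp add: W_def)
    qed (auto simp: W_def)
    have "supp (W N r)" by (auto simp: supp_def W_def split: if_splits)
    then have "herm (W N r)"
      by (simp add: herm_def adj_def hW)
    moreover have "0 \<le> Re (\<Sum>i<p. \<Sum>j<p. cnj (v i) * \<mu> i j (cell N r) * v j)" for v
      using h unfolding hermitian_psd_def by blast
    moreover have "qf (W N r) v = (\<Sum>i<p. \<Sum>j<p. cnj (v i) * \<mu> i j (cell N r) * v j)" for v
      unfolding qf_def W_def by (intro sum.cong refl) auto
    ultimately show ?thesis by (simp add: psd_def)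
  qed
  have lim: "mlim (\<lambda>N. D N i) (C i)" for i
    unfolding mlim_def
  proof (intro allI)
    fix a b
    have De: "D N i a b = (\<Sum>r\<le>Suc N. of_real (chebT i (real r / real (Suc N))) * W N r a b)" for N
      unfolding D_def sum_fun_apply csc_def by simp
    show "(\<lambda>N. D N i a b) \<longlonglongrightarrow> C i a b"
    proof (cases "a < p \<and> b < p")
      case True
      then show ?thesis
        unfolding De using cm_integral_LIMSEQ[OF \<mu> _ _ continuous_chebT, of a b i] by (simp add: W_def C_def)
    next
      case False
      then show ?thesis unfolding De by (auto simp: W_def C_def)
    qed
  qed
  have "C 0 = one"
  proof -
    have "chebT 0 = (\<lambda>_. 1)" by auto
    then have "C 0 = (\<lambda>a b. if a < p \<and> b < p then cm_integral (\<mu> a b) (\<lambda>_. 1) else 0)"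
      by (simp only: C_def)
    then show ?thesis using cm_integral_const[OF \<mu>] by (auto simp: one_def fun_eq_iff)
  qed
  moreover have "herm (C i)" for i
  proof (rule herm_limit[OF lim])
    show "herm (D N i)" for N
      unfolding D_def using W by (intro herm_sum herm_csc) (auto simp: psd_def)
  qed
  ultimately have C: "htup C" by (simp add: htup_def)
  have "tpsd n C"
    unfolding tpsd_def
  proof (intro allI impI)
    fix u :: "nat \<Rightarrow> cmx"
    have "mlim (\<lambda>N. TF n (D N) u u) (TF n C u u)"
      unfolding TF_def by (intro mlim_sum mlim_mm mlim_const lim)
    then have "(\<lambda>N. Re (TF n (D N) u u 0 0)) \<longlonglongrightarrow> Re (TF n C u u 0 0)"
      by (intro tendsto_Re mlimD)
    moreover have "0 \<le> Re (TF n (D N) u u 0 0)" for N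
    proof -
      have "TF n (D N) u u = (\<Sum>i\<le>n. \<Sum>j\<le>n. \<Sum>r\<le>Suc N. adj (u i) \<diamondop> csc (chebT (dd i j) (real r / real (Suc N))) (W N r) \<diamondop> u j)"
        by (simp only: TF_def D_def mm_sum_left mm_sum_right)
      also have "\<dots> = (\<Sum>i\<le>n. \<Sum>r\<le>Suc N. \<Sum>j\<le>n. adj (u i) \<diamondop> csc (chebT (dd i j) (real r / real (Suc N))) (W N r) \<diamondop> u j)"
        by (intro sum.cong refl sum.swap)
      also have "\<dots> = (\<Sum>r\<le>Suc N. \<Sum>i\<le>n. \<Sum>j\<le>n. adj (u i) \<diamondop> csc (chebT (dd i j) (real r / real (Suc N))) (W N r) \<diamondop> u j)"
        by (rule sum.swap)
      finally have "Re (TF n (D N) u u 0 0) = (\<Sum>r\<le>Suc N. Re ((\<Sum>i\<le>n. \<Sum>j\<le>n. adj (u i) \<diamondop>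
          csc (cos (real (dd i j) * arccos (2 * (real r / real (Suc N)) - 1))) (W N r) \<diamondop> u j) 0 0))"
        by (simp only: chebT_def sum_fun_apply Re_sum)
      then show ?thesis using atom_nonneg[OF W] by (simp only: sum_nonneg)
    qed
    ultimately show "0 \<le> Re (TF n C u u 0 0)" using LIMSEQ_le_const by blast
  qed
  moreover have "mat_moment p \<mu> j = Psi C j" for j
  proof (intro ext)
    fix a b
    show "mat_moment p \<mu> j a b = Psi C j a b"
    proof (cases "a < p \<and> b < p")
      case True
      then have ab: "a < p" "b < p" by auto
      define c where "c i = (if i = 0 then s0 j else amat j i / 2)" for i
      have split: "{..j} = insert 0 {1..j}" by auto
      have "cm_integral (\<mu> a b) (\<lambda>x. x ^ j) = (\<Sum>i\<in>{..j}. complex_of_real (c i) * cm_integral (\<mu> a b) (chebT i))"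
      proof (rule cm_integral_lincomb[OF \<mu> ab continuous_chebT])
        fix x :: real assume "x \<in> {0..1}"
        then show "x ^ j = (\<Sum>i\<in>{..j}. c i * chebT i x)"
          unfolding split by (simp add: power_chebT c_def)
      qed
      also have "\<dots> = (\<Sum>i\<in>{..j}. complex_of_real (c i) * C i a b)" using ab by (simp add: C_def)
      also have "\<dots> = Psi C j a b"
        unfolding split Psi_def using \<open>C 0 = one\<close> by (simp add: c_def sum_fun_apply csc_def)
      finally show ?thesis using ab by (simp add: mat_moment_def)
    next
      case False
      then show ?thesis by (auto simp: mat_moment_def Psi_entry[of j j] C_def one_def)
    qed
  qed
  ultimately show ?thesis using C by blast
qed

text \<open>The atoms move from [-1, 1] to [0, 1] by \<open>x r = (1 + y r) / 2\<close>, the inverse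
  of the shift inside \<open>chebT\<close>. Point masses are integrated through the Riemann sums,
  which evaluate \<open>f\<close> at the left end of the cell of each atom.\<close>

lemma rep_matrix_measure:
  assumes C: "htup C" and rep: "rep K n C"
  shows "\<exists>\<mu>. matrix_measure p \<mu> \<and> (\<forall>j\<in>{1..n}. mat_moment p \<mu> j = Psi C j)"
proof -
  obtain y W where yW: "repS {..<K} y W n C" using rep unfolding rep_def by blast
  have y: "y r \<in> {-1..1}" and W: "psd (W r)" if "r < K" for r
    using yW that by (auto simp: repS_def)
  have W1: "(\<Sum>r<K. W r) = one" using yW by (auto simp: repS_def)
  have Ce: "C j = (\<Sum>r<K. csc (cos (real j * arccos (y r))) (W r))" if "j \<in> {1..n}" for j
    using yW that by (auto simp: repS_def)
  define x where "x r = (1 + y r) / 2" for r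
  have x: "x r \<in> {0..1}" if "r < K" for r using y[OF that] by (auto simp: x_def)
  define \<mu> where "\<mu> a b B = (\<Sum>r<K. W r a b * complex_of_real (indicator B (x r)))" for a b B
  have \<mu>: "matrix_measure p \<mu>"
    unfolding matrix_measure_def
  proof (intro conjI ballI allI impI)
    fix i j
    show "is_complex_measure (\<mu> i j)"
      unfolding is_complex_measure_def
    proof (intro conjI allI impI)
      fix A :: "nat \<Rightarrow> real set" assume "disjoint_family A"
      then have "(\<lambda>n. indicator (A n) (x r) :: real) sums indicator (\<Union>(range A)) (x r)" for r
        by (intro indicator_sums) (auto simp: disjoint_family_on_def)
      then show "(\<lambda>n. \<mu> i j (A n)) sums \<mu> i j (\<Union>(range A))"
        unfolding \<mu>_def by (intro sums_sum sums_mult sums_of_real)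
    qed (simp add: \<mu>_def)
  next
    fix B
    have h: "W r i j = cnj (W r j i)" if "r < K" for r i j
      using W[OF that] unfolding psd_def herm_def adj_def by metis
    show "hermitian_psd p (\<lambda>i j. \<mu> i j B)"
      unfolding hermitian_psd_def
    proof (intro conjI allI impI)
      fix i j
      have "cnj (\<mu> j i B) = (\<Sum>r<K. cnj (W r j i) * complex_of_real (indicator B (x r)))"
        by (simp add: \<mu>_def)
      also have "\<dots> = \<mu> i j B"
        unfolding \<mu>_def by (intro sum.cong refl) (simp flip: h)
      finally show "\<mu> i j B = cnj (\<mu> j i B)" by simp
    next
      fix v :: "nat \<Rightarrow> complex"
      have "(\<lambda>i j. \<mu> i j B) = (\<Sum>r<K. csc (indicator B (x r)) (W r))"
        by (simp add: \<mu>_def sum_fun_apply csc_def fun_eq_iff mult.commute)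
      then have "(\<Sum>i<p. \<Sum>j<p. cnj (v i) * \<mu> i j B * v j) = qf (\<Sum>r<K. csc (indicator B (x r)) (W r)) v"
        unfolding qf_def by metis
      also have "Re \<dots> = (\<Sum>r<K. indicator B (x r) * Re (qf (W r) v))"
        by (simp add: qf_sum qf_csc)
      also have "\<dots> \<ge> 0" using W by (intro sum_nonneg mult_nonneg_nonneg) (auto simp: psd_def)
      finally show "0 \<le> Re (\<Sum>i<p. \<Sum>j<p. cnj (v i) * \<mu> i j B * v j)" .
    qed
  next
    fix i j assume "i < p" "j < p"
    have "\<mu> i j {0..1} = (\<Sum>r<K. W r) i j"
      unfolding \<mu>_def sum_fun_apply using x by (intro sum.cong refl) auto
    then show "\<mu> i j {0..1} = (if i = j then 1 else 0)"
      using \<open>i < p\<close> by (simp add: W1 one_def)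
  qed
  have int: "cm_integral (\<mu> a b) f = (\<Sum>r<K. W r a b * of_real (f (x r)))"
    if ab: "a < p" "b < p" and f: "continuous_on {0..1} f" for a b f
  proof -
    have "(\<Sum>q\<le>Suc N. complex_of_real (f (real q / real (Suc N))) * \<mu> a b (cell N q)) =
       (\<Sum>r<K. W r a b * of_real (f (lpt N (x r))))" for N
    proof -
      have "(\<Sum>q\<le>Suc N. complex_of_real (f (real q / real (Suc N))) * \<mu> a b (cell N q)) =
        (\<Sum>r<K. W r a b * of_real (\<Sum>q\<le>Suc N. indicator (cell N q) (x r) * f (real q / real (Suc N))))"
        unfolding \<mu>_def sum_distrib_left of_real_sum by (subst sum.swap) (simp only: of_real_mult mult_ac)
      also have "\<dots> = (\<Sum>r<K. W r a b * of_real (f (lpt N (x r))))"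
        using sum_cell[OF x, of _ N f] by (intro sum.cong refl) (simp del: sum.atMost_Suc of_nat_Suc)
      finally show ?thesis .
    qed
    moreover have "(\<lambda>N. \<Sum>r<K. W r a b * of_real (f (lpt N (x r)))) \<longlonglongrightarrow> (\<Sum>r<K. W r a b * of_real (f (x r)))"
      using x by (intro tendsto_sum tendsto_mult tendsto_const tendsto_of_real f_lpt_tendsto[OF f]) auto
    ultimately show ?thesis using LIMSEQ_unique[OF cm_integral_LIMSEQ[OF \<mu> ab f]] by simp
  qed
  have "mat_moment p \<mu> j = Psi C j" if j: "j \<in> {1..n}" for j
  proof (intro ext)
    fix a b
    have sC: "supp (Psi C j)"
      unfolding Psi_def using C by (intro supp_add supp_sum supp_csc) (auto simp: htupD)
    show "mat_moment p \<mu> j a b = Psi C j a b"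
    proof (cases "a < p \<and> b < p")
      case True
      then have ab: "a < p" "b < p" by auto
      have "mat_moment p \<mu> j a b = (\<Sum>r<K. W r a b * of_real (x r ^ j))"
        using ab by (simp add: mat_moment_def int[OF ab] continuous_intros)
      also have "\<dots> = (\<Sum>r<K. W r a b * of_real (s0 j + (\<Sum>i=1..j. amat j i / 2 * cos (real i * arccos (y r)))))"
      proof (intro sum.cong refl)
        fix r assume "r \<in> {..<K}"
        moreover have "2 * x r - 1 = y r" by (simp add: x_def field_simps)
        ultimately show "W r a b * of_real (x r ^ j) =
           W r a b * of_real (s0 j + (\<Sum>i=1..j. amat j i / 2 * cos (real i * arccos (y r))))"
          using power_chebT[OF x, of r j] by (simp add: chebT_def)
      qed
      also have "\<dots> = of_real (s0 j) * (\<Sum>r<K. W r a b) + (\<Sum>r<K. \<Sum>i=1..j. of_real (amat j i / 2) * (of_real (cos (real i * arccos (y r))) * W r a b))"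
        by (simp add: sum.distrib distrib_left sum_distrib_left mult_ac)
      also have "(\<Sum>r<K. \<Sum>i=1..j. of_real (amat j i / 2) * (of_real (cos (real i * arccos (y r))) * W r a b)) =
          (\<Sum>i=1..j. of_real (amat j i / 2) * (\<Sum>r<K. of_real (cos (real i * arccos (y r))) * W r a b))"
        by (subst sum.swap) (simp only: sum_distrib_left)
      also have "\<dots> = (\<Sum>i=1..j. of_real (amat j i / 2) * C i a b)"
        using j by (intro sum.cong refl) (simp add: Ce sum_fun_apply csc_def)
      also have "(\<Sum>r<K. W r a b) = one a b" unfolding W1[symmetric] sum_fun_apply ..
      finally show ?thesis by (simp add: Psi_def sum_fun_apply csc_def)
    next
      case False
      then show ?thesis using sC unfolding supp_def mat_moment_def by (metis (no_types, lifting))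
    qed
  qed
  then show ?thesis using \<mu> by blast
qed

lemma moment_space_eq:
  "S \<in> moment_space p n \<longleftrightarrow> (\<exists>C. htup C \<and> tpsd n C \<and> (\<forall>j. S j = (if j \<in> {1..n} then Psi C j else (\<lambda>_ _. 0))))"
proof
  assume "S \<in> moment_space p n"
  then obtain \<mu> where "matrix_measure p \<mu>" and S: "\<And>j. S j = (if j \<in> {1..n} then mat_moment p \<mu> j else (\<lambda>_ _. 0))"
    unfolding moment_space_def by blast
  then obtain C where "htup C" "tpsd n C" "\<And>j. mat_moment p \<mu> j = Psi C j"
    using matrix_measure_moments[of \<mu> n] by blast
  then show "\<exists>C. htup C \<and> tpsd n C \<and> (\<forall>j. S j = (if j \<in> {1..n} then Psi C j else (\<lambda>_ _. 0)))"
    using S by auto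
next
  assume "\<exists>C. htup C \<and> tpsd n C \<and> (\<forall>j. S j = (if j \<in> {1..n} then Psi C j else (\<lambda>_ _. 0)))"
  then obtain C where C: "htup C" "tpsd n C" and S: "\<And>j. S j = (if j \<in> {1..n} then Psi C j else (\<lambda>_ _. 0))"
    by blast
  obtain \<mu> where "matrix_measure p \<mu>" "\<And>j. j \<in> {1..n} \<Longrightarrow> mat_moment p \<mu> j = Psi C j"
    using rep_matrix_measure[OF C(1) tpsd_rep[OF C]] by blast
  then show "S \<in> moment_space p n"
    unfolding moment_space_def using S by auto
qed

text \<open>The only possible Chebyshev tuple of \<open>S\<close>, and continuous in
  \<open>S\<close>. It turns the existential description of the moment space into closed conditions
  on \<open>S\<close>.\<close>

definition Cof :: "nat \<Rightarrow> (nat \<Rightarrow> cmx) \<Rightarrow> nat \<Rightarrow> cmx" where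
  "Cof n S i = (if i = 0 then one else if i \<le> n then Psi_inv n S i else 0)"

lemma TF_cong: "(\<And>i. i \<le> n \<Longrightarrow> C i = C' i) \<Longrightarrow> TF n C u w = TF n C' u w"
  unfolding TF_def by (intro sum.cong refl) (auto simp: dd_def)

lemma tpsd_cong: "(\<And>i. i \<le> n \<Longrightarrow> C i = C' i) \<Longrightarrow> tpsd n C \<longleftrightarrow> tpsd n C'"
  unfolding tpsd_def using TF_cong[of n C C'] by simp

lemma herm_Psi: "htup C \<Longrightarrow> herm (Psi C j)"
  unfolding Psi_def by (intro herm_add herm_sum herm_csc) (auto simp: htupD)

lemma moment_space_Cof:
  "S \<in> moment_space p n \<longleftrightarrow> (\<forall>j. j \<notin> {1..n} \<longrightarrow> S j = (\<lambda>_ _. 0)) \<and> (\<forall>j\<in>{1..n}. herm (S j)) \<and> tpsd n (Cof n S)"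
proof
  assume "S \<in> moment_space p n"
  then obtain C where C: "htup C" "tpsd n C" and S: "\<And>j. S j = (if j \<in> {1..n} then Psi C j else (\<lambda>_ _. 0))"
    unfolding moment_space_eq by blast
  have "Cof n S i = C i" if "i \<le> n" for i
    using that Psi_inv_Psi[of i n S C] S C by (auto simp: Cof_def htupD)
  then have "tpsd n (Cof n S)" using C(2) tpsd_cong[of n "Cof n S" C] by simp
  then show "(\<forall>j. j \<notin> {1..n} \<longrightarrow> S j = (\<lambda>_ _. 0)) \<and> (\<forall>j\<in>{1..n}. herm (S j)) \<and> tpsd n (Cof n S)"
    using S herm_Psi[OF C(1)] by auto
next
  assume *: "(\<forall>j. j \<notin> {1..n} \<longrightarrow> S j = (\<lambda>_ _. 0)) \<and> (\<forall>j\<in>{1..n}. herm (S j)) \<and> tpsd n (Cof n S)"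
  have "herm (Psi_inv n S i)" for i
    unfolding Psi_inv_def using * by (intro herm_sum herm_csc herm_diff) auto
  then have "htup (Cof n S)" by (auto simp: htup_def Cof_def)
  moreover have "Psi (Cof n S) j = S j" if "j \<in> {1..n}" for j
    by (rule Psi_Psi_inv[OF that]) (auto simp: Cof_def)
  ultimately show "S \<in> moment_space p n"
    unfolding moment_space_eq using * by (intro exI[of _ "Cof n S"]) auto
qed

text \<open>Serves to show that the set conditioned on in \<open>unif_moment\<close> is
  Borel.\<close>

lemma closed_moment_space: "closed (moment_space p n)"
proof -
  have c: "continuous_on UNIV (\<lambda>S :: nat \<Rightarrow> cmx. S j a b)" for j a b
    by (rule continuous_on_product_then_coordinatewise, rule continuous_on_product_then_coordinatewise,
        rule continuous_on_product_coordinates)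
  have cC: "continuous_on UNIV (\<lambda>S. Cof n S i a b)" for i a b
  proof -
    have "continuous_on UNIV (\<lambda>S. Psi_inv n S i a b)"
      unfolding Psi_inv_def sum_fun_apply csc_def minus_apply by (intro continuous_on_sum continuous_on_mult continuous_on_diff continuous_on_const c)
    then show ?thesis by (cases "i = 0"; cases "i \<le> n") (auto simp: Cof_def)
  qed
  have 1: "closed {S :: nat \<Rightarrow> cmx. herm (S j)}" for j
  proof -
    have "{S :: nat \<Rightarrow> cmx. supp (S j)} = {S. \<forall>a b. \<not> (a < p \<and> b < p) \<longrightarrow> S j a b = 0}"
      by (auto simp: supp_def)
    also have "closed \<dots>"
      by (intro closed_Collect_all closed_Collect_imp open_Collect_const closed_Collect_eq continuous_on_const c)
    finally have "closed {S :: nat \<Rightarrow> cmx. supp (S j)}" .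
    moreover have "closed {S :: nat \<Rightarrow> cmx. adj (S j) = S j}"
      unfolding adj_def fun_eq_iff by (intro closed_Collect_all closed_Collect_eq continuous_on_cnj c)
    ultimately show ?thesis unfolding herm_def by (rule closed_Collect_conj)
  qed
  have 2: "closed {S :: nat \<Rightarrow> cmx. tpsd n (Cof n S)}"
    unfolding tpsd_def
  proof (intro closed_Collect_all closed_Collect_imp open_Collect_const closed_Collect_le)
    fix u :: "nat \<Rightarrow> cmx"
    show "continuous_on UNIV (\<lambda>S. Re (TF n (Cof n S) u u 0 0))"
      unfolding TF_def sum_fun_apply mm_def
      by (intro continuous_on_Re continuous_on_sum continuous_on_mult continuous_on_const cC)
  qed simp
  have 3: "closed {S :: nat \<Rightarrow> cmx. S j = (\<lambda>_ _. 0)}" for j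
    unfolding fun_eq_iff by (intro closed_Collect_all closed_Collect_eq continuous_on_const c)
  have "moment_space p n = {S. (\<forall>j. j \<notin> {1..n} \<longrightarrow> S j = (\<lambda>_ _. 0)) \<and> (\<forall>j. j \<in> {1..n} \<longrightarrow> herm (S j)) \<and> tpsd n (Cof n S)}"
    (is "_ = ?R")
  proof (rule Set.set_eqI)
    fix S :: "nat \<Rightarrow> cmx"
    show "S \<in> moment_space p n \<longleftrightarrow> S \<in> ?R"
      unfolding mem_Collect_eq moment_space_Cof Ball_def by (rule refl)
  qed
  also have "closed \<dots>"
    by (intro closed_Collect_conj closed_Collect_all closed_Collect_imp open_Collect_const 1 2 3)
  finally show ?thesis .
qed

end

section \<open>The law of the rescaled statistic\<close>

lemma borel_measurable_coordinatewise3: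
  fixes f :: "'a \<Rightarrow> nat \<Rightarrow> nat \<Rightarrow> nat \<Rightarrow> complex"
  assumes "\<And>j a b. (\<lambda>x. f x j a b) \<in> borel_measurable M"
  shows "f \<in> borel_measurable M"
  by (rule measurable_coordinatewise_then_product, rule measurable_coordinatewise_then_product,
      rule measurable_coordinatewise_then_product, rule assms)

lemma nn_integral_PiM_scale:
  assumes "finite I" "e \<noteq> 0" and H: "H \<in> borel_measurable (lbI I)"
  shows "(\<integral>\<^sup>+x. H (\<lambda>i\<in>I. e * x i) \<partial>lbI I) * ennreal (\<bar>e\<bar> ^ card I) = (\<integral>\<^sup>+x. H x \<partial>lbI I)"
  using nn_integral_PiM_triangular[of I "\<lambda>_. e" "\<lambda>_ _. 0" "\<lambda>_. 0" H] assms by (simp add: prod_constant)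

lemma integrable_exp_neg_square:
  fixes a :: real
  assumes "a > 0"
  shows "integrable lborel (\<lambda>x. exp (- a * x\<^sup>2))"
proof -
  define s where "s = 1 / sqrt (2 * a)"
  have s: "s > 0" "s\<^sup>2 = 1 / (2 * a)" using assms by (simp_all add: s_def power_divide)
  have "exp (- a * x\<^sup>2) = sqrt (2 * pi * s\<^sup>2) * normal_density 0 s x" for x
    using s assms by (simp add: normal_density_def field_simps)
  then show ?thesis using integrable_normal_density[OF s(1), of 0] by simp
qed

context cmats
begin

text \<open>Padded by 0 at index 0, as in \<open>leb_herm_tuple\<close>, where \<open>Ctup\<close>
  has the identity.\<close>

definition Tn :: "nat \<Rightarrow> (nat \<times> nat \<times> nat \<Rightarrow> real) \<Rightarrow> nat \<Rightarrow> cmx" where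
  "Tn n c = (\<lambda>j. if j \<in> {1..n} then herm_of_coords p (\<lambda>(i, l). c (j, i, l)) else (\<lambda>_ _. 0))"

lemma leb_herm_tuple_eq: "leb_herm_tuple p n = distr (lbI (cube n)) borel (Tn n)"
  by (simp add: leb_herm_tuple_def cube_def ibox_def Tn_def[abs_def])

lemma Tn_Ctup: "j \<in> {1..n} \<Longrightarrow> Tn n c j = Ctup n c j"
  by (simp add: Tn_def Ctup_def)

lemma measurable_Tn: "Tn n \<in> lbI (cube n) \<rightarrow>\<^sub>M borel"
proof (rule borel_measurable_coordinatewise3)
  fix j a b
  show "(\<lambda>c. Tn n c j a b) \<in> borel_measurable (lbI (cube n))"
  proof (cases "j \<in> {1..n}")
    case True
    then show ?thesis using measurable_Ctup[of n n j a b] by (simp add: Tn_Ctup)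
  next
    case False
    then have "Tn n c j = (\<lambda>_ _. 0)" for c by (simp only: Tn_def if_False)
    then show ?thesis by simp
  qed
qed

lemma measurable_coord: "(\<lambda>S :: nat \<Rightarrow> cmx. S j a b) \<in> borel_measurable borel"
proof (rule borel_measurable_continuous_onI)
  show "continuous_on UNIV (\<lambda>S :: nat \<Rightarrow> cmx. S j a b)"
    by (rule continuous_on_product_then_coordinatewise, rule continuous_on_product_then_coordinatewise,
        rule continuous_on_product_coordinates)
qed

lemma measurable_stat: "stat p k n \<in> borel \<rightarrow>\<^sub>M borel"
proof (rule borel_measurable_coordinatewise3)
  fix j a b :: nat
  have "(\<lambda>S. complex_of_real (sqrt (8 * real n * real p)) *
         (\<Sum>m=1..k. complex_of_real (Ainv k j m) *
            (S m a b - (if a = b then complex_of_real (s0 m) else 0)))) \<in> borel_measurable borel"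
    by (intro borel_measurable_times borel_measurable_const borel_measurable_sum borel_measurable_diff measurable_coord)
  then show "(\<lambda>S. stat p k n S j a b) \<in> borel_measurable borel"
    by (cases "j \<in> {1..k}"; cases "a < p \<and> b < p") (auto simp: stat_def)
qed

text \<open>In real coordinates \<open>Psi\<close> is triangular: \<open>psig\<close> is its strictly lower part and \<open>amat j j / 2\<close>
  its diagonal.\<close>

definition psig :: "nat \<times> nat \<times> nat \<Rightarrow> (nat \<times> nat \<times> nat \<Rightarrow> real) \<Rightarrow> real" where
  "psig = (\<lambda>(j, a, b) c. s0 j * (if a = b then 1 else 0) + (\<Sum>i\<in>{1..<j}. amat j i / 2 * c (i, a, b)))"

definition psic :: "nat \<Rightarrow> (nat \<times> nat \<times> nat \<Rightarrow> real) \<Rightarrow> nat \<times> nat \<times> nat \<Rightarrow> real" where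
  "psic n c = (\<lambda>i\<in>cube n. amat (fst i) (fst i) / 2 * c i + psig i c)"

lemma herm_of_coords_affine:
  "herm_of_coords p (\<lambda>il. s * e il + (\<Sum>i\<in>I. w i * f i il)) =
    csc s (herm_of_coords p e) + (\<Sum>i\<in>I. csc (w i) (herm_of_coords p (f i)))"
  by (intro ext) (auto simp: herm_of_coords_def csc_def sum_fun_apply complex_eq_iff sum_negf)

lemma herm_of_coords_delta: "herm_of_coords p (\<lambda>(a, b). if a = b then 1 else 0) = one"
  by (intro ext) (auto simp: herm_of_coords_def one_def complex_eq_iff)

lemma Tn_psic:
  assumes j: "j \<in> {1..n}"
  shows "Tn n (psic n c) j = Psi (Ctup n c) j"
proof -
  have split: "{1..j} = insert j {1..<j}" using j by auto
  have "Tn n (psic n c) j = herm_of_coords p (\<lambda>il. psic n c (j, il))"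
    using j by (simp add: Tn_def case_prod_unfold)
  also have "\<dots> = herm_of_coords p (\<lambda>il. s0 j * (case il of (a, b) \<Rightarrow> if a = b then 1 else 0) + (\<Sum>i=1..j. amat j i / 2 * c (i, il)))"
  proof (subst (1 2) herm_of_coords_restrict[symmetric], rule arg_cong[of _ _ "herm_of_coords p"], rule restrict_ext)
    fix il assume il: "il \<in> ibox p"
    then have "(j, il) \<in> cube n" using j by (simp add: cube_def)
    then show "psic n c (j, il) = s0 j * (case il of (a, b) \<Rightarrow> if a = b then 1 else 0) + (\<Sum>i=1..j. amat j i / 2 * c (i, il))"
      unfolding split by (cases il) (simp add: psic_def psig_def)
  qed
  also have "\<dots> = csc (s0 j) one + (\<Sum>i=1..j. csc (amat j i / 2) (herm_of_coords p (\<lambda>il. c (i, il))))"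
    unfolding herm_of_coords_affine herm_of_coords_delta ..
  also have "(\<Sum>i=1..j. csc (amat j i / 2) (herm_of_coords p (\<lambda>il. c (i, il)))) = (\<Sum>i=1..j. csc (amat j i / 2) (Ctup n c i))"
    using j by (intro sum.cong refl) (auto simp: Ctup_def case_prod_unfold)
  finally show ?thesis unfolding Psi_def .
qed

lemma Tn_psic_moment_space: "Tn n (psic n c) \<in> moment_space p n \<longleftrightarrow> tpsd n (Ctup n c)"
proof
  assume "Tn n (psic n c) \<in> moment_space p n"
  then obtain C where C: "htup C" "tpsd n C"
    and S: "\<And>j. Tn n (psic n c) j = (if j \<in> {1..n} then Psi C j else (\<lambda>_ _. 0))"
    unfolding moment_space_eq by blast
  have "C i = Ctup n c i" if "i \<le> n" for i
  proof (cases "i = 0")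
    case False
    then have i: "i \<in> {1..n}" using that by simp
    have "Psi_inv n (Tn n (psic n c)) i = C i" by (rule Psi_inv_Psi[OF i]) (simp add: S)
    moreover have "Psi_inv n (Tn n (psic n c)) i = Ctup n c i" by (rule Psi_inv_Psi[OF i]) (rule Tn_psic)
    ultimately show ?thesis by simp
  qed (use C htup_Ctup in \<open>simp add: htupD\<close>)
  then show "tpsd n (Ctup n c)" using C(2) tpsd_cong[of n C "Ctup n c"] by simp
next
  assume "tpsd n (Ctup n c)"
  then show "Tn n (psic n c) \<in> moment_space p n"
    unfolding moment_space_eq
  proof (intro exI[of _ "Ctup n c"] conjI htup_Ctup allI)
    show "Tn n (psic n c) j = (if j \<in> {1..n} then Psi (Ctup n c) j else (\<lambda>_ _. 0))" for j
      by (cases "j \<in> {1..n}") (simp_all only: Tn_psic if_True if_False, simp only: Tn_def if_False)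
  qed
qed

text \<open>8 n p is 4 times 2 n p, and the resulting 2 cancels the halves in \<open>Psi\<close>. By
  triangularity the first \<open>k\<close> moments involve only the leading k by k corner of A,
  which \<open>Ainv k\<close> undoes.\<close>

lemma stat_psic:
  assumes "k \<le> n"
  shows "stat p k n (Tn n (psic n c)) = Tn k (\<lambda>i. sqrt (2 * real n * real p) * c i)"
proof (intro ext)
  fix j a b
  show "stat p k n (Tn n (psic n c)) j a b = Tn k (\<lambda>i. sqrt (2 * real n * real p) * c i) j a b"
  proof (cases "j \<in> {1..k} \<and> a < p \<and> b < p")
    case True
    then have j: "j \<in> {1..k}" and ab: "a < p" "b < p" by auto
    let ?C = "Ctup n c"
    have sq: "sqrt (8 * real n * real p) = 2 * sqrt (2 * real n * real p)"
    proof -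
      have "8 * real n * real p = 4 * (2 * real n * real p)" by simp
      then show ?thesis by (simp only: real_sqrt_mult real_sqrt_four)
    qed
    have "stat p k n (Tn n (psic n c)) j a b = of_real (sqrt (8 * real n * real p)) *
       (\<Sum>m=1..k. of_real (Ainv k j m) * (Psi ?C m a b - of_real (s0 m) * one a b))"
      using j ab assms by (auto simp: stat_def Tn_psic one_def intro!: arg_cong[of _ _ "(*) _"] sum.cong)
    also have "\<dots> = of_real (sqrt (8 * real n * real p)) *
       (\<Sum>m=1..k. of_real (Ainv k j m) * (\<Sum>l=1..k. of_real (amat m l) * (?C l a b / 2)))"
      by (intro arg_cong[of _ _ "(*) _"] sum.cong refl) (simp add: Psi_entry[of _ k])
    also have "\<dots> = of_real (sqrt (2 * real n * real p)) * ?C j a b"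
      unfolding sum_Ainv_amat(1)[OF j] sq by simp
    also have "\<dots> = Tn k (\<lambda>i. sqrt (2 * real n * real p) * c i) j a b"
      using j ab assms by (auto simp: Ctup_def Tn_def herm_of_coords_def complex_eq_iff)
    finally show ?thesis .
  next
    case False
    then show ?thesis by (auto simp: stat_def Tn_def herm_of_coords_def)
  qed
qed

lemma measurable_psig:
  assumes "i \<in> cube n"
  shows "psig i \<in> borel_measurable (lbI (cube n))"
proof -
  obtain j a b where i: "i = (j, a, b)" "j \<in> {1..n}" "(a, b) \<in> ibox p" using assms by (auto simp: cube_def)
  have "(\<lambda>c. c (l, a, b)) \<in> borel_measurable (lbI (cube n))" if "l \<in> {1..<j}" for l
    using measurable_component_singleton[of "(l, a, b)" "cube n" "\<lambda>_. lborel :: real measure"] that i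
    by (auto simp: cube_def)
  then show ?thesis
    unfolding psig_def i by (auto intro!: borel_measurable_add borel_measurable_sum borel_measurable_times borel_measurable_const)
qed

lemma amat_diag: "1 \<le> j \<Longrightarrow> amat j j > 0"
  by (simp add: amat_def)

lemma nn_integral_psic:
  assumes F: "F \<in> borel_measurable (lbI (cube n))"
  shows "(\<integral>\<^sup>+c. F (psic n c) \<partial>lbI (cube n)) * ennreal (\<Prod>i\<in>cube n. \<bar>amat (fst i) (fst i) / 2\<bar>) = (\<integral>\<^sup>+c. F c \<partial>lbI (cube n))"
  unfolding psic_def
proof (rule nn_integral_PiM_triangular[where r = fst])
  fix i x y assume i: "i \<in> cube n" and xy: "\<And>j. j \<in> cube n \<Longrightarrow> fst j < fst i \<Longrightarrow> x j = (y j :: real)"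
  obtain j a b where ij: "i = (j, a, b)" "j \<in> {1..n}" "(a, b) \<in> ibox p" using i by (auto simp: cube_def)
  have "(\<Sum>l\<in>{1..<j}. amat j l / 2 * x (l, a, b)) = (\<Sum>l\<in>{1..<j}. amat j l / 2 * y (l, a, b))"
    using ij by (intro sum.cong refl arg_cong[of _ _ "(*) _"] xy) (auto simp: cube_def)
  then show "psig i x = psig i y" unfolding psig_def ij by simp
next
  fix i assume "i \<in> cube n"
  then have "amat (fst i) (fst i) > 0" by (intro amat_diag) (auto simp: cube_def)
  then show "amat (fst i) (fst i) / 2 \<noteq> 0" by simp
qed (use measurable_psig F in auto)

lemma measurable_psic: "psic n \<in> lbI (cube n) \<rightarrow>\<^sub>M lbI (cube n)"
  unfolding psic_def
proof (rule measurable_restrict)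
  fix i assume i: "i \<in> cube n"
  then have "(\<lambda>c. c i) \<in> borel_measurable (lbI (cube n))"
    using measurable_component_singleton[of i "cube n" "\<lambda>_. lborel :: real measure"] by simp
  then show "(\<lambda>c. amat (fst i) (fst i) / 2 * c i + psig i c) \<in> lbI (cube n) \<rightarrow>\<^sub>M lborel"
    unfolding measurable_lborel1
    by (intro borel_measurable_add borel_measurable_times borel_measurable_const measurable_psig[OF i])
qed

lemma sets_moment_space: "moment_space p n \<in> sets borel"
  using closed_moment_space by (rule borel_closed)

lemma sets_tpsd: "{c \<in> space (lbI (cube n)). tpsd n (Ctup n c)} \<in> sets (lbI (cube n))"
proof -
  have "(\<lambda>c. Tn n (psic n c)) \<in> lbI (cube n) \<rightarrow>\<^sub>M borel"
    by (rule measurable_compose[OF measurable_psic measurable_Tn])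
  from measurable_sets[OF this sets_moment_space[of n]] show ?thesis
    by (simp add: vimage_def Int_def Tn_psic_moment_space conj_commute)
qed

lemma sets_regular: "{c \<in> space (lbI (cube n)). regular n (Ctup n c)} \<in> sets (lbI (cube n))"
  by (rule measurable_regular) (auto intro: measurable_Ctup htup_Ctup)

lemma Ctup_restrict: "Ctup k (restrict x (cube k)) = Ctup k x"
proof
  fix j
  show "Ctup k (restrict x (cube k)) j = Ctup k x j"
    by (intro ext) (auto simp: Ctup_def herm_of_coords_def cube_def ibox_def)
qed

lemma Tn_restrict: "Tn k (restrict x (cube k)) = Tn k x"
proof
  fix j
  show "Tn k (restrict x (cube k)) j = Tn k x j"
    by (intro ext) (auto simp: Tn_def herm_of_coords_def cube_def ibox_def)
qed

text \<open>The positive semidefinite set is star-shaped and its dilations by \<open>t < 1\<close> lie in the positive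
  definite set, so the boundary is negligible.\<close>

lemma AE_tpsd_regular: "AE c in lbI (cube n). tpsd n (Ctup n c) \<longleftrightarrow> regular n (Ctup n c)"
proof -
  let ?M = "lbI (cube n)"
  define K where "K = {c \<in> space ?M. tpsd n (Ctup n c)}"
  define U where "U = {c \<in> space ?M. regular n (Ctup n c)}"
  have KM [measurable]: "K \<in> sets ?M" and UM [measurable]: "U \<in> sets ?M"
    unfolding K_def U_def by (rule sets_tpsd sets_regular)+
  have UK: "U \<subseteq> K" using posdef_tpsd[OF htup_Ctup] by (auto simp: K_def U_def regular_def)
  \<comment> \<open>\<open>dens n 0\<close> is the indicator of the regular set; integrating out all
    moments leaves \<open>L\<close> times an integral over a single point.\<close>
  have finU: "emeasure ?M U < \<infinity>"
  proof -
    obtain L where L1: "L < \<infinity>" and LF: "\<And>F. F \<in> borel_measurable (lbI (cube 0)) \<Longrightarrow>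
       (\<integral>\<^sup>+c. ennreal (dens n 0 (Ctup n c)) * F (restrict c (cube 0)) \<partial>lbI (cube n)) =
       L * (\<integral>\<^sup>+c. ennreal (dens 0 (0 + p * (n - 0)) (Ctup 0 c)) * F c \<partial>lbI (cube 0))"
      using fold_integral[OF le0[of n], of 0] by blast
    have L2: "(\<integral>\<^sup>+c. ennreal (dens n 0 (Ctup n c)) * 1 \<partial>lbI (cube n)) =
       L * (\<integral>\<^sup>+c. ennreal (dens 0 (0 + p * (n - 0)) (Ctup 0 c)) * 1 \<partial>lbI (cube 0))"
      by (rule LF[of "\<lambda>_. 1"]) simp
    have "emeasure ?M U = (\<integral>\<^sup>+c. indicator U c \<partial>?M)" by simp
    also have "\<dots> = (\<integral>\<^sup>+c. ennreal (dens n 0 (Ctup n c)) * 1 \<partial>lbI (cube n))"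
      by (intro nn_integral_cong) (auto simp: U_def dens_def indicator_def)
    also have "\<dots> = L * 1"
      unfolding L2 by (simp add: dens_def regular_def cube_def PiM_empty nn_integral_count_space_finite)
    finally show ?thesis using L1 by simp
  qed
  have le: "emeasure ?M K * ennreal (t ^ card (cube n)) \<le> emeasure ?M U" if t: "0 < t" "t < 1" for t
  proof -
    have "emeasure ?M K * ennreal (t ^ card (cube n)) \<le> (\<integral>\<^sup>+c. indicator U (\<lambda>i\<in>cube n. t * c i) \<partial>?M) * ennreal (\<bar>t\<bar> ^ card (cube n))"
    proof (rule mult_mono)
      have "emeasure ?M K = (\<integral>\<^sup>+c. indicator K c \<partial>?M)" by simp
      also have "\<dots> \<le> (\<integral>\<^sup>+c. indicator U (\<lambda>i\<in>cube n. t * c i) \<partial>?M)"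
      proof (rule nn_integral_mono)
        fix c assume "c \<in> space ?M"
        have "(\<lambda>i\<in>cube n. t * c i) \<in> U" if "c \<in> K"
        proof -
          have "regular n (tsc t (Ctup n c))"
            using tpsd_tsc_posdef[OF htup_Ctup _ less_imp_le[OF t(1)] t(2)] that by (auto simp: regular_def K_def)
          then have "regular n (Ctup n (\<lambda>i\<in>cube n. t * c i))"
            by (simp only: Ctup_restrict Ctup_scale)
          then show ?thesis by (simp add: U_def space_PiM)
        qed
        then show "indicator K c \<le> (indicator U (\<lambda>i\<in>cube n. t * c i) :: ennreal)"
          by (auto simp: indicator_def)
      qed
      finally show "emeasure ?M K \<le> (\<integral>\<^sup>+c. indicator U (\<lambda>i\<in>cube n. t * c i) \<partial>?M)" .
    qed (use t in auto)
    also have "\<dots> = (\<integral>\<^sup>+c. indicator U c \<partial>?M)"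
      by (rule nn_integral_PiM_scale) (use t in auto)
    finally show ?thesis by simp
  qed
  have finK: "emeasure ?M K < \<infinity>"
  proof (rule ccontr)
    assume "\<not> emeasure ?M K < \<infinity>"
    then have "emeasure ?M K = \<infinity>" by (simp add: less_top[symmetric])
    with le[of "1/2"] have "\<infinity> \<le> emeasure ?M U" by (simp add: ennreal_top_mult)
    then show False using finU by simp
  qed
  have "measure ?M K \<le> measure ?M U"
  proof (rule LIMSEQ_le_const2)
    \<comment> \<open>The double successor keeps \<open>t 0\<close> positive.\<close>
    define t where "t m = 1 - 1 / real (Suc (Suc m))" for m
    have "(\<lambda>m. 1 / real (Suc m)) \<longlonglongrightarrow> 0" using LIMSEQ_inverse_real_of_nat by (simp add: inverse_eq_divide)
    from LIMSEQ_Suc[OF this] have "t \<longlonglongrightarrow> 1 - 0" unfolding t_def by (intro tendsto_intros)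
    then have "(\<lambda>m. measure ?M K * t m ^ card (cube n)) \<longlonglongrightarrow> measure ?M K * 1 ^ card (cube n)"
      by (intro tendsto_intros) simp
    then show "(\<lambda>m. measure ?M K * t m ^ card (cube n)) \<longlonglongrightarrow> measure ?M K" by simp
    show "\<exists>N. \<forall>m\<ge>N. measure ?M K * t m ^ card (cube n) \<le> measure ?M U"
    proof (intro exI allI impI)
      fix m
      have t: "0 < t m" "t m < 1" by (auto simp: t_def)
      have "ennreal (measure ?M K * t m ^ card (cube n)) \<le> ennreal (measure ?M U)"
        using le[OF t] finK finU t
        by (simp add: emeasure_eq_ennreal_measure[of ?M] less_top[symmetric] ennreal_mult)
      then show "measure ?M K * t m ^ card (cube n) \<le> measure ?M U"
        by (simp add: ennreal_le_iff)
    qed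
  qed
  then have "emeasure ?M K \<le> emeasure ?M U"
    using finK finU by (simp add: emeasure_eq_ennreal_measure less_top[symmetric] ennreal_leI)
  then have "emeasure ?M (K - U) = 0"
    using emeasure_Diff[OF _ KM UM UK] finU emeasure_mono[OF UK KM] by (auto simp: less_top[symmetric])
  then have "AE c in ?M. c \<notin> K - U" by (intro AE_not_in) (auto simp: null_sets_def)
  with AE_space show ?thesis
    by eventually_elim (use UK in \<open>auto simp: K_def U_def\<close>)
qed

lemma measurable_dens_tsc: "(\<lambda>x. dens k m (tsc e (Ctup k x))) \<in> borel_measurable (lbI (cube k))"
proof (rule measurable_dens)
  fix j a b
  have "(\<lambda>x. of_real e * Ctup k x j a b) \<in> borel_measurable (lbI (cube k))"
    by (intro borel_measurable_times borel_measurable_const measurable_Ctup) simp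
  then show "(\<lambda>x. tsc e (Ctup k x) j a b) \<in> borel_measurable (lbI (cube k))"
    by (cases "j = 0") (simp_all add: tsc_def csc_def)
qed (intro htup_tsc htup_Ctup)

text \<open>\<open>psic\<close> passes to Chebyshev coordinates, \<open>AE_tpsd_regular\<close>
  replaces the indicator by \<open>dens n 0\<close>, \<open>fold_integral\<close> removes the
  moments beyond \<open>k\<close>, and a dilation absorbs the scale of the statistic.
  \<open>A\<close> collects Jacobians and constants, none of which depends on
  \<open>F\<close>.\<close>

lemma nn_integral_moment_space:
  assumes k: "k \<le> n" and n: "1 \<le> n" and p: "1 \<le> p"
  shows "\<exists>A. 0 < A \<and> A < \<infinity> \<and> (\<forall>F \<in> borel_measurable borel.
    (\<integral>\<^sup>+S. F (stat p k n S) * indicator (moment_space p n) S \<partial>leb_herm_tuple p n) =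
     A * (\<integral>\<^sup>+x. ennreal (dens k (p * (n - k)) (tsc (1 / sqrt (2 * real n * real p)) (Ctup k x))) * F (Tn k x) \<partial>lbI (cube k)))"
proof -
  define r where "r = sqrt (2 * real n * real p)"
  define e where "e = 1 / r"
  have r: "r > 0" using n p by (simp add: r_def)
  then have e: "e > 0" "r * e = 1" by (simp_all add: e_def)
  define \<kappa> where "\<kappa> = (\<Prod>i\<in>cube n. \<bar>amat (fst i) (fst i) / 2\<bar>)"
  have \<kappa>: "\<kappa> > 0"
    unfolding \<kappa>_def
  proof (rule prod_pos)
    fix i assume "i \<in> cube n"
    then have "amat (fst i) (fst i) > 0" by (intro amat_diag) (auto simp: cube_def)
    then show "0 < \<bar>amat (fst i) (fst i) / 2\<bar>" by simp
  qed
  obtain L where L: "0 < L" "L < \<infinity>" "\<And>F. F \<in> borel_measurable (lbI (cube k)) \<Longrightarrow>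
    (\<integral>\<^sup>+c. ennreal (dens n 0 (Ctup n c)) * F (restrict c (cube k)) \<partial>lbI (cube n)) =
     L * (\<integral>\<^sup>+c. ennreal (dens k (0 + p * (n - k)) (Ctup k c)) * F c \<partial>lbI (cube k))"
    using fold_integral[OF k, of 0] by blast
  define d where "d = ennreal (e ^ card (cube k))"
  have d: "0 < d" "d < \<infinity>" using e by (simp_all add: d_def)
  have main: "(\<integral>\<^sup>+S. F (stat p k n S) * indicator (moment_space p n) S \<partial>leb_herm_tuple p n) =
     ennreal \<kappa> * L * d * (\<integral>\<^sup>+x. ennreal (dens k (p * (n - k)) (tsc e (Ctup k x))) * F (Tn k x) \<partial>lbI (cube k))"
    if F: "F \<in> borel_measurable borel" for F :: "(nat \<Rightarrow> cmx) \<Rightarrow> ennreal"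
  proof -
    have FS: "(\<lambda>S. F (stat p k n S) * indicator (moment_space p n) S) \<in> borel_measurable borel"
      by (intro borel_measurable_times_ennreal borel_measurable_indicator measurable_compose[OF measurable_stat F] sets_moment_space)
    have scm: "(\<lambda>c. \<lambda>i\<in>cube k. r * c i) \<in> lbI (cube k) \<rightarrow>\<^sub>M lbI (cube k)"
    proof (rule measurable_restrict)
      fix i assume "i \<in> cube k"
      then have "(\<lambda>c. c i) \<in> borel_measurable (lbI (cube k))"
        using measurable_component_singleton[of i "cube k" "\<lambda>_. lborel :: real measure"] by simp
      then show "(\<lambda>c. r * c i) \<in> lbI (cube k) \<rightarrow>\<^sub>M lborel"
        unfolding measurable_lborel1 by (intro borel_measurable_times borel_measurable_const)
    qed
    have Tr: "Tn k (\<lambda>i\<in>cube k. r * c i) = Tn k (\<lambda>i. r * c i)" for c by (rule Tn_restrict)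
    have FT: "(\<lambda>c. F (Tn k (\<lambda>i. r * c i))) \<in> borel_measurable (lbI (cube k))"
      using measurable_compose[OF scm measurable_compose[OF measurable_Tn F]] by (simp only: Tr)
    have dm: "(\<lambda>c. dens k (p * (n - k)) (Ctup k c)) \<in> borel_measurable (lbI (cube k))"
      by (rule measurable_dens) (auto intro: measurable_Ctup htup_Ctup)
    have "(\<integral>\<^sup>+S. F (stat p k n S) * indicator (moment_space p n) S \<partial>leb_herm_tuple p n) =
      (\<integral>\<^sup>+c. F (stat p k n (Tn n c)) * indicator (moment_space p n) (Tn n c) \<partial>lbI (cube n))"
      unfolding leb_herm_tuple_eq by (rule nn_integral_distr[OF measurable_Tn]) (use FS in simp)
    also have "\<dots> = (\<integral>\<^sup>+c. F (stat p k n (Tn n (psic n c))) * indicator (moment_space p n) (Tn n (psic n c)) \<partial>lbI (cube n)) * ennreal \<kappa>"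
      unfolding \<kappa>_def by (rule nn_integral_psic[symmetric]) (rule measurable_compose[OF measurable_Tn FS])
    also have "(\<integral>\<^sup>+c. F (stat p k n (Tn n (psic n c))) * indicator (moment_space p n) (Tn n (psic n c)) \<partial>lbI (cube n)) =
       (\<integral>\<^sup>+c. ennreal (dens n 0 (Ctup n c)) * F (Tn k (\<lambda>i. r * restrict c (cube k) i)) \<partial>lbI (cube n))"
    proof (rule nn_integral_cong_AE, use AE_tpsd_regular[of n] in eventually_elim)
      fix c assume *: "tpsd n (Ctup n c) \<longleftrightarrow> regular n (Ctup n c)"
      have "Tn k (\<lambda>i. r * restrict c (cube k) i) = Tn k (\<lambda>i. r * c i)"
      proof -
        have "Tn k (\<lambda>i. r * restrict c (cube k) i) = Tn k (\<lambda>i\<in>cube k. r * c i)"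
          by (subst Tn_restrict[symmetric]) (intro arg_cong[of _ _ "Tn k"] restrict_ext, simp)
        then show ?thesis by (simp only: Tr)
      qed
      then show "F (stat p k n (Tn n (psic n c))) * indicator (moment_space p n) (Tn n (psic n c)) =
         ennreal (dens n 0 (Ctup n c)) * F (Tn k (\<lambda>i. r * restrict c (cube k) i))"
        using * by (simp add: stat_psic[OF k] r_def[symmetric] dens_def indicator_def Tn_psic_moment_space)
    qed
    also have "\<dots> = L * (\<integral>\<^sup>+c. ennreal (dens k (p * (n - k)) (Ctup k c)) * F (Tn k (\<lambda>i. r * c i)) \<partial>lbI (cube k))"
      using L(3)[OF FT] by simp
    also have "(\<integral>\<^sup>+c. ennreal (dens k (p * (n - k)) (Ctup k c)) * F (Tn k (\<lambda>i. r * c i)) \<partial>lbI (cube k)) =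
       (\<integral>\<^sup>+x. ennreal (dens k (p * (n - k)) (Ctup k (\<lambda>i\<in>cube k. e * x i))) * F (Tn k (\<lambda>i. r * (\<lambda>i\<in>cube k. e * x i) i)) \<partial>lbI (cube k)) * ennreal (\<bar>e\<bar> ^ card (cube k))"
      by (rule nn_integral_PiM_scale[symmetric]) (use e FT dm in auto)
    also have "(\<integral>\<^sup>+x. ennreal (dens k (p * (n - k)) (Ctup k (\<lambda>i\<in>cube k. e * x i))) * F (Tn k (\<lambda>i. r * (\<lambda>i\<in>cube k. e * x i) i)) \<partial>lbI (cube k)) =
       (\<integral>\<^sup>+x. ennreal (dens k (p * (n - k)) (tsc e (Ctup k x))) * F (Tn k x) \<partial>lbI (cube k))"
    proof (rule nn_integral_cong)
      fix x :: "nat \<times> nat \<times> nat \<Rightarrow> real"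
      have "Tn k (\<lambda>i. r * (\<lambda>i\<in>cube k. e * x i) i) = Tn k x"
      proof -
        have "Tn k (\<lambda>i. r * (\<lambda>i\<in>cube k. e * x i) i) = Tn k (restrict x (cube k))"
          by (subst Tn_restrict[symmetric]) (intro arg_cong[of _ _ "Tn k"] restrict_ext, use e(2) in \<open>simp add: mult.assoc[symmetric]\<close>)
        then show ?thesis by (simp only: Tn_restrict)
      qed
      then show "ennreal (dens k (p * (n - k)) (Ctup k (\<lambda>i\<in>cube k. e * x i))) * F (Tn k (\<lambda>i. r * (\<lambda>i\<in>cube k. e * x i) i)) =
         ennreal (dens k (p * (n - k)) (tsc e (Ctup k x))) * F (Tn k x)"
        by (simp only: Ctup_restrict Ctup_scale)
    qed
    finally show ?thesis using e by (simp add: d_def mult_ac)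
  qed
  have "0 < ennreal \<kappa> * L * d" "ennreal \<kappa> * L * d < \<infinity>"
    using \<kappa> L d by (auto simp: ennreal_zero_less_mult_iff ennreal_mult_less_top)
  then show ?thesis using main unfolding e_def r_def by blast
qed

section \<open>Convergence to the Gaussian unitary ensemble\<close>

definition wt :: "nat \<times> nat \<Rightarrow> real" where
  "wt ij = (if fst ij = snd ij then 1 else 2)"

text \<open>An off-diagonal coordinate enters tr X^2 with weight 2, so its variance is 1/2.\<close>

definition sdev :: "nat \<times> nat \<Rightarrow> real" where
  "sdev ij = (if fst ij = snd ij then 1 else 1 / sqrt 2)"

definition gdens :: "nat \<times> nat \<Rightarrow> real \<Rightarrow> real" where
  "gdens ij = normal_density 0 (sdev ij)"

lemma gdens_eq: "gdens ij x = (if fst ij = snd ij then (2 * pi) powr (- 1 / 2) else pi powr (- 1 / 2)) * exp (- wt ij * x\<^sup>2 / 2)"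
  by (simp add: gdens_def normal_density_def sdev_def wt_def power_divide powr_minus_divide powr_half_sqrt field_simps)

text \<open>The p diagonal factors (2 pi)^(-1/2) and the p (p - 1) off-diagonal factors pi^(-1/2)
  multiply to the GUE constant.\<close>

lemma prod_gdens:
  assumes "1 \<le> p"
  shows "(\<Prod>ij\<in>ibox p. gdens ij (c ij)) = gue_const p * exp (- (\<Sum>ij\<in>ibox p. wt ij * (c ij)\<^sup>2) / 2)"
proof -
  have "(\<Prod>ij\<in>ibox p. (if fst ij = snd ij then (2 * pi) powr (- 1 / 2) else pi powr (- 1 / 2))) =
     (\<Prod>i<p. \<Prod>j<p. if i = j then (2 * pi) powr (- 1 / 2) else pi powr (- 1 / 2))"
    unfolding ibox_def prod.cartesian_product by (intro prod.cong refl) auto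
  also have "\<dots> = (\<Prod>i<p. (2 * pi) powr (- 1 / 2) * (pi powr (- 1 / 2)) ^ (p - 1))"
  proof (intro prod.cong refl)
    fix i assume "i \<in> {..<p}"
    then have i: "i < p" by simp
    have "(\<Prod>j<p. if i = j then (2 * pi) powr (- 1 / 2) else pi powr (- 1 / 2)) =
       (2 * pi) powr (- 1 / 2) * (\<Prod>j\<in>{..<p} - {i}. if i = j then (2 * pi) powr (- 1 / 2) else pi powr (- 1 / 2))"
      using i by (subst prod.remove[of _ i]) auto
    also have "(\<Prod>j\<in>{..<p} - {i}. if i = j then (2 * pi) powr (- 1 / 2) else pi powr (- 1 / 2)) = (\<Prod>j\<in>{..<p} - {i}. pi powr (- 1 / 2))"
      by (intro prod.cong) auto
    finally show "(\<Prod>j<p. if i = j then (2 * pi) powr (- 1 / 2) else pi powr (- 1 / 2)) = (2 * pi) powr (- 1 / 2) * (pi powr (- 1 / 2)) ^ (p - 1)"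
      using i by simp
  qed
  also have "\<dots> = ((2 * pi) powr (- 1 / 2)) ^ p * (pi powr (- 1 / 2)) ^ ((p - 1) * p)"
    by (simp add: power_mult_distrib power_mult)
  also have "((2 * pi) powr (- 1 / 2)) ^ p = (2 * pi) powr (- real p / 2)"
    by (simp add: powr_power)
  also have "(pi powr (- 1 / 2)) ^ ((p - 1) * p) = pi powr (- real p * (real p - 1) / 2)"
  proof -
    have "- 1 / 2 * real ((p - 1) * p) = - real p * (real p - 1) / 2"
      using assms by (simp add: of_nat_diff)
    moreover have "(pi powr (- 1 / 2)) ^ ((p - 1) * p) = pi powr (- 1 / 2 * real ((p - 1) * p))"
      by (subst powr_power) auto
    ultimately show ?thesis by (rule subst)
  qed
  finally show ?thesis
    unfolding gdens_eq prod.distrib exp_sum[OF finite_ibox, symmetric] gue_const_def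
    by (simp add: sum_negf sum_divide_distrib)
qed

lemma tr_sq_herm: "tr_sq p (herm_of_coords p c) = (\<Sum>ij\<in>ibox p. wt ij * (c ij)\<^sup>2)"
  using ftr_herm_sq[of c] by (simp add: tr_sq_def ftr_def mm_def wt_def)

lemma measurable_gdens: "gdens ij \<in> borel_measurable lborel"
  by (simp add: gdens_def)

lemma gdens_nonneg: "0 \<le> gdens ij x"
  by (simp add: gdens_def)

lemma nn_integral_gdens: "(\<integral>\<^sup>+x. ennreal (gdens ij x) \<partial>lborel) = 1"
proof -
  have s: "0 < sdev ij" by (simp add: sdev_def)
  show ?thesis
    unfolding gdens_def
    by (subst nn_integral_eq_integral) (simp_all add: integrable_normal_density[OF s] integral_normal_density[OF s])
qed

text \<open>\<open>f\<close> tells to which matrix position a coordinate belongs: \<open>id\<close>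
  for one matrix, \<open>snd\<close> for a tuple of matrices.\<close>

definition Gd :: "'i set \<Rightarrow> ('i \<Rightarrow> nat \<times> nat) \<Rightarrow> ('i \<Rightarrow> real) \<Rightarrow> real" where
  "Gd I f x = (\<Prod>i\<in>I. gdens (f i) (x i))"

lemma Gd_nonneg: "0 \<le> Gd I f x"
  unfolding Gd_def by (intro prod_nonneg gdens_nonneg)

lemma measurable_Gd: "Gd I f \<in> borel_measurable (lbI I)"
  unfolding Gd_def
proof (rule borel_measurable_prod)
  fix i assume i: "i \<in> I"
  show "(\<lambda>x. gdens (f i) (x i)) \<in> borel_measurable (lbI I)"
    by (rule measurable_compose[OF measurable_component_singleton[OF i] measurable_gdens])
qed

lemma nn_integral_Gd: "finite I \<Longrightarrow> (\<integral>\<^sup>+x. ennreal (Gd I f x) \<partial>lbI I) = 1"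
proof -
  assume I: "finite I"
  have "(\<integral>\<^sup>+x. ennreal (Gd I f x) \<partial>lbI I) = (\<integral>\<^sup>+x. (\<Prod>i\<in>I. ennreal (gdens (f i) (x i))) \<partial>lbI I)"
    unfolding Gd_def by (simp add: prod_ennreal gdens_nonneg)
  also have "\<dots> = (\<Prod>i\<in>I. \<integral>\<^sup>+x. ennreal (gdens (f i) x) \<partial>lborel)"
    by (rule lb.product_nn_integral_prod[OF I]) (use measurable_gdens in simp)
  finally show ?thesis by (simp add: nn_integral_gdens)
qed

lemma measurable_herm: "herm_of_coords p \<in> lbI (ibox p) \<rightarrow>\<^sub>M borel"
  by (rule measurable_coordinatewise_then_product, rule measurable_coordinatewise_then_product,
      rule measurable_herm_of_coords)

lemma GUE_eq:
  assumes "1 \<le> p"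
  shows "GUE p = distr (density (lbI (ibox p)) (\<lambda>c. ennreal (Gd (ibox p) id c))) borel (herm_of_coords p)"
  unfolding GUE_def ibox_def[symmetric] tr_sq_herm
  by (simp add: Gd_def prod_gdens[OF assms])

lemma emeasure_GUE:
  assumes "1 \<le> p" "A \<in> sets borel"
  shows "emeasure (GUE p) A = (\<integral>\<^sup>+c. ennreal (Gd (ibox p) id c) * indicator A (herm_of_coords p c) \<partial>lbI (ibox p))"
proof -
  have "herm_of_coords p -` A \<inter> space (lbI (ibox p)) \<in> sets (lbI (ibox p))"
    by (rule measurable_sets[OF measurable_herm assms(2)])
  then show ?thesis
    unfolding GUE_eq[OF assms(1)] using measurable_herm measurable_Gd[of "ibox p" id] assms(2)
    by (subst emeasure_distr) (auto simp: emeasure_density intro!: nn_integral_cong split: split_indicator)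
qed

lemma prob_space_GUE: "1 \<le> p \<Longrightarrow> prob_space (GUE p)"
proof (rule prob_spaceI)
  assume p: "1 \<le> p"
  have "space (GUE p) = UNIV" by (simp add: GUE_def)
  then show "emeasure (GUE p) (space (GUE p)) = 1"
    using emeasure_GUE[OF p, of UNIV] nn_integral_Gd[OF finite_ibox, of p id] by simp
qed

lemma nn_integral_cube_prod:
  assumes \<phi>: "\<And>j. \<phi> j \<in> borel_measurable (lbI (ibox p))"
  shows "(\<integral>\<^sup>+x. (\<Prod>j\<in>{1..k}. \<phi> j (\<lambda>il\<in>ibox p. x (j, il))) \<partial>lbI (cube k)) = (\<Prod>j\<in>{1..k}. \<integral>\<^sup>+c. \<phi> j c \<partial>lbI (ibox p))"
proof (induction k)
  case 0
  then show ?case by (simp add: cube_def PiM_empty nn_integral_count_space_finite)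
next
  case (Suc k)
  let ?J = "{Suc k} \<times> ibox p"
  let ?m = "\<lambda>x y. merge (cube k) ?J (x, y)"
  have comp: "(\<lambda>x. \<phi> j (\<lambda>il\<in>ibox p. x (j, il))) \<in> borel_measurable (lbI I)" if "{j} \<times> ibox p \<subseteq> I" for j I
    by (rule measurable_compose[OF _ \<phi>], rule measurable_restrict, rule measurable_component_singleton) (use that in auto)
  have m: "(\<lambda>x. \<Prod>j\<in>{1..Suc k}. \<phi> j (\<lambda>il\<in>ibox p. x (j, il))) \<in> borel_measurable (lbI (cube (Suc k)))"
    by (intro borel_measurable_prod_ennreal comp) (auto simp: cube_def)
  have "(\<integral>\<^sup>+x. (\<Prod>j\<in>{1..Suc k}. \<phi> j (\<lambda>il\<in>ibox p. x (j, il))) \<partial>lbI (cube (Suc k))) =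
    (\<integral>\<^sup>+x. (\<integral>\<^sup>+y. (\<Prod>j\<in>{1..Suc k}. \<phi> j (\<lambda>il\<in>ibox p. ?m x y (j, il))) \<partial>lbI ?J) \<partial>lbI (cube k))"
    unfolding cube_Suc(1)
    by (rule lb.product_nn_integral_fold) (use cube_Suc(2) m in \<open>auto simp: cube_Suc(1)\<close>)
  also have "\<dots> = (\<integral>\<^sup>+x. (\<integral>\<^sup>+y. (\<Prod>j\<in>{1..k}. \<phi> j (\<lambda>il\<in>ibox p. x (j, il))) * \<phi> (Suc k) (\<lambda>il\<in>ibox p. y (Suc k, il)) \<partial>lbI ?J) \<partial>lbI (cube k))"
  proof (intro nn_integral_cong)
    fix x y :: "nat \<times> nat \<times> nat \<Rightarrow> real"
    have 1: "(\<lambda>il\<in>ibox p. ?m x y (j, il)) = (\<lambda>il\<in>ibox p. x (j, il))" if "j \<in> {1..k}" for j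
      using that by (intro restrict_ext) (auto simp: merge_def cube_def)
    have 2: "(\<lambda>il\<in>ibox p. ?m x y (Suc k, il)) = (\<lambda>il\<in>ibox p. y (Suc k, il))"
      by (intro restrict_ext) (auto simp: merge_def cube_def)
    have "(\<Prod>j\<in>{1..Suc k}. \<phi> j (\<lambda>il\<in>ibox p. ?m x y (j, il))) =
       (\<Prod>j\<in>{1..k}. \<phi> j (\<lambda>il\<in>ibox p. ?m x y (j, il))) * \<phi> (Suc k) (\<lambda>il\<in>ibox p. ?m x y (Suc k, il))"
      by simp
    also have "(\<Prod>j\<in>{1..k}. \<phi> j (\<lambda>il\<in>ibox p. ?m x y (j, il))) = (\<Prod>j\<in>{1..k}. \<phi> j (\<lambda>il\<in>ibox p. x (j, il)))"
      by (intro prod.cong refl) (simp only: 1)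
    finally show "(\<Prod>j\<in>{1..Suc k}. \<phi> j (\<lambda>il\<in>ibox p. ?m x y (j, il))) =
       (\<Prod>j\<in>{1..k}. \<phi> j (\<lambda>il\<in>ibox p. x (j, il))) * \<phi> (Suc k) (\<lambda>il\<in>ibox p. y (Suc k, il))"
      by (simp only: 2)
  qed
  also have "\<dots> = (\<integral>\<^sup>+x. (\<Prod>j\<in>{1..k}. \<phi> j (\<lambda>il\<in>ibox p. x (j, il))) * (\<integral>\<^sup>+y. \<phi> (Suc k) (\<lambda>il\<in>ibox p. y (Suc k, il)) \<partial>lbI ?J) \<partial>lbI (cube k))"
    by (intro nn_integral_cong nn_integral_cmult comp) auto
  also have "\<dots> = (\<integral>\<^sup>+x. (\<Prod>j\<in>{1..k}. \<phi> j (\<lambda>il\<in>ibox p. x (j, il))) \<partial>lbI (cube k)) * (\<integral>\<^sup>+y. \<phi> (Suc k) (\<lambda>il\<in>ibox p. y (Suc k, il)) \<partial>lbI ?J)"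
    by (intro nn_integral_multc borel_measurable_prod_ennreal comp) (auto simp: cube_def)
  also have "(\<integral>\<^sup>+y. \<phi> (Suc k) (\<lambda>il\<in>ibox p. y (Suc k, il)) \<partial>lbI ?J) = (\<integral>\<^sup>+c. \<phi> (Suc k) c \<partial>lbI (ibox p))"
  proof -
    have J: "?J = Pair (Suc k) ` ibox p" by auto
    show ?thesis unfolding J by (rule nn_integral_PiM_reindex[OF finite_ibox _ \<phi>]) (auto simp: inj_on_def)
  qed
  finally show ?case unfolding Suc.IH by simp
qed

lemma Gd_cube: "Gd (cube k) snd x = (\<Prod>j\<in>{1..k}. Gd (ibox p) id (\<lambda>il\<in>ibox p. x (j, il)))"
proof -
  have "Gd (cube k) snd x = (\<Prod>j\<in>{1..k}. \<Prod>il\<in>ibox p. gdens il (x (j, il)))"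
    unfolding Gd_def cube_def prod.cartesian_product by (intro prod.cong refl) auto
  then show ?thesis by (simp add: Gd_def)
qed

text \<open>The product measure is recognised on boxes: the coordinates split into slices, one for
  each matrix, over which the Gaussian density factorises.\<close>

lemma GUE_vec_eq:
  assumes p: "1 \<le> p"
  shows "GUE_vec p k = distr (density (lbI (cube k)) (\<lambda>x. ennreal (Gd (cube k) snd x))) borel (Tn k)"
proof -
  interpret G: product_sigma_finite "\<lambda>_ :: nat. GUE p"
    using prob_space_imp_sigma_finite[OF prob_space_GUE[OF p]] by (simp add: product_sigma_finite_def)
  let ?N = "density (lbI (cube k)) (\<lambda>x. ennreal (Gd (cube k) snd x))"
  let ?B = "PiM {1..k} (\<lambda>_. borel :: cmx measure)"
  let ?H = "\<lambda>x. \<lambda>j\<in>{1..k}. herm_of_coords p (\<lambda>il\<in>ibox p. x (j, il))"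
  let ?pad = "\<lambda>G j. if j \<in> {1..k} then G j else (\<lambda>_ _. 0 :: complex)"
  have H: "?H \<in> lbI (cube k) \<rightarrow>\<^sub>M ?B"
  proof (rule measurable_restrict)
    fix j assume "j \<in> {1..k}"
    then show "(\<lambda>x. herm_of_coords p (\<lambda>il\<in>ibox p. x (j, il))) \<in> borel_measurable (lbI (cube k))"
      by (intro measurable_compose[OF _ measurable_herm] measurable_restrict measurable_component_singleton) (auto simp: cube_def)
  qed
  then have HN: "?H \<in> ?N \<rightarrow>\<^sub>M ?B" by simp
  have sG: "sets (GUE p) = sets borel" by (simp add: GUE_def)
  have eq: "distr ?N ?B ?H = PiM {1..k} (\<lambda>_. GUE p)"
  proof (rule G.PiM_eqI)
    show "sets (distr ?N ?B ?H) = sets (PiM {1..k} (\<lambda>_. GUE p))"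
      using sG by (simp cong: sets_PiM_cong)
    fix A assume "\<And>j. j \<in> {1..k} \<Longrightarrow> A j \<in> sets (GUE p)"
    then have A: "\<And>j. j \<in> {1..k} \<Longrightarrow> A j \<in> sets borel" by (simp add: sG)
    define A' where "A' j = (if j \<in> {1..k} then A j else UNIV)" for j
    have A': "A' j \<in> sets borel" for j using A by (auto simp: A'_def)
    define \<phi> where "\<phi> j c = ennreal (Gd (ibox p) id c) * indicator (A' j) (herm_of_coords p c)" for j c
    have \<phi>: "\<phi> j \<in> borel_measurable (lbI (ibox p))" for j
      unfolding \<phi>_def using measurable_Gd[of "ibox p" id]
      by (intro borel_measurable_times_ennreal measurable_compose[OF measurable_herm borel_measurable_indicator] A') simp
    have PA: "Pi\<^sub>E {1..k} A \<in> sets ?B" using A by (intro sets_PiM_I_finite) auto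
    have "emeasure (distr ?N ?B ?H) (Pi\<^sub>E {1..k} A) = emeasure ?N (?H -` Pi\<^sub>E {1..k} A \<inter> space (lbI (cube k)))"
      by (subst emeasure_distr[OF HN PA]) simp
    also have "\<dots> = (\<integral>\<^sup>+x. ennreal (Gd (cube k) snd x) * indicator (?H -` Pi\<^sub>E {1..k} A \<inter> space (lbI (cube k))) x \<partial>lbI (cube k))"
      using measurable_sets[OF H PA] measurable_Gd[of "cube k" snd] by (intro emeasure_density) auto
    also have "\<dots> = (\<integral>\<^sup>+x. (\<Prod>j\<in>{1..k}. \<phi> j (\<lambda>il\<in>ibox p. x (j, il))) \<partial>lbI (cube k))"
    proof (rule nn_integral_cong)
      fix x assume x: "x \<in> space (lbI (cube k))"
      have ind: "(indicator (?H -` Pi\<^sub>E {1..k} A \<inter> space (lbI (cube k))) x :: ennreal) =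
         (\<Prod>j\<in>{1..k}. indicator (A' j) (herm_of_coords p (\<lambda>il\<in>ibox p. x (j, il))))"
      proof (cases "\<forall>j\<in>{1..k}. herm_of_coords p (\<lambda>il\<in>ibox p. x (j, il)) \<in> A j")
        case True
        then show ?thesis using x by (auto simp: A'_def PiE_def indicator_def intro!: prod.neutral[symmetric])
      next
        case False
        then obtain j where j: "j \<in> {1..k}" "herm_of_coords p (\<lambda>il\<in>ibox p. x (j, il)) \<notin> A j" by blast
        then have "?H x \<notin> Pi\<^sub>E {1..k} A" by (auto simp: PiE_iff)
        moreover have "(\<Prod>j\<in>{1..k}. indicator (A' j) (herm_of_coords p (\<lambda>il\<in>ibox p. x (j, il)))) = (0 :: ennreal)"
          using j by (intro prod_zero bexI[of _ j]) (auto simp: A'_def)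
        ultimately show ?thesis by (simp add: indicator_def)
      qed
      show "ennreal (Gd (cube k) snd x) * indicator (?H -` Pi\<^sub>E {1..k} A \<inter> space (lbI (cube k))) x =
         (\<Prod>j\<in>{1..k}. \<phi> j (\<lambda>il\<in>ibox p. x (j, il)))"
        unfolding ind \<phi>_def prod.distrib Gd_cube by (simp add: prod_ennreal Gd_nonneg)
    qed
    also have "\<dots> = (\<Prod>j\<in>{1..k}. \<integral>\<^sup>+c. \<phi> j c \<partial>lbI (ibox p))" by (rule nn_integral_cube_prod[OF \<phi>])
    also have "\<dots> = (\<Prod>j\<in>{1..k}. emeasure (GUE p) (A j))"
    proof (rule prod.cong[OF refl])
      fix j assume j: "j \<in> {1..k}"
      show "(\<integral>\<^sup>+c. \<phi> j c \<partial>lbI (ibox p)) = emeasure (GUE p) (A j)"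
        unfolding \<phi>_def emeasure_GUE[OF p A[OF j]] using j by (simp add: A'_def)
    qed
    finally show "emeasure (distr ?N ?B ?H) (Pi\<^sub>E {1..k} A) = (\<Prod>j\<in>{1..k}. emeasure (GUE p) (A j))" .
  qed simp
  have pad: "?pad \<in> ?B \<rightarrow>\<^sub>M borel"
  proof (rule borel_measurable_coordinatewise3)
    fix j a b
    show "(\<lambda>G. ?pad G j a b) \<in> borel_measurable ?B"
    proof (cases "j \<in> {1..k}")
      case True
      have "(\<lambda>X :: cmx. X a b) \<in> borel_measurable borel"
        by (intro borel_measurable_continuous_onI, rule continuous_on_product_then_coordinatewise, rule continuous_on_product_coordinates)
      from measurable_compose[OF measurable_component_singleton[OF True] this] show ?thesis using True by simp
    qed (simp only: if_False, simp)
  qed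
  have "GUE_vec p k = distr (distr ?N ?B ?H) borel ?pad"
    unfolding GUE_vec_def eq ..
  also have "\<dots> = distr ?N borel (?pad \<circ> ?H)" by (rule distr_distr[OF pad HN])
  also have "?pad \<circ> ?H = Tn k"
    by (intro ext) (auto simp: Tn_def herm_of_coords_restrict case_prod_unfold)
  finally show ?thesis .
qed

definition qsum :: "nat \<Rightarrow> (nat \<times> nat \<times> nat \<Rightarrow> real) \<Rightarrow> real" where
  "qsum k x = (\<Sum>i\<in>cube k. wt (snd i) * (x i)\<^sup>2)"

lemma qsum_eq: "(\<Sum>l=1..k. Re (ftr (Ctup k x l \<diamondop> Ctup k x l))) = qsum k x"
proof -
  have "(\<Sum>l=1..k. Re (ftr (Ctup k x l \<diamondop> Ctup k x l))) = (\<Sum>l=1..k. \<Sum>ij\<in>ibox p. wt ij * (x (l, ij))\<^sup>2)"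
  proof (intro sum.cong refl)
    fix l assume "l \<in> {1..k}"
    then have "Ctup k x l = herm_of_coords p (\<lambda>ij. x (l, ij))" by (simp add: Ctup_def case_prod_unfold)
    then show "Re (ftr (Ctup k x l \<diamondop> Ctup k x l)) = (\<Sum>ij\<in>ibox p. wt ij * (x (l, ij))\<^sup>2)"
      by (simp add: ftr_herm_sq wt_def)
  qed
  also have "\<dots> = qsum k x" unfolding qsum_def cube_def sum.cartesian_product by (intro sum.cong refl) auto
  finally show ?thesis .
qed

lemma qsum_nonneg: "0 \<le> qsum k x"
  unfolding qsum_def by (intro sum_nonneg) (auto simp: wt_def)

lemma Gd_qsum: "\<exists>\<gamma>>0. \<forall>x. Gd (cube k) snd x = \<gamma> * exp (- qsum k x / 2)"
proof -
  define g where "g i = (if fst (snd i) = snd (snd i) then (2 * pi) powr (- 1 / 2) else pi powr (- 1 / 2))" for i :: "nat \<times> nat \<times> nat"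
  have "Gd (cube k) snd x = (\<Prod>i\<in>cube k. g i) * exp (- qsum k x / 2)" for x
    unfolding Gd_def gdens_eq prod.distrib exp_sum[OF finite_cube, symmetric] qsum_def g_def
    by (simp add: sum_negf sum_divide_distrib)
  moreover have "0 < (\<Prod>i\<in>cube k. g i)" by (intro prod_pos) (auto simp: g_def)
  ultimately show ?thesis by blast
qed

lemma integrable_exp_qsum:
  assumes "a > 0"
  shows "integrable (lbI (cube k)) (\<lambda>x. exp (- a * qsum k x))"
proof -
  have "integrable (lbI (cube k)) (\<lambda>x. \<Prod>i\<in>cube k. exp (- (a * wt (snd i)) * (x i)\<^sup>2))"
    by (rule lb.product_integrable_prod[OF finite_cube]) (rule integrable_exp_neg_square, use assms in \<open>simp add: wt_def\<close>)
  moreover have "(\<Prod>i\<in>cube k. exp (- (a * wt (snd i)) * (x i)\<^sup>2)) = exp (- a * qsum k x)" for x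
    by (simp add: exp_sum[OF finite_cube, symmetric] qsum_def sum_negf sum_distrib_left mult.assoc)
  ultimately show ?thesis by simp
qed

section \<open>Dominated convergence of the rescaled densities\<close>

definition rate :: "nat \<Rightarrow> real" where
  "rate n = 1 / sqrt (2 * real n * real p)"

definition gn :: "nat \<Rightarrow> nat \<Rightarrow> (nat \<times> nat \<times> nat \<Rightarrow> real) \<Rightarrow> real" where
  "gn k n x = dens k (p * (n - k)) (tsc (rate n) (Ctup k x))"

text \<open>From n \<ge> 2 k follows n - k \<ge> n / 2, so p (n - k) / k times 1 / (2 n p) is at
  least 1 / (4 k), which gives a majorant free of n.\<close>

lemma gn_le:
  assumes p: "1 \<le> p" and k: "1 \<le> k" and n: "2 * k \<le> n"
  shows "gn k n x \<le> exp (- (1 / (4 * real k)) * qsum k x)"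
proof -
  let ?C = "tsc (rate n) (Ctup k x)"
  have C: "htup ?C" by (intro htup_tsc htup_Ctup)
  have r2: "(rate n)\<^sup>2 = 1 / (2 * real n * real p)" by (simp add: rate_def power_divide)
  have "(\<Sum>l=1..k. Re (ftr (?C l \<diamondop> ?C l))) = (\<Sum>l=1..k. (rate n)\<^sup>2 * Re (ftr (Ctup k x l \<diamondop> Ctup k x l)))"
    by (intro sum.cong refl) (auto simp: tsc_def ftr_csc simp del: of_real_power)
  also have "\<dots> = (rate n)\<^sup>2 * qsum k x" unfolding sum_distrib_left[symmetric] qsum_eq ..
  finally have s: "(\<Sum>l=1..k. Re (ftr (?C l \<diamondop> ?C l))) = (rate n)\<^sup>2 * qsum k x" .
  have "1 / (4 * real k) \<le> real (p * (n - k)) / real k * (rate n)\<^sup>2"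
    using p k n unfolding r2 by (simp add: of_nat_diff field_simps)
  then have "1 / (4 * real k) * qsum k x \<le> real (p * (n - k)) / real k * (rate n)\<^sup>2 * qsum k x"
    by (intro mult_right_mono qsum_nonneg)
  then have "exp (- (real (p * (n - k)) / real k) * ((rate n)\<^sup>2 * qsum k x)) \<le> exp (- (1 / (4 * real k)) * qsum k x)"
    by (simp add: mult.assoc)
  then show ?thesis using dens_le[OF C k, of "p * (n - k)"] unfolding s gn_def by linarith
qed

lemma gn_tendsto:
  assumes p: "1 \<le> p"
  shows "(\<lambda>n. gn k n x) \<longlonglongrightarrow> exp (- qsum k x / 2)"
proof -
  \<comment> \<open>\<open>rate 0\<close> is 0, being a division by zero, whereas
    \<open>dens_tendsto\<close> asks for nonzero scales.\<close>
  define e where "e n = (if n = 0 then 1 else rate n)" for n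
  have e0: "e n \<noteq> 0" for n using p by (auto simp: e_def rate_def)
  have ee: "eventually (\<lambda>n. rate n = e n) sequentially"
    using eventually_gt_at_top[of 0] by eventually_elim (simp add: e_def)
  have r2: "(rate n)\<^sup>2 = 1 / (2 * real n * real p)" for n by (simp add: rate_def power_divide)
  have i0: "(\<lambda>n. 1 / real n) \<longlonglongrightarrow> 0" by (rule lim_1_over_n)
  have "(\<lambda>n. sqrt (1 / real n * (1 / (2 * real p)))) \<longlonglongrightarrow> sqrt (0 * (1 / (2 * real p)))"
    by (intro tendsto_real_sqrt tendsto_mult i0 tendsto_const)
  moreover have "sqrt (1 / real n * (1 / (2 * real p))) = rate n" for n
    by (simp add: rate_def real_sqrt_divide mult_ac)
  ultimately have "rate \<longlonglongrightarrow> 0" by simp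
  then have e: "e \<longlonglongrightarrow> 0" by (rule Lim_transform_eventually[OF _ ee])
  have "(\<lambda>n. 1 / 2 - real k / 2 * (1 / real n)) \<longlonglongrightarrow> 1 / 2 - real k / 2 * 0"
    by (intro tendsto_intros i0)
  then have "(\<lambda>n. 1 / 2 - real k / 2 * (1 / real n)) \<longlonglongrightarrow> 1 / 2" by simp
  moreover have "eventually (\<lambda>n. 1 / 2 - real k / 2 * (1 / real n) = real (p * (n - k)) * (e n)\<^sup>2) sequentially"
    using ee eventually_ge_at_top[of "k + 1"]
  proof eventually_elim
    case (elim n)
    then show ?case using p unfolding elim(1)[symmetric] r2 by (simp add: of_nat_diff field_simps)
  qed
  ultimately have m: "(\<lambda>n. real (p * (n - k)) * (e n)\<^sup>2) \<longlonglongrightarrow> 1 / 2"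
    by (rule Lim_transform_eventually)
  have "(\<lambda>n. dens k (p * (n - k)) (tsc (e n) (Ctup k x))) \<longlonglongrightarrow> exp (- (1 / 2) * (\<Sum>l=1..k. Re (ftr (Ctup k x l \<diamondop> Ctup k x l))))"
    by (rule dens_tendsto[OF htup_Ctup e e0 m])
  then have "(\<lambda>n. dens k (p * (n - k)) (tsc (e n) (Ctup k x))) \<longlonglongrightarrow> exp (- qsum k x / 2)"
    unfolding qsum_eq by simp
  moreover have "eventually (\<lambda>n. dens k (p * (n - k)) (tsc (e n) (Ctup k x)) = gn k n x) sequentially"
    using ee by eventually_elim (simp add: gn_def)
  ultimately show ?thesis by (rule Lim_transform_eventually)
qed

lemma gn_nonneg: "0 \<le> gn k n x"
  unfolding gn_def by (rule dens_nonneg)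

lemma measurable_gn: "gn k n \<in> borel_measurable (lbI (cube k))"
  unfolding gn_def by (rule measurable_dens_tsc)

lemma integrable_gn:
  assumes "1 \<le> p" "1 \<le> k" "2 * k \<le> n"
  shows "integrable (lbI (cube k)) (gn k n)"
proof (rule Bochner_Integration.integrable_bound)
  show "integrable (lbI (cube k)) (\<lambda>x. exp (- (1 / (4 * real k)) * qsum k x))"
    using assms by (intro integrable_exp_qsum) simp
  show "AE x in lbI (cube k). norm (gn k n x) \<le> norm (exp (- (1 / (4 * real k)) * qsum k x))"
    using gn_le[OF assms] gn_nonneg by (intro AE_I2) (simp del: mult_minus_left)
qed (rule measurable_gn)

lemma integral_gn_tendsto:
  fixes f :: "(nat \<Rightarrow> cmx) \<Rightarrow> real"
  assumes p: "1 \<le> p" and k: "1 \<le> k" and f: "f \<in> borel_measurable borel" and B: "\<And>S. \<bar>f S\<bar> \<le> B"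
  shows "(\<lambda>n. \<integral>x. gn k n x * f (Tn k x) \<partial>lbI (cube k)) \<longlonglongrightarrow> (\<integral>x. exp (- qsum k x / 2) * f (Tn k x) \<partial>lbI (cube k))"
proof -
  have fT: "(\<lambda>x. f (Tn k x)) \<in> borel_measurable (lbI (cube k))" by (rule measurable_compose[OF measurable_Tn f])
  have "integrable (lbI (cube k)) (\<lambda>x. exp (- (1 / 2) * qsum k x))"
    by (rule integrable_exp_qsum) simp
  then have em: "(\<lambda>x. exp (- qsum k x / 2)) \<in> borel_measurable (lbI (cube k))" by simp
  \<comment> \<open>The majorant is available from \<open>2 * k\<close> on, hence the shift of the
    sequence.\<close>
  have "(\<lambda>n. \<integral>x. gn k (n + 2 * k) x * f (Tn k x) \<partial>lbI (cube k)) \<longlonglongrightarrow> (\<integral>x. exp (- qsum k x / 2) * f (Tn k x) \<partial>lbI (cube k))"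
  proof (rule integral_dominated_convergence[where w = "\<lambda>x. exp (- (1 / (4 * real k)) * qsum k x) * B"])
    show "integrable (lbI (cube k)) (\<lambda>x. exp (- (1 / (4 * real k)) * qsum k x) * B)"
      using k by (intro integrable_mult_left integrable_exp_qsum) simp
    show "AE x in lbI (cube k). (\<lambda>n. gn k (n + 2 * k) x * f (Tn k x)) \<longlonglongrightarrow> exp (- qsum k x / 2) * f (Tn k x)"
      by (intro AE_I2 tendsto_mult tendsto_const LIMSEQ_ignore_initial_segment gn_tendsto[OF p])
    show "AE x in lbI (cube k). norm (gn k (n + 2 * k) x * f (Tn k x)) \<le> exp (- (1 / (4 * real k)) * qsum k x) * B" for n
    proof (rule AE_I2)
      fix x
      have "\<bar>gn k (n + 2 * k) x\<bar> * \<bar>f (Tn k x)\<bar> \<le> exp (- (1 / (4 * real k)) * qsum k x) * B"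
        using gn_le[OF p k, of "n + 2 * k" x] gn_nonneg[of k "n + 2 * k" x] B
        by (intro mult_mono) (auto simp del: mult_minus_left)
      then show "norm (gn k (n + 2 * k) x * f (Tn k x)) \<le> exp (- (1 / (4 * real k)) * qsum k x) * B"
        by (simp only: real_norm_def abs_mult)
    qed
  qed (use em fT measurable_gn in \<open>auto intro!: borel_measurable_times\<close>)
  then show ?thesis by (rule LIMSEQ_offset)
qed

text \<open>\<open>A\<close> occurs both in the measure of an event and in the volume of the moment
  space and cancels, so in coordinates the statistic has density \<open>gn k n\<close> divided by
  its integral.\<close>

lemma integral_stat:
  fixes f :: "(nat \<Rightarrow> cmx) \<Rightarrow> real"
  assumes p: "1 \<le> p" and k: "1 \<le> k" and n: "2 * k \<le> n" and f: "f \<in> borel_measurable borel"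
    and z: "0 < (\<integral>x. gn k n x \<partial>lbI (cube k))"
  shows "(\<integral>S. f S \<partial>distr (unif_moment p n) borel (stat p k n)) =
    (\<integral>x. gn k n x * f (Tn k x) \<partial>lbI (cube k)) / (\<integral>x. gn k n x \<partial>lbI (cube k))"
proof -
  let ?M = "lbI (cube k)"
  define Z where "Z = (\<integral>x. gn k n x \<partial>?M)"
  have Z: "Z > 0" using z by (simp add: Z_def)
  have nZ: "(\<integral>\<^sup>+x. ennreal (gn k n x) \<partial>?M) = ennreal Z"
    unfolding Z_def using integrable_gn[OF p k n] gn_nonneg by (intro nn_integral_eq_integral) auto
  obtain A where A: "0 < A" "A < \<infinity>" and AF: "\<And>F. F \<in> borel_measurable borel \<Longrightarrow>
    (\<integral>\<^sup>+S. F (stat p k n S) * indicator (moment_space p n) S \<partial>leb_herm_tuple p n) =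
     A * (\<integral>\<^sup>+x. ennreal (gn k n x) * F (Tn k x) \<partial>?M)"
    using nn_integral_moment_space[of k n] p k n unfolding gn_def rate_def by auto
  have sl: "sets (leb_herm_tuple p n) = sets borel" by (simp add: leb_herm_tuple_def)
  have mom: "moment_space p n \<in> sets (leb_herm_tuple p n)" using sets_moment_space sl by simp
  have V: "emeasure (leb_herm_tuple p n) (moment_space p n) = A * ennreal Z"
    using AF[of "\<lambda>_. 1"] nZ mom by (simp add: nn_integral_indicator)
  have st: "stat p k n \<in> unif_moment p n \<rightarrow>\<^sub>M borel"
    using measurable_stat by (simp add: unif_moment_def sl cong: measurable_cong_sets)
  have eq: "distr (unif_moment p n) borel (stat p k n) = distr (density ?M (\<lambda>x. ennreal (gn k n x / Z))) borel (Tn k)"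
  proof (rule measure_eqI)
    fix D assume "D \<in> sets (distr (unif_moment p n) borel (stat p k n))"
    then have D: "D \<in> sets borel" by simp
    have sD: "stat p k n -` D \<in> sets borel" using measurable_sets[OF measurable_stat D] by simp
    have spu: "space (unif_moment p n) = UNIV" using sets_eq_imp_space_eq[OF sl] by (simp add: unif_moment_def)
    have "emeasure (distr (unif_moment p n) borel (stat p k n)) D = emeasure (unif_moment p n) (stat p k n -` D)"
      by (simp add: emeasure_distr[OF st D] spu)
    also have "\<dots> = emeasure (leb_herm_tuple p n) (moment_space p n \<inter> stat p k n -` D) / (A * ennreal Z)"
      unfolding unif_moment_def by (subst emeasure_uniform_measure) (use sD sl mom V in auto)
    also have "emeasure (leb_herm_tuple p n) (moment_space p n \<inter> stat p k n -` D) =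
       (\<integral>\<^sup>+S. indicator (moment_space p n \<inter> stat p k n -` D) S \<partial>leb_herm_tuple p n)"
      using sD sl mom by (intro nn_integral_indicator[symmetric]) auto
    also have "\<dots> = (\<integral>\<^sup>+S. indicator D (stat p k n S) * indicator (moment_space p n) S \<partial>leb_herm_tuple p n)"
      by (intro nn_integral_cong) (auto simp: indicator_def)
    also have "\<dots> = A * (\<integral>\<^sup>+x. ennreal (gn k n x) * indicator D (Tn k x) \<partial>?M)"
      by (rule AF) (use D in simp)
    also have "A * (\<integral>\<^sup>+x. ennreal (gn k n x) * indicator D (Tn k x) \<partial>?M) / (A * ennreal Z) =
       (\<integral>\<^sup>+x. ennreal (gn k n x) * indicator D (Tn k x) \<partial>?M) / ennreal Z"
      using divide_mult_eq[of A _ "ennreal Z"] A by (simp add: mult.commute[of A])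
    also have "\<dots> = (\<integral>\<^sup>+x. ennreal (gn k n x) * indicator D (Tn k x) / ennreal Z \<partial>?M)"
      using measurable_gn measurable_compose[OF measurable_Tn borel_measurable_indicator[OF D]]
      by (intro nn_integral_divide[symmetric] borel_measurable_times_ennreal) auto
    also have "\<dots> = (\<integral>\<^sup>+x. ennreal (gn k n x / Z) * indicator (Tn k -` D \<inter> space ?M) x \<partial>?M)"
      using Z gn_nonneg by (intro nn_integral_cong) (auto simp: indicator_def divide_ennreal)
    also have "\<dots> = emeasure (density ?M (\<lambda>x. ennreal (gn k n x / Z))) (Tn k -` D \<inter> space ?M)"
      using measurable_sets[OF measurable_Tn D] measurable_gn by (intro emeasure_density[symmetric]) auto
    also have "\<dots> = emeasure (distr (density ?M (\<lambda>x. ennreal (gn k n x / Z))) borel (Tn k)) D"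
      using measurable_Tn D by (subst emeasure_distr) auto
    finally show "emeasure (distr (unif_moment p n) borel (stat p k n)) D = emeasure (distr (density ?M (\<lambda>x. ennreal (gn k n x / Z))) borel (Tn k)) D" .
  qed simp
  have "(\<integral>S. f S \<partial>distr (unif_moment p n) borel (stat p k n)) = (\<integral>x. f (Tn k x) \<partial>density ?M (\<lambda>x. ennreal (gn k n x / Z)))"
    unfolding eq using measurable_Tn f by (intro integral_distr) auto
  also have "\<dots> = (\<integral>x. (gn k n x / Z) *\<^sub>R f (Tn k x) \<partial>?M)"
    using measurable_gn measurable_compose[OF measurable_Tn f] Z gn_nonneg
    by (intro integral_density) auto
  also have "\<dots> = (\<integral>x. gn k n x * f (Tn k x) / Z \<partial>?M)" by simp
  also have "\<dots> = (\<integral>x. gn k n x * f (Tn k x) \<partial>?M) / Z" by simp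
  finally show ?thesis by (simp add: Z_def)
qed

text \<open>Total mass 1 determines the prefactor \<open>\<gamma>\<close> as the reciprocal of the
  Gaussian integral, which gives the same quotient form as in \<open>integral_stat\<close>.\<close>

lemma integral_GUE_vec:
  fixes f :: "(nat \<Rightarrow> cmx) \<Rightarrow> real"
  assumes p: "1 \<le> p" and f: "f \<in> borel_measurable borel"
  shows "0 < (\<integral>x. exp (- qsum k x / 2) \<partial>lbI (cube k))"
    and "(\<integral>S. f S \<partial>GUE_vec p k) = (\<integral>x. exp (- qsum k x / 2) * f (Tn k x) \<partial>lbI (cube k)) / (\<integral>x. exp (- qsum k x / 2) \<partial>lbI (cube k))"
proof -
  let ?M = "lbI (cube k)"
  obtain \<gamma> where \<gamma>: "\<gamma> > 0" "\<And>x. Gd (cube k) snd x = \<gamma> * exp (- qsum k x / 2)"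
    using Gd_qsum[of k] by (elim exE conjE) simp
  have i: "integrable ?M (\<lambda>x. exp (- qsum k x / 2))"
    using integrable_exp_qsum[of "1/2" k] by simp
  have "(\<integral>\<^sup>+x. ennreal (Gd (cube k) snd x) \<partial>?M) = ennreal (\<integral>x. \<gamma> * exp (- qsum k x / 2) \<partial>?M)"
    unfolding \<gamma>(2) using \<gamma>(1) i by (intro nn_integral_eq_integral integrable_mult_right) auto
  then have "ennreal (\<gamma> * (\<integral>x. exp (- qsum k x / 2) \<partial>?M)) = 1"
    using nn_integral_Gd[OF finite_cube, of k snd] by simp
  then have g1: "\<gamma> * (\<integral>x. exp (- qsum k x / 2) \<partial>?M) = 1"
    by (simp add: ennreal_eq_1)
  show pos: "0 < (\<integral>x. exp (- qsum k x / 2) \<partial>?M)"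
    by (rule zero_less_mult_pos[OF _ \<gamma>(1)]) (simp only: g1 zero_less_one)
  have "(\<integral>S. f S \<partial>GUE_vec p k) = (\<integral>x. f (Tn k x) \<partial>density ?M (\<lambda>x. ennreal (Gd (cube k) snd x)))"
    unfolding GUE_vec_eq[OF p] using measurable_Tn f by (intro integral_distr) auto
  also have "\<dots> = (\<integral>x. Gd (cube k) snd x *\<^sub>R f (Tn k x) \<partial>?M)"
    by (intro integral_density AE_I2 Gd_nonneg measurable_Gd measurable_compose[OF measurable_Tn f])
  also have "\<dots> = \<gamma> * (\<integral>x. exp (- qsum k x / 2) * f (Tn k x) \<partial>?M)"
    by (simp add: \<gamma>(2) mult.assoc)
  finally have eq: "(\<integral>S. f S \<partial>GUE_vec p k) = \<gamma> * (\<integral>x. exp (- qsum k x / 2) * f (Tn k x) \<partial>?M)" .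
  show "(\<integral>S. f S \<partial>GUE_vec p k) = (\<integral>x. exp (- qsum k x / 2) * f (Tn k x) \<partial>?M) / (\<integral>x. exp (- qsum k x / 2) \<partial>?M)"
  proof -
    have "c * b = b / a" if "c * a = 1" for a b c :: real
      using that by (cases "a = 0") (auto simp: field_simps)
    from this[OF g1] show ?thesis unfolding eq .
  qed
qed

text \<open>Both expectations are quotients of integrals over the same coordinates. Numerator and
  denominator converge by \<open>integral_gn_tendsto\<close>, the denominator being the case of the
  constant function 1.\<close>

lemma conv_in_distr_stat:
  assumes p: "1 \<le> p" and k: "1 \<le> k"
  shows "conv_in_distr (\<lambda>n. distr (unif_moment p n) borel (stat p k n)) (GUE_vec p k)"
  unfolding conv_in_distr_def
proof (intro allI impI)
  fix f :: "(nat \<Rightarrow> cmx) \<Rightarrow> real" assume "continuous_on UNIV f \<and> bounded (range f)"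
  then have f: "f \<in> borel_measurable borel" and "bounded (range f)"
    by (auto intro: borel_measurable_continuous_onI)
  then obtain B where B: "\<And>S. \<bar>f S\<bar> \<le> B" by (auto simp: bounded_iff)
  let ?z = "\<lambda>n. \<integral>x. gn k n x \<partial>lbI (cube k)"
  have z: "?z \<longlonglongrightarrow> (\<integral>x. exp (- qsum k x / 2) \<partial>lbI (cube k))"
    using integral_gn_tendsto[OF p k, of "\<lambda>_. 1" 1] by simp
  have pos: "0 < (\<integral>x. exp (- qsum k x / 2) \<partial>lbI (cube k))" by (rule integral_GUE_vec(1)[OF p f])
  have "(\<lambda>n. (\<integral>x. gn k n x * f (Tn k x) \<partial>lbI (cube k)) / ?z n) \<longlonglongrightarrow> (\<integral>S. f S \<partial>GUE_vec p k)"
    unfolding integral_GUE_vec(2)[OF p f]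
    by (intro tendsto_divide integral_gn_tendsto[OF p k f B] z) (use pos in simp)
  moreover have "eventually (\<lambda>n. (\<integral>x. gn k n x * f (Tn k x) \<partial>lbI (cube k)) / ?z n =
      (\<integral>S. f S \<partial>distr (unif_moment p n) borel (stat p k n))) sequentially"
    using order_tendstoD(1)[OF z pos] eventually_ge_at_top[of "2 * k"]
    by eventually_elim (simp add: integral_stat[OF p k _ f])
  ultimately show "(\<lambda>n. \<integral>S. f S \<partial>distr (unif_moment p n) borel (stat p k n)) \<longlonglongrightarrow> (\<integral>S. f S \<partial>GUE_vec p k)"
    by (rule Lim_transform_eventually)
qed

end

theorem theorem5p3:
  fixes p k :: nat
  assumes "1 \<le> p" and "1 \<le> k"
  shows "conv_in_distr (\<lambda>n. distr (unif_moment p n) borel (stat p k n)) (GUE_vec p k)"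
  using assms by (rule cmats.conv_in_distr_stat)

end
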